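(* Let $G$ be a Cohen--Macaulay very well-covered graph with $2n$ vertices $x_1,\dots,x_n,y_1,\dots,y_n$ in standard labelling. Let $N[x_n]=\{x_{i_1},x_{i_2},\dots,x_{i_t},x_n,y_n\}$ and $N[y_n]=\{x_{j_1},x_{j_2},\dots,x_{j_p},x_n,y_n\}$, and define $$G_1=G\setminus\{x_{i_1},y_{i_1},\dots,x_{i_t},y_{i_t},x_n,y_n\},\qquad G_2=G\setminus\{x_{j_1},y_{j_1},\dots,x_{j_p},y_{j_p},x_n,y_n\}.$$ Then $$I(G)^\vee=x_{i_1}x_{i_2}\cdots x_{i_t}\,y_n\,I(G_1)^\vee+x_{j_1}x_{j_2}\cdots x_{j_p}\,x_n\,I(G_2)^\vee$$ is a Betti splitting.
   Context: Graphs are finite, simple and undirected. $K$ is a field, $S=K[x_1,\dots,x_n,y_1,\dots,y_n]$, and vertices are identified with variables of $S$. The edge ideal $I(G)$ is generated by the products of the endpoints of edges of $G$; the cover ideal $I(G)^\vee$ is generated by the monomials $\prod_{z\in C}z$, $C$ a minimal vertex cover of $G$. Cover ideals of induced subgraphs are regarded as ideals of $S$ (generated by the same monomials); the cover ideal of the graph with no vertices is $S=(1)$. $G$ is unmixed if all minimal vertex covers have the same cardinality; $G$ is very well-covered if it is unmixed, has no isolated vertices, and $2\,\mathrm{height}(I(G))=|V(G)|$; $G$ is Cohen--Macaulay if $S/I(G)$ is a Cohen--Macaulay ring. For $W\subseteq V(G)$, $G\setminus W$ is the graph obtained by deleting the vertices in $W$ and their incident edges. $N[z]$ is the closed neighborhood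 of the vertex $z$ ($z$ together with its neighbors). Standard labelling: a Cohen--Macaulay very well-covered graph with $2n$ vertices always admits a labelling $V(G)=\{x_1,\dots,x_n,y_1,\dots,y_n\}$ such that: (i) $X=\{x_1,\dots,x_n\}$ is a minimal vertex cover and $Y=\{y_1,\dots,y_n\}$ is a maximal independent set; (ii) $x_iy_i\in E(G)$ for all $i$; (iii) if $x_iy_j\in E(G)$ then $i\le j$; (iv) if $x_iy_j\in E(G)$ then $x_ix_j\notin E(G)$; (v) if $z_ix_j,\,y_jx_k\in E(G)$ then $z_ix_k\in E(G)$, for any distinct $i,j,k$ and $z_i\in\{x_i,y_i\}$. Any labelling satisfying (i)--(v) is called standard; in it, $N[x_n]$ and $N[y_n]$ have the displayed form with all indices $i_r,j_q<n$. For a monomial ideal $I$, $G(I)$ is its minimal set of monomial generators. If $I,P,Q$ are monomial ideals with $G(I)$ the disjoint union of $G(P)$ and $G(Q)$, then $I=P+Q$ is a Betti splitting if $\beta_{i,j}(I)=\beta_{i,j}(P)+\beta_{i,j}(Q)+\beta_{i-1,j}(P\cap Q)$ for all $i,j$ (graded Betti numbers). *)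

theory Defs
  imports
    "HOL-Library.Poly_Mapping"
    "HOL-Library.Extended_Nat"
    "HOL-Algebra.Algebra"
    "HOL-Algebra.Algebraic_Closure_Type"
    "Jordan_Normal_Form.Matrix_Kernel"
begin

section \<open>Commutative algebra\<close>

definition prime_height :: "('a, 'b) ring_scheme \<Rightarrow> 'a set \<Rightarrow> enat" where
  "prime_height R p = Sup {enat k | k. \<exists>c :: nat \<Rightarrow> 'a set.
     (\<forall>i\<le>k. primeideal (c i) R) \<and> (\<forall>i<k. c i \<subset> c (Suc i)) \<and> c k = p}"

definition ideal_height :: "('a, 'b) ring_scheme \<Rightarrow> 'a set \<Rightarrow> enat" where
  "ideal_height R I = Inf {prime_height R p | p. primeideal p R \<and> I \<subseteq> p}"

definition krull_dim :: "('a, 'b) ring_scheme \<Rightarrow> enat" where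
  "krull_dim R = Sup {prime_height R p | p. primeideal p R}"

text \<open>Membership of \<open>x r\<close> in \<open>(x\<^sub>1, \<dots>, x\<^sub>k)\<close> says that \<open>x\<close> annihilates the class of
  \<open>r\<close> in \<open>R/(x\<^sub>1, \<dots>, x\<^sub>k)\<close>.\<close>

definition regular_sequence :: "('a, 'b) ring_scheme \<Rightarrow> 'a list \<Rightarrow> bool" where
  "regular_sequence R xs \<longleftrightarrow>
     set xs \<subseteq> carrier R \<and> Idl\<^bsub>R\<^esub> (set xs) \<noteq> carrier R \<and>
     (\<forall>k<length xs. \<forall>r\<in>carrier R.
        (xs ! k) \<otimes>\<^bsub>R\<^esub> r \<in> Idl\<^bsub>R\<^esub> (set (take k xs)) \<longrightarrow> r \<in> Idl\<^bsub>R\<^esub> (set (take k xs)))"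

definition local_depth :: "('a, 'b) ring_scheme \<Rightarrow> enat" where
  "local_depth R = Sup {enat (length xs) | xs.
     regular_sequence R xs \<and> set xs \<subseteq> (THE m. maximalideal m R)}"

text \<open>The fraction \<open>a/s\<close>, as an equivalence class of pairs.\<close>

definition loc_frac :: "('a, 'b) ring_scheme \<Rightarrow> 'a set \<Rightarrow> 'a \<Rightarrow> 'a \<Rightarrow> ('a \<times> 'a) set" where
  "loc_frac R p a s = {(b, t). b \<in> carrier R \<and> t \<in> carrier R - p \<and>
     (\<exists>u\<in>carrier R - p. u \<otimes>\<^bsub>R\<^esub> (t \<otimes>\<^bsub>R\<^esub> a) = u \<otimes>\<^bsub>R\<^esub> (s \<otimes>\<^bsub>R\<^esub> b))}"

text \<open>The localization of \<open>R\<close> at a prime ideal \<open>p\<close>. In both operations, all members of the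
  unions are the same class.\<close>

definition localization :: "('a, 'b) ring_scheme \<Rightarrow> 'a set \<Rightarrow> ('a \<times> 'a) set ring" where
  "localization R p = \<lparr>
     carrier = {loc_frac R p a s | a s. a \<in> carrier R \<and> s \<in> carrier R - p},
     monoid.mult = (\<lambda>A B. \<Union>(a, s)\<in>A. \<Union>(b, t)\<in>B. loc_frac R p (a \<otimes>\<^bsub>R\<^esub> b) (s \<otimes>\<^bsub>R\<^esub> t)),
     monoid.one = loc_frac R p \<one>\<^bsub>R\<^esub> \<one>\<^bsub>R\<^esub>,
     ring.zero = loc_frac R p \<zero>\<^bsub>R\<^esub> \<one>\<^bsub>R\<^esub>,
     ring.add = (\<lambda>A B. \<Union>(a, s)\<in>A. \<Union>(b, t)\<in>B.
              loc_frac R p ((a \<otimes>\<^bsub>R\<^esub> t) \<oplus>\<^bsub>R\<^esub> (b \<otimes>\<^bsub>R\<^esub> s)) (s \<otimes>\<^bsub>R\<^esub> t))\<rparr>"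

definition cohen_macaulay_ring :: "('a, 'b) ring_scheme \<Rightarrow> bool" where
  "cohen_macaulay_ring R \<longleftrightarrow> cring R \<and> noetherian_ring R \<and>
     (\<forall>m. maximalideal m R \<longrightarrow>
        local_depth (localization R m) = krull_dim (localization R m))"


section \<open>The polynomial ring and monomial ideals\<close>

text \<open>Polynomials over \<open>'k\<close> whose variables are the elements of the type \<open>'v\<close>; for finite
  \<open>'v\<close> this is the polynomial ring in \<open>CARD('v)\<close> variables.\<close>

type_synonym ('v, 'k) mpoly = "('v \<Rightarrow>\<^sub>0 nat) \<Rightarrow>\<^sub>0 'k"

abbreviation poly_ring :: "('v, 'k::field) mpoly ring" where
  "poly_ring \<equiv> ring_of_type_algebra"

definition var :: "'v \<Rightarrow> ('v, 'k::field) mpoly" where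
  "var v = Poly_Mapping.single (Poly_Mapping.single v 1) 1"

definition monomials :: "('v, 'k::field) mpoly set" where
  "monomials = range (\<lambda>m. Poly_Mapping.single m 1)"

definition monomial_degree :: "('v \<Rightarrow>\<^sub>0 nat) \<Rightarrow> nat" where
  "monomial_degree m = (\<Sum>v\<in>Poly_Mapping.keys m. Poly_Mapping.lookup m v)"

definition homogeneous :: "int \<Rightarrow> ('v, 'k::field) mpoly \<Rightarrow> bool" where
  "homogeneous e f \<longleftrightarrow> (\<forall>m\<in>Poly_Mapping.keys f. int (monomial_degree m) = e)"

definition monomial_ideal :: "('v, 'k::field) mpoly set \<Rightarrow> bool" where
  "monomial_ideal I \<longleftrightarrow> (\<exists>A\<subseteq>monomials. I = Idl\<^bsub>poly_ring\<^esub> A)"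

definition min_monomial_gens :: "('v, 'k::field) mpoly set \<Rightarrow> ('v, 'k) mpoly set" where
  "min_monomial_gens I = (THE A. A \<subseteq> monomials \<and> Idl\<^bsub>poly_ring\<^esub> A = I \<and>
     (\<forall>B. B \<subset> A \<longrightarrow> Idl\<^bsub>poly_ring\<^esub> B \<noteq> I))"


section \<open>Graded Betti numbers\<close>

text \<open>A graded free resolution \<open>\<dots> \<rightarrow> F\<^sub>1 \<rightarrow> F\<^sub>0 \<rightarrow> I \<rightarrow> 0\<close> of an ideal \<open>I\<close> of the polynomial
  ring \<open>S\<close>. The list \<open>sh i\<close> consists of the degrees of the basis elements of \<open>F\<^sub>i\<close>, so that
  \<open>F\<^sub>i\<close> is the direct sum of the \<open>S(-e)\<close> with \<open>e\<close> in \<open>sh i\<close>. The one-row matrix \<open>d 0\<close>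
  is the augmentation, regarded as a map from \<open>F\<^sub>0\<close> to \<open>S\<close>, and \<open>d (i + 1)\<close> is the
  differential from \<open>F\<^sub>i\<^sub>+\<^sub>1\<close> to \<open>F\<^sub>i\<close>.\<close>

definition graded_free_resolution ::
  "(nat \<Rightarrow> int list) \<Rightarrow> (nat \<Rightarrow> ('v, 'k::field) mpoly mat) \<Rightarrow> ('v, 'k) mpoly set \<Rightarrow> bool" where
  "graded_free_resolution sh d I \<longleftrightarrow>
     d 0 \<in> carrier_mat 1 (length (sh 0)) \<and>
     (\<forall>c<length (sh 0). homogeneous (sh 0 ! c) (d 0 $$ (0, c))) \<and>
     (\<lambda>v. (d 0 *\<^sub>v v) $ 0) ` carrier_vec (length (sh 0)) = I \<and>
     (\<forall>i. d (Suc i) \<in> carrier_mat (length (sh i)) (length (sh (Suc i))) \<and>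
        (\<forall>r<length (sh i). \<forall>c<length (sh (Suc i)).
           homogeneous (sh (Suc i) ! c - sh i ! r) (d (Suc i) $$ (r, c))) \<and>
        (\<lambda>v. d (Suc i) *\<^sub>v v) ` carrier_vec (length (sh (Suc i))) = mat_kernel (d i))"

definition minimal_graded_free_resolution ::
  "(nat \<Rightarrow> int list) \<Rightarrow> (nat \<Rightarrow> ('v, 'k::field) mpoly mat) \<Rightarrow> ('v, 'k) mpoly set \<Rightarrow> bool" where
  "minimal_graded_free_resolution sh d I \<longleftrightarrow> graded_free_resolution sh d I \<and>
     (\<forall>i. \<forall>r<length (sh i). \<forall>c<length (sh (Suc i)).
        d (Suc i) $$ (r, c) \<in> Idl\<^bsub>poly_ring\<^esub> (range var))"

text \<open>The homological degree is an integer, so that \<open>\<beta>\<^sub>-\<^sub>1\<^sub>,\<^sub>j = 0\<close> makes sense. The minimal graded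
  free resolution is unique up to isomorphism, so the value does not depend on its choice.\<close>

definition betti :: "('v, 'k::field) mpoly set \<Rightarrow> int \<Rightarrow> int \<Rightarrow> nat" where
  "betti I i j = (if i < 0 then 0 else
     (THE b. \<exists>sh d. minimal_graded_free_resolution sh d I \<and> b = count_list (sh (nat i)) j))"

definition betti_splitting ::
  "('v, 'k::field) mpoly set \<Rightarrow> ('v, 'k) mpoly set \<Rightarrow> ('v, 'k) mpoly set \<Rightarrow> bool" where
  "betti_splitting I P Q \<longleftrightarrow>
     monomial_ideal I \<and> monomial_ideal P \<and> monomial_ideal Q \<and>
     min_monomial_gens I = min_monomial_gens P \<union> min_monomial_gens Q \<and>
     min_monomial_gens P \<inter> min_monomial_gens Q = {} \<and>
     I = P <+>\<^bsub>poly_ring\<^esub> Q \<and>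
     (\<forall>i j. betti I i j = betti P i j + betti Q i j + betti (P \<inter> Q) (i - 1) j)"


section \<open>Graphs\<close>

record 'v graph =
  verts :: "'v set"
  edges :: "'v set set"

definition simple_graph :: "'v graph \<Rightarrow> bool" where
  "simple_graph G \<longleftrightarrow> finite (verts G) \<and> (\<forall>e\<in>edges G. e \<subseteq> verts G \<and> card e = 2)"

definition delete_verts :: "'v graph \<Rightarrow> 'v set \<Rightarrow> 'v graph" where
  "delete_verts G W = \<lparr>verts = verts G - W, edges = {e \<in> edges G. e \<inter> W = {}}\<rparr>"

definition closed_nbhd :: "'v graph \<Rightarrow> 'v \<Rightarrow> 'v set" where
  "closed_nbhd G z = insert z {w. {z, w} \<in> edges G}"

definition vertex_cover :: "'v graph \<Rightarrow> 'v set \<Rightarrow> bool" where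
  "vertex_cover G C \<longleftrightarrow> C \<subseteq> verts G \<and> (\<forall>e\<in>edges G. e \<inter> C \<noteq> {})"

definition minimal_vertex_cover :: "'v graph \<Rightarrow> 'v set \<Rightarrow> bool" where
  "minimal_vertex_cover G C \<longleftrightarrow> vertex_cover G C \<and> (\<forall>D. D \<subset> C \<longrightarrow> \<not> vertex_cover G D)"

definition independent_set :: "'v graph \<Rightarrow> 'v set \<Rightarrow> bool" where
  "independent_set G A \<longleftrightarrow> A \<subseteq> verts G \<and> (\<forall>e\<in>edges G. \<not> e \<subseteq> A)"

definition maximal_independent_set :: "'v graph \<Rightarrow> 'v set \<Rightarrow> bool" where
  "maximal_independent_set G A \<longleftrightarrow>
     independent_set G A \<and> (\<forall>B. A \<subset> B \<longrightarrow> \<not> independent_set G B)"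

definition edge_ideal :: "'v graph \<Rightarrow> ('v, 'k::field) mpoly set" where
  "edge_ideal G = Idl\<^bsub>poly_ring\<^esub> {var u * var v | u v. {u, v} \<in> edges G}"

definition cover_ideal :: "'v graph \<Rightarrow> ('v, 'k::field) mpoly set" where
  "cover_ideal G = Idl\<^bsub>poly_ring\<^esub> {\<Prod>z\<in>C. var z | C. minimal_vertex_cover G C}"

definition unmixed :: "'v graph \<Rightarrow> bool" where
  "unmixed G \<longleftrightarrow>
     (\<forall>C D. minimal_vertex_cover G C \<and> minimal_vertex_cover G D \<longrightarrow> card C = card D)"

definition no_isolated_verts :: "'v graph \<Rightarrow> bool" where
  "no_isolated_verts G \<longleftrightarrow> (\<forall>v\<in>verts G. \<exists>e\<in>edges G. v \<in> e)"

text \<open>In the next two definitions the polynomial ring is the one over \<open>'k\<close> with variables the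
  whole type \<open>'v\<close>; they are meant for \<open>verts G = UNIV\<close>.\<close>

definition very_well_covered :: "'k::field itself \<Rightarrow> 'v graph \<Rightarrow> bool" where
  "very_well_covered K G \<longleftrightarrow> unmixed G \<and> no_isolated_verts G \<and>
     2 * ideal_height poly_ring (edge_ideal G :: ('v, 'k) mpoly set) = enat (card (verts G))"

definition cohen_macaulay_graph :: "'k::field itself \<Rightarrow> 'v graph \<Rightarrow> bool" where
  "cohen_macaulay_graph K G \<longleftrightarrow>
     cohen_macaulay_ring (poly_ring Quot (edge_ideal G :: ('v, 'k) mpoly set))"

definition standard_labelling ::
  "'v graph \<Rightarrow> nat \<Rightarrow> (nat \<Rightarrow> 'v) \<Rightarrow> (nat \<Rightarrow> 'v) \<Rightarrow> bool" where
  "standard_labelling G n x y \<longleftrightarrow>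
     inj_on x {1..n} \<and> inj_on y {1..n} \<and> x ` {1..n} \<inter> y ` {1..n} = {} \<and>
     verts G = x ` {1..n} \<union> y ` {1..n} \<and>
     minimal_vertex_cover G (x ` {1..n}) \<and> maximal_independent_set G (y ` {1..n}) \<and>
     (\<forall>i\<in>{1..n}. {x i, y i} \<in> edges G) \<and>
     (\<forall>i\<in>{1..n}. \<forall>j\<in>{1..n}. {x i, y j} \<in> edges G \<longrightarrow> i \<le> j) \<and>
     (\<forall>i\<in>{1..n}. \<forall>j\<in>{1..n}. {x i, y j} \<in> edges G \<longrightarrow> {x i, x j} \<notin> edges G) \<and>
     (\<forall>i\<in>{1..n}. \<forall>j\<in>{1..n}. \<forall>k\<in>{1..n}. \<forall>z\<in>{x i, y i}.
        i \<noteq> j \<and> j \<noteq> k \<and> i \<noteq> k \<and> {z, x j} \<in> edges G \<and> {y j, x k} \<in> edges G \<longrightarrow>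
        {z, x k} \<in> edges G)"

end

theory Submission
  imports Defs
begin

text \<open>Put \<open>x = x\<^sub>n\<close> and \<open>y = y\<^sub>n\<close>. A minimal vertex cover avoiding \<open>x\<close> contains all neighbours of
  \<open>x\<close>, and one containing \<open>x\<close> avoids \<open>y\<close> and contains all neighbours of \<open>y\<close>; this
  identifies the two summands with \<open>y P\<close> and \<open>x Q\<close>, where the generators of the monomial ideals \<open>P\<close>
  and \<open>Q\<close> involve neither \<open>x\<close> nor \<open>y\<close>. Then \<open>y P \<inter> x Q = x y (P \<inter> Q)\<close>, so the inclusions of the intersection
  into the summands are \<open>x\<close> and \<open>y\<close> times the inclusions of \<open>P \<inter> Q\<close> into \<open>P\<close> and \<open>Q\<close>. Hence
  they lift to maps of minimal resolutions with entries in the maximal ideal, and the mapping cone is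
  a minimal resolution of the sum.\<close>

text \<open>Two obstacles shape the development. \<open>betti\<close> is a definite description over
  minimal resolutions of unbounded length, so before a Betti number can be read off, such
  resolutions must be shown to exist and to have determined shifts. For uniqueness, comparison maps
  are reduced modulo the variables: \<open>const\<close> is a ring homomorphism to the field that
  kills the differentials of minimal resolutions, and with them the homotopies, so mutually inverse
  matrices over the field remain. Existence uses the grading by exponent vectors, whose homogeneous
  polynomials are scalar multiples of monomials: finite generation of syzygies becomes a matter of
  finitely many supports, and discarding a redundant generator becomes division by a scalar. Total
  degree then yields the integer shifts.

  On the graph side the delicate vertices are the deleted partners \<open>y i\<close> of the forced
  neighbours \<open>x i\<close>. Unmixedness keeps them out of the cover, because it makes a minimal
  cover meet each edge \<open>{x i, y i}\<close> exactly once; conditions (iii) and (v) of the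
  labelling show that their edges are covered anyway.\<close>

no_notation fps_nth (infixl \<open>$\<close> 75)

section \<open>Polynomials and restriction of their support\<close>

text \<open>Homogeneous components for total degree, components for a multidegree, constant terms
  and the splitting of a polynomial along a sum of monomial ideals are all instances, for different
  sets \<open>S\<close> of exponents.\<close>

lift_definition restr :: "'a set \<Rightarrow> ('a \<Rightarrow>\<^sub>0 'b::zero) \<Rightarrow> ('a \<Rightarrow>\<^sub>0 'b)"
  is "\<lambda>S f k. if k \<in> S then f k else 0"
  by (rule finite_subset) (auto split: if_splits)

lemma lookup_restr: "Poly_Mapping.lookup (restr S f) k = (if k \<in> S then Poly_Mapping.lookup f k else 0)"
  by transfer simp

lemma keys_restr: "Poly_Mapping.keys (restr S f) = Poly_Mapping.keys f \<inter> S"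
  by (auto simp: in_keys_iff lookup_restr split: if_splits)

lemma restr_sum: "restr S (sum f A) = (\<Sum>a\<in>A. restr S (f a))"
  by (rule poly_mapping_eqI) (auto simp: lookup_restr lookup_sum)

lemma restr_id: "Poly_Mapping.keys f \<subseteq> S \<Longrightarrow> restr S f = f"
  by (rule poly_mapping_eqI) (auto simp: lookup_restr in_keys_iff)

lemma restr_zero [simp]: "restr S 0 = 0"
  by (rule poly_mapping_eqI) (simp add: lookup_restr)

lemma restr_disjoint: "Poly_Mapping.keys f \<inter> S = {} \<Longrightarrow> restr S f = 0"
  by (rule poly_mapping_eqI) (auto simp: lookup_restr in_keys_iff)

lemma keys_times: 
  fixes f g :: "'a::monoid_add \<Rightarrow>\<^sub>0 'b::semiring_0"
  assumes "k \<in> Poly_Mapping.keys (f * g)"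
  obtains a b where "a \<in> Poly_Mapping.keys f" "b \<in> Poly_Mapping.keys g" "k = a + b"
  using assms keys_mult[of f g] by blast

text \<open>Every exponent of \<open>f\<close> translates \<open>S\<close> into \<open>T\<close> and
  the complement of \<open>S\<close> into the complement of \<open>T\<close>. The products of
  \<open>f\<close> with the two halves of \<open>g\<close> therefore have separate supports, and
  selecting \<open>T\<close> keeps exactly the first.\<close>

lemma restr_times:
  fixes f g :: "('v, 'k::field) mpoly"
  assumes "\<And>m m'. m \<in> Poly_Mapping.keys f \<Longrightarrow> m + m' \<in> T \<longleftrightarrow> m' \<in> S"
  shows "restr T (f * g) = f * restr S g"
proof -
  have g: "g = restr S g + restr (- S) g"
    by (rule poly_mapping_eqI) (auto simp: lookup_restr lookup_add)
  have "restr T (f * g) = restr T (f * restr S g) + restr T (f * restr (- S) g)"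
    by (subst (1) g, rule poly_mapping_eqI) (auto simp: lookup_restr lookup_add distrib_left)
  also have "restr T (f * restr S g) = f * restr S g"
    using assms by (intro restr_id subsetI, elim keys_times) (auto simp: keys_restr)
  also have "restr T (f * restr (- S) g) = 0"
    using assms by (intro restr_disjoint, auto, elim keys_times) (auto simp: keys_restr)
  finally show ?thesis by simp
qed

lemma keys_sum_subset:
  assumes "\<And>i. i \<in> I \<Longrightarrow> Poly_Mapping.keys (f i) \<subseteq> S"
  shows "Poly_Mapping.keys (sum f I) \<subseteq> S"
proof (cases "finite I")
  case True
  then show ?thesis using assms
  proof (induction I rule: finite_induct)
    case (insert i I)
    have "Poly_Mapping.keys (f i + sum f I) \<subseteq> Poly_Mapping.keys (f i) \<union> Poly_Mapping.keys (sum f I)"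
      by (rule Poly_Mapping.keys_add)
    then show ?case using insert by auto
  qed simp
qed simp

lemma poly_mapping_eq_sum_single:
  "f = (\<Sum>m\<in>Poly_Mapping.keys f. Poly_Mapping.single m (Poly_Mapping.lookup f m))"
proof (rule poly_mapping_eqI)
  fix k
  have "Poly_Mapping.lookup (\<Sum>m\<in>Poly_Mapping.keys f. Poly_Mapping.single m (Poly_Mapping.lookup f m)) k
    = (\<Sum>m\<in>Poly_Mapping.keys f. if m = k then Poly_Mapping.lookup f k else 0)"
    by (auto simp: lookup_sum lookup_single when_def intro!: sum.cong)
  also have "\<dots> = Poly_Mapping.lookup f k"
    by (simp add: in_keys_iff)
  finally show "Poly_Mapping.lookup f k = Poly_Mapping.lookup (\<Sum>m\<in>Poly_Mapping.keys f. Poly_Mapping.single m (Poly_Mapping.lookup f m)) k" ..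
qed

text \<open>Addition of exponents is cancellative, so only the term of \<open>f\<close> at
  \<open>m\<close> can contribute to \<open>a + m\<close>: this is \<open>restr_times\<close> for
  the singletons \<open>{a + m}\<close> and \<open>{m}\<close>.\<close>

lemma lookup_single_times:
  fixes f :: "('v, 'k::field) mpoly"
  shows "Poly_Mapping.lookup (Poly_Mapping.single a c * f) (a + m) = c * Poly_Mapping.lookup f m"
proof -
  have "Poly_Mapping.lookup (Poly_Mapping.single a c * f) (a + m) = Poly_Mapping.lookup (restr {a + m} (Poly_Mapping.single a c * f)) (a + m)"
    by (simp add: lookup_restr)
  also have "restr {a + m} (Poly_Mapping.single a c * f) = Poly_Mapping.single a c * restr {m} f"
    by (rule restr_times) (auto split: if_splits)
  also have "restr {m} f = Poly_Mapping.single m (Poly_Mapping.lookup f m)"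
    by (rule poly_mapping_eqI) (auto simp: lookup_restr lookup_single when_def)
  finally show ?thesis by (simp add: mult_single)
qed

lemma single_times_cancel:
  fixes f :: "('v, 'k::field) mpoly"
  assumes "Poly_Mapping.single a 1 * f = Poly_Mapping.single a 1 * g"
  shows "f = g"
proof (rule poly_mapping_eqI)
  fix m
  show "Poly_Mapping.lookup f m = Poly_Mapping.lookup g m"
    using arg_cong[OF assms, of "\<lambda>h. Poly_Mapping.lookup h (a + m)"] by (simp add: lookup_single_times)
qed

lemma keys_single_times:
  fixes f :: "('v, 'k::field) mpoly"
  shows "Poly_Mapping.keys (Poly_Mapping.single a 1 * f) = (+) a ` Poly_Mapping.keys f"
proof
  show "Poly_Mapping.keys (Poly_Mapping.single a 1 * f) \<subseteq> (+) a ` Poly_Mapping.keys f"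
    by (auto elim!: keys_times split: if_splits)
  show "(+) a ` Poly_Mapping.keys f \<subseteq> Poly_Mapping.keys (Poly_Mapping.single a 1 * f)"
    by (auto simp: in_keys_iff lookup_single_times)
qed

lemma var_times_cancel: "var v * f = var v * g \<Longrightarrow> f = g"
  unfolding var_def by (rule single_times_cancel)

text \<open>The residue map of the maximal ideal generated by the variables. Applied entrywise, it
  reduces matrices of polynomials to matrices over the field.\<close>

definition const :: "('v, 'k::field) mpoly \<Rightarrow> 'k" where
  "const f = Poly_Mapping.lookup f 0"

lemma exp_add_eq_0_iff: "(a::'v \<Rightarrow>\<^sub>0 nat) + b = 0 \<longleftrightarrow> a = 0 \<and> b = 0"
  by (metis add.right_neutral lookup_add lookup_zero poly_mapping_eqI zero_eq_add_iff_both_eq_0)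

lemma const_simps [simp]:
  "const 0 = 0" "const 1 = 1" "const (f + g) = const f + const g" "const (f - g) = const f - const g"
  "const (- f) = - const f"
  by (simp_all add: const_def lookup_add lookup_minus lookup_one)

lemma const_sum: "const (sum f A) = (\<Sum>a\<in>A. const (f a))"
  by (simp add: const_def lookup_sum)

text \<open>A sum of exponents is \<open>0\<close> only if both are, so the terms of
  \<open>f\<close> with nonzero exponent never reach the constant term of the product.\<close>

lemma const_times [simp]: "const (f * g) = const f * const g"
proof -
  have "f = restr {0} f + restr (-{0}) f" 
    by (rule poly_mapping_eqI) (auto simp: lookup_restr lookup_add)
  also have "restr {0} f = Poly_Mapping.single 0 (const f)"
    by (rule poly_mapping_eqI) (auto simp: lookup_restr lookup_single when_def const_def)
  finally have f: "f * g = Poly_Mapping.single 0 (const f) * g + restr (-{0}) f * g"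
    by (metis distrib_right)
  have "0 \<notin> Poly_Mapping.keys (restr (-{0}) f * g)"
    by (auto simp: keys_restr exp_add_eq_0_iff elim: keys_times)
  then have "const (restr (-{0}) f * g) = 0"
    by (simp add: const_def in_keys_iff)
  then show ?thesis
    using lookup_single_times[of 0 "const f" g 0] unfolding f by (simp add: const_def lookup_add)
qed

lemma const_var [simp]: "const (var v) = 0"
  by (auto simp: const_def var_def lookup_single when_def poly_mapping_eq_iff fun_eq_iff)

section \<open>Monomial ideals\<close>

lemma poly_ring_simps [simp]:
  "carrier poly_ring = UNIV" "monoid.mult poly_ring = (*)" "ring.add poly_ring = (+)"
  "monoid.one poly_ring = 1" "ring.zero poly_ring = 0"
  by (auto simp: ring_of_type_algebra_def)

lemma cring_poly_ring: "cring poly_ring"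
  by (rule cring_from_type_algebra)

lemma ring_poly_ring: "ring poly_ring"
  by (rule ring_from_type_algebra)

text \<open>Closure under negation is multiplication by \<open>-1\<close>, and commutativity reduces
  the two absorption laws to one.\<close>

lemma ideal_poly_ring_iff:
  "ideal I (poly_ring :: ('v, 'k::field) mpoly ring) \<longleftrightarrow>
     0 \<in> I \<and> (\<forall>f\<in>I. \<forall>g\<in>I. f + g \<in> I) \<and> (\<forall>f\<in>I. \<forall>g. g * f \<in> I)"
proof
  assume I: "ideal I (poly_ring :: ('v, 'k::field) mpoly ring)"
  interpret ideal I "poly_ring :: ('v, 'k::field) mpoly ring" by (rule I)
  show "0 \<in> I \<and> (\<forall>f\<in>I. \<forall>g\<in>I. f + g \<in> I) \<and> (\<forall>f\<in>I. \<forall>g. g * f \<in> I)"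
    using additive_subgroup.zero_closed[OF additive_subgroup_axioms]
      additive_subgroup.a_closed[OF additive_subgroup_axioms] I_l_closed by auto
next
  assume I: "0 \<in> I \<and> (\<forall>f\<in>I. \<forall>g\<in>I. f + g \<in> I) \<and> (\<forall>f\<in>I. \<forall>g. g * f \<in> I)"
  show "ideal I (poly_ring :: ('v, 'k::field) mpoly ring)"
  proof (rule idealI)
    interpret cring "poly_ring :: ('v, 'k::field) mpoly ring" by (rule cring_poly_ring)
    have neg: "\<ominus>\<^bsub>poly_ring\<^esub> f = - f" for f :: "('v, 'k) mpoly"
      by (rule sum_zero_eq_neg[symmetric]) auto
    show "subgroup I (add_monoid (poly_ring :: ('v, 'k::field) mpoly ring))"
    proof (rule add.subgroupI)
      fix f assume "f \<in> I"
      then have "(-1) * f \<in> I" using I by blast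
      then show "\<ominus>\<^bsub>poly_ring\<^esub> f \<in> I" by (simp add: neg)
    qed (use I in auto)
  qed (use I ring_poly_ring in \<open>auto simp: mult.commute\<close>)
qed

lemma Idl_ideal: "ideal (Idl\<^bsub>poly_ring\<^esub> A) (poly_ring :: ('v, 'k::field) mpoly ring)"
  by (rule ring.genideal_ideal[OF ring_poly_ring]) simp

lemma Idl_superset: "A \<subseteq> Idl\<^bsub>poly_ring\<^esub> (A :: ('v, 'k::field) mpoly set)"
  by (rule ring.genideal_self[OF ring_poly_ring]) simp

lemma Idl_least: "ideal I poly_ring \<Longrightarrow> A \<subseteq> I \<Longrightarrow> Idl\<^bsub>poly_ring\<^esub> A \<subseteq> (I :: ('v, 'k::field) mpoly set)"
  by (rule ring.genideal_minimal[OF ring_poly_ring])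

lemma ideal_sum:
  assumes "ideal I (poly_ring :: ('v, 'k::field) mpoly ring)" "\<And>a. a \<in> A \<Longrightarrow> f a \<in> I"
  shows "sum f A \<in> I"
  using assms(2)
  by (induction A rule: infinite_finite_induct) (use assms(1) in \<open>auto simp: ideal_poly_ring_iff\<close>)

text \<open>Monomial ideals are handled through the set of exponents that may occur. For upward
  closed \<open>U\<close> this is the ideal spanned by the monomials of \<open>U\<close>, and sums
  and intersections of such ideals become unions and intersections of sets.\<close>

definition exp_ideal :: "('v \<Rightarrow>\<^sub>0 nat) set \<Rightarrow> ('v, 'k::field) mpoly set" where
  "exp_ideal U = {f. Poly_Mapping.keys f \<subseteq> U}"

definition up_closure :: "('v \<Rightarrow>\<^sub>0 nat) set \<Rightarrow> ('v \<Rightarrow>\<^sub>0 nat) set" where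
  "up_closure E = {a + b | a b. a \<in> E}"

lemma up_closureI: "a \<in> E \<Longrightarrow> a + b \<in> up_closure E"
  unfolding up_closure_def by blast

lemma up_closure_self: "a \<in> E \<Longrightarrow> a \<in> up_closure E"
  using up_closureI[of a E 0] by simp

lemma up_closure_add: "m \<in> up_closure E \<Longrightarrow> m + m' \<in> up_closure E"
  by (auto simp: up_closure_def add.assoc) (metis add.assoc)

abbreviation mon :: "('v \<Rightarrow>\<^sub>0 nat) \<Rightarrow> ('v, 'k::field) mpoly" where
  "mon m \<equiv> Poly_Mapping.single m 1"

lemma ideal_exp_ideal:
  assumes "\<And>m m'. m \<in> U \<Longrightarrow> m + m' \<in> U"
  shows "ideal (exp_ideal U :: ('v, 'k::field) mpoly set) poly_ring"
  unfolding ideal_poly_ring_iff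
proof (intro conjI ballI allI)
  show "0 \<in> (exp_ideal U :: ('v, 'k::field) mpoly set)" by (simp add: exp_ideal_def)
  fix f g :: "('v, 'k) mpoly"
  assume f: "f \<in> exp_ideal U"
  { assume "g \<in> exp_ideal U"
    then show "f + g \<in> exp_ideal U" using f Poly_Mapping.keys_add[of f g] by (auto simp: exp_ideal_def) }
  show "g * f \<in> exp_ideal U"
    using f assms by (auto simp: exp_ideal_def elim!: keys_times) (metis add.commute subsetD)
qed

text \<open>A polynomial supported on multiples of the generators is a sum of terms, each of which
  is a term times one generator. Membership in a monomial ideal is thereby a condition on the
  support alone.\<close>

lemma Idl_mon:
  "Idl\<^bsub>poly_ring\<^esub> (mon ` E) = (exp_ideal (up_closure E) :: ('v, 'k::field) mpoly set)"
proof
  show "Idl\<^bsub>poly_ring\<^esub> (mon ` E) \<subseteq> (exp_ideal (up_closure E) :: ('v, 'k::field) mpoly set)"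
  proof (rule Idl_least)
    show "ideal (exp_ideal (up_closure E) :: ('v, 'k::field) mpoly set) poly_ring"
      by (rule ideal_exp_ideal) (rule up_closure_add)
  qed (auto simp: up_closure_self exp_ideal_def)
  show "(exp_ideal (up_closure E) :: ('v, 'k::field) mpoly set) \<subseteq> Idl\<^bsub>poly_ring\<^esub> (mon ` E)"
  proof
    fix f :: "('v, 'k) mpoly" assume f: "f \<in> exp_ideal (up_closure E)"
    have I: "ideal (Idl\<^bsub>poly_ring\<^esub> (mon ` E)) (poly_ring :: ('v, 'k) mpoly ring)" by (rule Idl_ideal)
    have "(\<Sum>m\<in>Poly_Mapping.keys f. Poly_Mapping.single m (Poly_Mapping.lookup f m)) \<in> Idl\<^bsub>poly_ring\<^esub> (mon ` E)"
    proof (rule ideal_sum[OF I])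
      fix m assume "m \<in> Poly_Mapping.keys f"
      then obtain a b where ab: "m = a + b" "a \<in> E" using f by (auto simp: exp_ideal_def up_closure_def)
      then have "mon a \<in> Idl\<^bsub>poly_ring\<^esub> (mon ` E)" by (intro subsetD[OF Idl_superset] imageI)
      then have "Poly_Mapping.single b (Poly_Mapping.lookup f m) * mon a \<in> Idl\<^bsub>poly_ring\<^esub> (mon ` E)"
        using I by (auto simp: ideal_poly_ring_iff)
      then show "Poly_Mapping.single m (Poly_Mapping.lookup f m) \<in> Idl\<^bsub>poly_ring\<^esub> (mon ` E)"
        by (simp add: mult_single ab add.commute)
    qed
    then show "f \<in> Idl\<^bsub>poly_ring\<^esub> (mon ` E)" by (subst poly_mapping_eq_sum_single[of f])
  qed
qed

lemma mon_in_exp_ideal [simp]: "mon m \<in> exp_ideal U \<longleftrightarrow> m \<in> U"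
  by (auto simp: exp_ideal_def)

lemma exp_ideal_inter: "exp_ideal U \<inter> exp_ideal V = exp_ideal (U \<inter> V)"
  by (auto simp: exp_ideal_def)

lemma exp_ideal_union:
  "exp_ideal U <+>\<^bsub>poly_ring\<^esub> exp_ideal V = (exp_ideal (U \<union> V) :: ('v, 'k::field) mpoly set)"
proof
  show "exp_ideal U <+>\<^bsub>poly_ring\<^esub> exp_ideal V \<subseteq> (exp_ideal (U \<union> V) :: ('v, 'k::field) mpoly set)"
  proof (clarsimp simp: set_add_def' exp_ideal_def)
    fix f g :: "('v, 'k) mpoly" and m
    assume "Poly_Mapping.keys f \<subseteq> U" "Poly_Mapping.keys g \<subseteq> V" "m \<in> Poly_Mapping.keys (f + g)" "m \<notin> V"
    then show "m \<in> U" using Poly_Mapping.keys_add[of f g] by blast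
  qed
  show "(exp_ideal (U \<union> V) :: ('v, 'k::field) mpoly set) \<subseteq> exp_ideal U <+>\<^bsub>poly_ring\<^esub> exp_ideal V"
  proof
    fix f :: "('v, 'k) mpoly" assume f: "f \<in> exp_ideal (U \<union> V)"
    have "f = restr U f + restr (-U) f" 
      by (rule poly_mapping_eqI) (auto simp: lookup_restr lookup_add)
    moreover have "restr U f \<in> exp_ideal U" "restr (-U) f \<in> exp_ideal V"
      using f by (auto simp: exp_ideal_def keys_restr)
    ultimately show "f \<in> exp_ideal U <+>\<^bsub>poly_ring\<^esub> exp_ideal V" by (auto simp: set_add_def')
  qed
qed

lemma monomials_image:
  assumes "A \<subseteq> monomials"
  obtains E where "A = mon ` E"
  using assms unfolding monomials_def by (metis subset_imageE)

text \<open>An element of \<open>E\<close> is a multiple of one in \<open>E'\<close>, which in turn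
  is a multiple of one in \<open>E\<close>. As no exponent of \<open>E\<close> properly divides
  another, this chain collapses and all three agree.\<close>

lemma up_closure_eq_imp_eq:
  assumes "up_closure E = up_closure E'"
    and "\<And>a b. a \<in> E \<Longrightarrow> a + b \<in> E \<Longrightarrow> b = 0" "\<And>a b. a \<in> E' \<Longrightarrow> a + b \<in> E' \<Longrightarrow> b = 0"
  shows "E \<subseteq> E'"
proof
  fix a assume a: "a \<in> E"
  then obtain a' b where ab: "a' \<in> E'" "a = a' + b" using assms(1) up_closure_self[of a E] unfolding up_closure_def by blast
  then obtain a'' b' where ab': "a'' \<in> E" "a' = a'' + b'" using assms(1) up_closure_self[of a' E'] unfolding up_closure_def by blast
  have "b' + b = 0" using assms(2)[OF ab'(1), of "b' + b"] a ab ab' by (simp add: add.assoc)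
  then show "a \<in> E'" using ab by (simp add: exp_add_eq_0_iff)
qed

text \<open>The definite description is settled in two halves: an antichain for divisibility is an
  irredundant generating set, and every irredundant set of monomials is such an antichain, hence
  equal to \<open>E\<close> by the preceding comparison.\<close>

lemma min_monomial_gens_Idl:
  assumes anti: "\<And>a b. a \<in> E \<Longrightarrow> a + b \<in> E \<Longrightarrow> b = 0"
  shows "min_monomial_gens (Idl\<^bsub>poly_ring\<^esub> (mon ` E)) = (mon ` E :: ('v, 'k::field) mpoly set)"
  unfolding min_monomial_gens_def
proof (rule the_equality)
  have inj: "inj (mon :: ('v \<Rightarrow>\<^sub>0 nat) \<Rightarrow> ('v, 'k::field) mpoly)" 
    by (rule injI) (metis keys_single singleton_inject zero_neq_one)
  have exp_inj: "U = V" if "exp_ideal U = (exp_ideal V :: ('v, 'k::field) mpoly set)" for U V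
    using that by (metis mon_in_exp_ideal subsetI subset_antisym)
  show "(mon ` E :: ('v, 'k) mpoly set) \<subseteq> monomials \<and>
    Idl\<^bsub>poly_ring\<^esub> (mon ` E) = (Idl\<^bsub>poly_ring\<^esub> (mon ` E) :: ('v, 'k) mpoly set) \<and>
    (\<forall>B\<subset>mon ` E. Idl\<^bsub>poly_ring\<^esub> B \<noteq> (Idl\<^bsub>poly_ring\<^esub> (mon ` E) :: ('v, 'k) mpoly set))"
  proof (intro conjI allI impI)
    show "(mon ` E :: ('v, 'k) mpoly set) \<subseteq> monomials" by (auto simp: monomials_def)
    fix B :: "('v, 'k) mpoly set"
    assume B: "B \<subset> mon ` E"
    then have "B \<subseteq> mon ` E" by blast
    then obtain E' where "E' \<subseteq> E" "B = mon ` E'" by (rule subset_imageE)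
    with B have E': "B = mon ` E'" "E' \<subset> E" by auto
    show "Idl\<^bsub>poly_ring\<^esub> B \<noteq> (Idl\<^bsub>poly_ring\<^esub> (mon ` E))"
    proof
      assume "Idl\<^bsub>poly_ring\<^esub> B = (Idl\<^bsub>poly_ring\<^esub> (mon ` E))"
      then have "up_closure E = up_closure E'" unfolding E' Idl_mon by (rule exp_inj[symmetric])
      then have "E \<subseteq> E'" by (rule up_closure_eq_imp_eq) (use anti E' in auto)
      then show False using E' by auto
    qed
  qed simp
  fix A :: "('v, 'k) mpoly set"
  assume A: "A \<subseteq> monomials \<and> Idl\<^bsub>poly_ring\<^esub> A = Idl\<^bsub>poly_ring\<^esub> (mon ` E) \<and>
    (\<forall>B\<subset>A. Idl\<^bsub>poly_ring\<^esub> B \<noteq> Idl\<^bsub>poly_ring\<^esub> (mon ` E))"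
  obtain E' where E': "A = mon ` E'" using A monomials_image by metis
  have up: "up_closure E = up_closure E'" using A unfolding E' Idl_mon by (metis exp_inj)
  \<comment> \<open>If \<open>a\<close> properly divided \<open>a + b\<close> inside
    \<open>E'\<close>, then \<open>a + b\<close> could be dropped without changing the ideal,
    against the irredundancy of \<open>A\<close>.\<close>
  have anti': "b = 0" if ab: "a \<in> E'" "a + b \<in> E'" for a b
  proof (rule ccontr)
    assume b: "b \<noteq> 0"
    then have ne: "a \<noteq> a + b" by simp
    have "up_closure (E' - {a + b}) = up_closure E'"
    proof
      show "up_closure E' \<subseteq> up_closure (E' - {a + b})"
      proof
        fix m assume "m \<in> up_closure E'"
        then obtain c d where cd: "c \<in> E'" "m = c + d" by (auto simp: up_closure_def)
        show "m \<in> up_closure (E' - {a + b})"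
        proof (cases "c = a + b")
          case True
          then show ?thesis using ab ne cd up_closureI[of a "E' - {a + b}" "b + d"] by (simp add: add.assoc)
        qed (use cd in \<open>auto intro: up_closureI\<close>)
      qed
    qed (auto simp: up_closure_def)
    moreover have "mon ` (E' - {a + b}) \<noteq> (mon ` E' :: ('v, 'k) mpoly set)"
      using ab by (subst inj_image_eq_iff[OF inj]) auto
    then have "mon ` (E' - {a + b}) \<subset> A" unfolding E' by blast
    moreover have "Idl\<^bsub>poly_ring\<^esub> (mon ` (E' - {a + b})) \<noteq> (Idl\<^bsub>poly_ring\<^esub> (mon ` E) :: ('v, 'k) mpoly set)"
      using A calculation(2) by simp
    ultimately show False by (simp add: Idl_mon up)
  qed
  have "E = E'"
    using up_closure_eq_imp_eq[OF up anti anti'] up_closure_eq_imp_eq[OF up[symmetric] anti' anti] by (rule equalityI)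
  then show "A = mon ` E" using E' by simp
qed

lemma const_Idl_var:
  assumes "f \<in> Idl\<^bsub>poly_ring\<^esub> (range (var :: 'v \<Rightarrow> ('v, 'k::field) mpoly))"
  shows "const f = 0"
proof -
  have "Idl\<^bsub>poly_ring\<^esub> (range (var :: 'v \<Rightarrow> ('v, 'k::field) mpoly)) \<subseteq> {f. const f = 0}"
    by (rule Idl_least) (auto simp: ideal_poly_ring_iff)
  then show ?thesis using assms by blast
qed

text \<open>Every exponent other than \<open>0\<close> involves some variable, which can be split
  off. Together with \<open>const_Idl_var\<close> this turns the minimality condition on entries
  into the vanishing of constant terms.\<close>

lemma Idl_var_if_const:
  assumes "const (f :: ('v, 'k::field) mpoly) = 0"
  shows "f \<in> Idl\<^bsub>poly_ring\<^esub> (range var)"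
proof -
  have r: "range var = (mon ` (range (\<lambda>v. Poly_Mapping.single v 1)) :: ('v, 'k) mpoly set)"
    by (auto simp: var_def)
  have "m \<in> up_closure (range (\<lambda>v. Poly_Mapping.single v 1))" if m: "m \<in> Poly_Mapping.keys f" for m
  proof -
    have "m \<noteq> 0" using m assms by (auto simp: const_def in_keys_iff)
    then obtain v where v: "Poly_Mapping.lookup m v \<noteq> 0" by (metis lookup_zero poly_mapping_eqI)
    have "m = Poly_Mapping.single v 1 + (m - Poly_Mapping.single v 1)"
      using v by (intro poly_mapping_eqI) (auto simp: lookup_add lookup_minus lookup_single when_def)
    then show ?thesis using up_closureI[of "Poly_Mapping.single v 1"] by (metis rangeI)
  qed
  then show ?thesis unfolding r Idl_mon by (auto simp: exp_ideal_def)
qed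

section \<open>Graded matrices\<close>

lemma monomial_degree_superset:
  "finite V \<Longrightarrow> Poly_Mapping.keys m \<subseteq> V \<Longrightarrow> monomial_degree m = (\<Sum>v\<in>V. Poly_Mapping.lookup m v)"
  unfolding monomial_degree_def by (rule sum.mono_neutral_left) (auto simp: in_keys_iff)

lemma monomial_degree_add: "monomial_degree (m + m') = monomial_degree m + monomial_degree m'"
  using Poly_Mapping.keys_add[of m m']
  by (simp add: monomial_degree_superset[of "Poly_Mapping.keys m \<union> Poly_Mapping.keys m'"] lookup_add sum.distrib)

lemma monomial_degree_zero [simp]: "monomial_degree 0 = 0"
  by (simp add: monomial_degree_def)

lemma homogeneous_times: "homogeneous a f \<Longrightarrow> homogeneous b g \<Longrightarrow> homogeneous (a + b) (f * g)"
  by (auto simp: homogeneous_def monomial_degree_add elim!: keys_times)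

lemma homogeneous_sum: "(\<And>i. i \<in> A \<Longrightarrow> homogeneous a (f i)) \<Longrightarrow> homogeneous a (sum f A)"
  using keys_sum_subset[of A f "{m. int (monomial_degree m) = a}"] by (auto simp: homogeneous_def)

lemma homogeneous_zero [simp]: "homogeneous a 0"
  by (simp add: homogeneous_def)

lemma homogeneous_uminus [simp]: "homogeneous a (- f) \<longleftrightarrow> homogeneous a f"
  by (simp add: homogeneous_def in_keys_iff)

lemma const_homogeneous: "homogeneous a f \<Longrightarrow> a \<noteq> 0 \<Longrightarrow> const f = 0"
  unfolding homogeneous_def const_def using in_keys_iff[of 0 f] monomial_degree_zero by force

text \<open>A degree-preserving map of graded free modules: the columns belong to generators of the
  source, of degrees \<open>cs\<close>, and the rows to generators of the target, of degrees
  \<open>rs\<close>.\<close>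

definition homogeneous_mat :: "int list \<Rightarrow> int list \<Rightarrow> ('v, 'k::field) mpoly mat \<Rightarrow> bool" where
  "homogeneous_mat rs cs D \<longleftrightarrow> D \<in> carrier_mat (length rs) (length cs) \<and>
     (\<forall>r<length rs. \<forall>c<length cs. homogeneous (cs ! c - rs ! r) (D $$ (r, c)))"

lemma homogeneous_mat_carrier: "homogeneous_mat rs cs D \<Longrightarrow> D \<in> carrier_mat (length rs) (length cs)"
  by (simp add: homogeneous_mat_def)

lemma index_mult_mat_sum:
  assumes "A \<in> carrier_mat n k" "B \<in> carrier_mat k l" "i < n" "j < l"
  shows "(A * B) $$ (i, j) = (\<Sum>m<k. A $$ (i, m) * B $$ (m, j))"
  using assms by (auto simp: scalar_prod_def atLeast0LessThan intro!: sum.cong)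

lemma index_mult_mat_vec_sum:
  assumes "A \<in> carrier_mat n k" "v \<in> carrier_vec k" "i < n"
  shows "(A *\<^sub>v v) $ i = (\<Sum>m<k. A $$ (i, m) * v $ m)"
  using assms by (auto simp: scalar_prod_def atLeast0LessThan intro!: sum.cong)

lemma homogeneous_mat_mult:
  assumes "homogeneous_mat rs ks A" "homogeneous_mat ks cs B"
  shows "homogeneous_mat rs cs (A * B)"
  unfolding homogeneous_mat_def
proof (intro conjI allI impI)
  show "A * B \<in> carrier_mat (length rs) (length cs)"
    using assms by (auto simp: homogeneous_mat_def)
  fix r c assume rc: "r < length rs" "c < length cs"
  have "homogeneous ((ks ! k - rs ! r) + (cs ! c - ks ! k)) (A $$ (r, k) * B $$ (k, c))" if "k < length ks" for k
    using assms that rc by (intro homogeneous_times) (auto simp: homogeneous_mat_def)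
  then have "homogeneous (cs ! c - rs ! r) (\<Sum>k<length ks. A $$ (r, k) * B $$ (k, c))"
    by (intro homogeneous_sum) auto
  then show "homogeneous (cs ! c - rs ! r) ((A * B) $$ (r, c))"
    using assms rc by (subst index_mult_mat_sum) (auto dest: homogeneous_mat_carrier)
qed

section \<open>Lifting matrices along the image of another matrix\<close>

definition mat_image :: "('a::comm_ring_1) mat \<Rightarrow> 'a vec set" where
  "mat_image A = (\<lambda>v. A *\<^sub>v v) ` carrier_vec (dim_col A)"

lemma mat_lift:
  assumes A: "A \<in> carrier_mat n k" and M: "M \<in> carrier_mat n l"
    and im: "\<And>c. c < l \<Longrightarrow> col M c \<in> mat_image A"
  obtains N where "N \<in> carrier_mat k l" "A * N = M"
proof -
  have "\<forall>c. \<exists>w. c < l \<longrightarrow> w \<in> carrier_vec k \<and> A *\<^sub>v w = col M c"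
    using im A unfolding mat_image_def by (metis carrier_matD(2) imageE)
  then obtain w where w: "\<And>c. c < l \<Longrightarrow> w c \<in> carrier_vec k" "\<And>c. c < l \<Longrightarrow> A *\<^sub>v w c = col M c"
    by metis
  define N where "N = mat k l (\<lambda>(i, c). w c $ i)"
  have N: "N \<in> carrier_mat k l" by (simp add: N_def)
  have "A * N = M"
  proof (rule eq_matI)
    fix i j assume ij: "i < dim_row M" "j < dim_col M"
    then have ij': "i < n" "j < l" using M by auto
    have "(A * N) $$ (i, j) = (\<Sum>m<k. A $$ (i, m) * w j $ m)"
      using ij' by (subst index_mult_mat_sum[OF A N]) (auto simp: N_def)
    also have "\<dots> = (A *\<^sub>v w j) $ i"
      using ij' w by (subst index_mult_mat_vec_sum[OF A]) auto
    finally show "(A * N) $$ (i, j) = M $$ (i, j)" using w ij ij' by simp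
  qed (use A M N in auto)
  then show ?thesis using that N by blast
qed

text \<open>An arbitrary lift is first found column by column. Replacing each entry by its component
  in the degree demanded there does not change the product, because the entries of \<open>A\<close>
  are homogeneous and \<open>M\<close> already lives in the required degrees.\<close>

lemma homogeneous_mat_lift:
  fixes A M :: "('v, 'k::field) mpoly mat"
  assumes A: "homogeneous_mat rs ks A" and M: "homogeneous_mat rs cs M"
    and im: "\<And>c. c < length cs \<Longrightarrow> col M c \<in> mat_image A"
  obtains N where "homogeneous_mat ks cs N" "A * N = M"
proof -
  note Ac = homogeneous_mat_carrier[OF A] and Mc = homogeneous_mat_carrier[OF M]
  obtain W where W: "W \<in> carrier_mat (length ks) (length cs)" "A * W = M"
    using mat_lift[OF Ac Mc im] by blast
  let ?S = "\<lambda>e. {m :: 'v \<Rightarrow>\<^sub>0 nat. int (monomial_degree m) = e}"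
  define N where "N = mat (length ks) (length cs) (\<lambda>(k, c). restr (?S (cs ! c - ks ! k)) (W $$ (k, c)))"
  have N: "N \<in> carrier_mat (length ks) (length cs)" by (simp add: N_def)
  have "homogeneous_mat ks cs N"
    using N by (auto simp: homogeneous_mat_def N_def homogeneous_def keys_restr)
  moreover have "A * N = M"
  proof (rule eq_matI)
    fix r c assume "r < dim_row M" "c < dim_col M"
    then have rc: "r < length rs" "c < length cs" using Mc by auto
    have "(A * N) $$ (r, c) = (\<Sum>k<length ks. A $$ (r, k) * restr (?S (cs ! c - ks ! k)) (W $$ (k, c)))"
      using rc by (subst index_mult_mat_sum[OF Ac N]) (auto simp: N_def)
    also have "\<dots> = (\<Sum>k<length ks. restr (?S (cs ! c - rs ! r)) (A $$ (r, k) * W $$ (k, c)))"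
    proof (rule sum.cong[OF refl], rule restr_times[symmetric])
      fix k m m' assume "k \<in> {..<length ks}" "m \<in> Poly_Mapping.keys (A $$ (r, k))"
      then have "int (monomial_degree m) = ks ! k - rs ! r"
        using A rc by (auto simp: homogeneous_mat_def homogeneous_def)
      then show "m + m' \<in> ?S (cs ! c - rs ! r) \<longleftrightarrow> m' \<in> ?S (cs ! c - ks ! k)"
        by (auto simp: monomial_degree_add)
    qed
    also have "\<dots> = restr (?S (cs ! c - rs ! r)) (M $$ (r, c))"
      using rc by (simp add: restr_sum W(2)[symmetric] index_mult_mat_sum[OF Ac W(1)])
    also have "\<dots> = M $$ (r, c)"
      using M rc by (intro restr_id) (auto simp: homogeneous_mat_def homogeneous_def)
    finally show "(A * N) $$ (r, c) = M $$ (r, c)" .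
  qed (use Ac Mc N in auto)
  ultimately show ?thesis using that by blast
qed

lemma mult_mat_unit_vec:
  fixes A :: "'a::comm_ring_1 mat"
  assumes "A \<in> carrier_mat n k" "c < k"
  shows "A *\<^sub>v unit_vec k c = col A c"
  using assms by (intro eq_vecI) auto

lemma col_mem_kernel:
  assumes A: "A \<in> carrier_mat n k" and M: "M \<in> carrier_mat k l" and 0: "A * M = 0\<^sub>m n l" and c: "c < l"
  shows "col M c \<in> mat_kernel A"
proof (rule mat_kernelI[OF A])
  show "A *\<^sub>v col M c = 0\<^sub>v n"
    using col_mult2[OF A M c] 0 c by simp
qed (use M c in auto)

lemma mult_zero_if_image_kernel:
  assumes A: "A \<in> carrier_mat n k" and B: "B \<in> carrier_mat k l" and ex: "mat_image B \<subseteq> mat_kernel A"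
  shows "A * B = 0\<^sub>m n l"
proof (rule eq_matI)
  fix i j assume ij: "i < dim_row (0\<^sub>m n l)" "j < dim_col (0\<^sub>m n l)"
  have "B *\<^sub>v unit_vec l j \<in> mat_image B" using B by (auto simp: mat_image_def)
  then have 0: "A *\<^sub>v (B *\<^sub>v unit_vec l j) = 0\<^sub>v n" using ex mat_kernelD(2)[OF A] by blast
  have "B *\<^sub>v unit_vec l j = col B j" using ij by (intro mult_mat_unit_vec[OF B]) auto
  then have "(A * B) $$ (i, j) = (A *\<^sub>v (B *\<^sub>v unit_vec l j)) $ i" using A B ij by simp
  then show "(A * B) $$ (i, j) = 0\<^sub>m n l $$ (i, j)" using 0 ij by simp
qed (use A B in auto)

section \<open>Uniqueness of the graded Betti numbers\<close>

interpretation const_hom: comm_ring_hom "const :: ('v, 'k::field) mpoly \<Rightarrow> 'k"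
  by unfold_locales auto

text \<open>The rank inequality for a matrix with a left inverse, indexed by arbitrary finite sets.
  If \<open>S'\<close> were smaller, both factors could be padded with zeros to square matrices of
  size \<open>card S\<close>; a one-sided inverse would then be two-sided, which a zero row
  forbids.\<close>

lemma card_le_if_left_inverse:
  fixes a b :: "'i \<Rightarrow> 'j \<Rightarrow> 'k::field"
  assumes fin: "finite S" "finite S'"
    and inv: "\<And>c c'. c \<in> S \<Longrightarrow> c' \<in> S \<Longrightarrow> (\<Sum>r\<in>S'. b c r * a c' r) = (if c = c' then 1 else 0)"
  shows "card S \<le> card S'"
proof (rule ccontr)
  let ?N = "card S" and ?M = "card S'"
  assume "\<not> ?N \<le> ?M"
  then have lt: "?M < ?N" by simp
  obtain f where f: "bij_betw f {..<?N} S"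
    using ex_bij_betw_nat_finite[OF fin(1)] by (auto simp: atLeast0LessThan)
  obtain g where g: "bij_betw g {..<?M} S'"
    using ex_bij_betw_nat_finite[OF fin(2)] by (auto simp: atLeast0LessThan)
  define P where "P = mat ?N ?N (\<lambda>(i, k). if k < ?M then b (f i) (g k) else 0)"
  define Q where "Q = mat ?N ?N (\<lambda>(k, j). if k < ?M then a (f j) (g k) else 0)"
  have P: "P \<in> carrier_mat ?N ?N" and Q: "Q \<in> carrier_mat ?N ?N" by (simp_all add: P_def Q_def)
  have "P * Q = 1\<^sub>m ?N"
  proof (rule eq_matI)
    fix i j assume ij: "i < dim_row (1\<^sub>m ?N :: 'k mat)" "j < dim_col (1\<^sub>m ?N :: 'k mat)"
    then have ij': "f i \<in> S" "f j \<in> S" "f i = f j \<longleftrightarrow> i = j" 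
      using f by (auto simp: bij_betw_def inj_on_eq_iff)
    have "(P * Q) $$ (i, j) = (\<Sum>m<?N. P $$ (i, m) * Q $$ (m, j))"
      by (rule index_mult_mat_sum[OF P Q]) (use ij in auto)
    also have "\<dots> = (\<Sum>m<?M. b (f i) (g m) * a (f j) (g m))"
      using lt ij by (intro sum.mono_neutral_cong_right) (auto simp: P_def Q_def)
    also have "\<dots> = (\<Sum>r\<in>S'. b (f i) r * a (f j) r)"
      by (rule sum.reindex_bij_betw[OF g])
    finally show "(P * Q) $$ (i, j) = 1\<^sub>m ?N $$ (i, j)" using inv ij ij' by simp
  qed (use P Q in auto)
  then have "Q * P = 1\<^sub>m ?N" by (rule mat_mult_left_right_inverse[OF P Q])
  \<comment> \<open>Row \<open>?M\<close> of \<open>Q\<close> is the first row of the padding, since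
    indices start at 0.\<close>
  moreover have "(Q * P) $$ (?M, ?M) = 0"
    using lt by (subst index_mult_mat_sum[OF Q P]) (auto simp: Q_def)
  ultimately show False using lt by simp
qed

text \<open>Modulo the variables only entries between generators of equal degree survive. The
  reduced matrices thus decompose into blocks indexed by degree, and the block of degree
  \<open>j\<close> of \<phi> still has a left inverse.\<close>

lemma count_list_le_if_left_inverse:
  fixes \<phi> \<psi> :: "('v, 'k::field) mpoly mat"
  assumes phi: "homogeneous_mat sh' sh \<phi>" and psi: "homogeneous_mat sh sh' \<psi>"
    and inv: "map_mat const (\<psi> * \<phi>) = 1\<^sub>m (length sh)"
  shows "count_list sh j \<le> count_list sh' j"
proof -
  have cnt: "count_list xs j = card {c. c < length xs \<and> xs ! c = j}" for xs :: "int list"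
    by (simp add: count_list_eq_length_filter length_filter_conv_card conj_commute eq_commute)
  note c = homogeneous_mat_carrier[OF phi] homogeneous_mat_carrier[OF psi]
  show ?thesis unfolding cnt
  proof (rule card_le_if_left_inverse[where b = "\<lambda>c r. const (\<psi> $$ (c, r))" and a = "\<lambda>c r. const (\<phi> $$ (r, c))"])
    fix c c' assume cc: "c \<in> {c. c < length sh \<and> sh ! c = j}" "c' \<in> {c. c < length sh \<and> sh ! c = j}"
    have "const ((\<psi> * \<phi>) $$ (c, c')) = (if c = c' then 1 else 0)"
      using arg_cong[OF inv, of "\<lambda>A. A $$ (c, c')"] cc c by auto
    moreover have "const ((\<psi> * \<phi>) $$ (c, c')) = (\<Sum>r<length sh'. const (\<psi> $$ (c, r)) * const (\<phi> $$ (r, c')))"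
      using cc by (subst index_mult_mat_sum[OF c(2,1)]) (auto simp: const_sum)
    moreover have "\<dots> = (\<Sum>r | r < length sh' \<and> sh' ! r = j. const (\<psi> $$ (c, r)) * const (\<phi> $$ (r, c')))"
    proof (rule sum.mono_neutral_right)
      show "\<forall>r\<in>{..<length sh'} - {r. r < length sh' \<and> sh' ! r = j}. const (\<psi> $$ (c, r)) * const (\<phi> $$ (r, c')) = 0"
      proof
        fix r assume "r \<in> {..<length sh'} - {r. r < length sh' \<and> sh' ! r = j}"
        then have "const (\<psi> $$ (c, r)) = 0"
          using psi cc by (intro const_homogeneous[of "sh' ! r - sh ! c"]) (auto simp: homogeneous_mat_def)
        then show "const (\<psi> $$ (c, r)) * const (\<phi> $$ (r, c')) = 0" by simp
      qed
    qed auto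
    ultimately show "(\<Sum>r | r < length sh' \<and> sh' ! r = j. const (\<psi> $$ (c, r)) * const (\<phi> $$ (r, c'))) = (if c = c' then 1 else 0)"
      by simp
  qed auto
qed

section \<open>Basic properties of resolutions and lifting from one to another\<close>

lemma resolution_homogeneous_aug:
  "graded_free_resolution sh d I \<Longrightarrow> homogeneous_mat [0] (sh 0) (d 0)"
  by (auto simp: graded_free_resolution_def homogeneous_mat_def)

lemma resolution_homogeneous:
  "graded_free_resolution sh d I \<Longrightarrow> homogeneous_mat (sh i) (sh (Suc i)) (d (Suc i))"
  by (auto simp: graded_free_resolution_def homogeneous_mat_def)

lemma resolution_exact:
  assumes "graded_free_resolution sh d I"
  shows "mat_image (d (Suc i)) = mat_kernel (d i)"
proof -
  have "dim_col (d (Suc i)) = length (sh (Suc i))" using assms by (auto simp: graded_free_resolution_def)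
  then show ?thesis using assms by (simp add: graded_free_resolution_def mat_image_def)
qed

lemma resolution_carrier:
  assumes "graded_free_resolution sh d I"
  shows "d i \<in> carrier_mat (if i = 0 then 1 else length (sh (i - 1))) (length (sh i))"
  using assms by (cases i) (auto simp: graded_free_resolution_def)

lemma resolution_image:
  assumes "graded_free_resolution sh d I"
  shows "mat_image (d 0) = {v \<in> carrier_vec 1. v $ 0 \<in> I}"
proof -
  have d: "d 0 \<in> carrier_mat 1 (length (sh 0))" and I: "(\<lambda>v. (d 0 *\<^sub>v v) $ 0) ` carrier_vec (length (sh 0)) = I"
    using assms by (auto simp: graded_free_resolution_def)
  show ?thesis
  proof (intro equalityI subsetI)
    fix v assume v: "v \<in> {v \<in> carrier_vec 1. v $ 0 \<in> I}"
    then have "v $ 0 \<in> (\<lambda>v. (d 0 *\<^sub>v v) $ 0) ` carrier_vec (length (sh 0))" unfolding I by simp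
    then obtain w where w: "w \<in> carrier_vec (length (sh 0))" "(d 0 *\<^sub>v w) $ 0 = v $ 0"
      by (elim imageE) (rule that, assumption, erule sym)
    have "d 0 *\<^sub>v w = v"
    proof (rule eq_vecI)
      fix i assume "i < dim_vec v"
      then have "i = 0" using v by auto
      then show "(d 0 *\<^sub>v w) $ i = v $ i" using w(2) by (simp only:)
    qed (use v d in auto)
    then show "v \<in> mat_image (d 0)" using w d by (auto simp: mat_image_def)
  qed (use d I in \<open>auto simp: mat_image_def simp del: index_mult_mat_vec\<close>)
qed

lemma resolution_differential_squared:
  assumes "graded_free_resolution sh d I"
  shows "d i * d (Suc i) = 0\<^sub>m (dim_row (d i)) (length (sh (Suc i)))"
proof (rule mult_zero_if_image_kernel)
  show "d i \<in> carrier_mat (dim_row (d i)) (length (sh i))" using resolution_carrier[OF assms, of i] by auto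
  show "d (Suc i) \<in> carrier_mat (length (sh i)) (length (sh (Suc i)))"
    using resolution_carrier[OF assms, of "Suc i"] by auto
qed (simp add: resolution_exact[OF assms])

lemma minimal_resolution_const:
  assumes "minimal_graded_free_resolution sh d I"
  shows "map_mat const (d (Suc i)) = 0\<^sub>m (length (sh i)) (length (sh (Suc i)))"
  using assms resolution_carrier[of sh d I "Suc i"]
  by (intro eq_matI) (auto simp: minimal_graded_free_resolution_def const_Idl_var)

lemma resolution_lift_aug:
  fixes d d' :: "nat \<Rightarrow> ('v, 'k::field) mpoly mat"
  assumes d: "graded_free_resolution sh d I" and d': "graded_free_resolution sh' d' I'" and sub: "I \<subseteq> I'"
  obtains \<phi> where "homogeneous_mat (sh' 0) (sh 0) \<phi>" "d' 0 * \<phi> = d 0"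
proof (rule homogeneous_mat_lift[OF resolution_homogeneous_aug[OF d'] resolution_homogeneous_aug[OF d]])
  fix c assume c: "c < length (sh 0)"
  have dc: "d 0 \<in> carrier_mat 1 (length (sh 0))" using resolution_carrier[OF d, of 0] by simp
  have "d 0 *\<^sub>v unit_vec (length (sh 0)) c \<in> mat_image (d 0)" using dc by (auto simp: mat_image_def)
  also have "d 0 *\<^sub>v unit_vec (length (sh 0)) c = col (d 0) c" by (rule mult_mat_unit_vec[OF dc c])
  finally show "col (d 0) c \<in> mat_image (d' 0)"
    using sub unfolding resolution_image[OF d] resolution_image[OF d'] by blast
qed (use that in blast)

text \<open>The inductive step in comparing resolutions: the hypothesis on \<open>d' i\<close> puts
  the columns of \<open>\<phi> * d (Suc i)\<close> into its kernel, which by exactness is the image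
  of \<open>d' (Suc i)\<close>.\<close>

lemma resolution_lift:
  fixes d d' :: "nat \<Rightarrow> ('v, 'k::field) mpoly mat"
  assumes d: "graded_free_resolution sh d I" and d': "graded_free_resolution sh' d' I'"
    and phi: "homogeneous_mat (sh' i) (sh i) \<phi>"
    and 0: "d' i * (\<phi> * d (Suc i)) = 0\<^sub>m (dim_row (d' i)) (length (sh (Suc i)))"
  obtains \<phi>' where "homogeneous_mat (sh' (Suc i)) (sh (Suc i)) \<phi>'" "d' (Suc i) * \<phi>' = \<phi> * d (Suc i)"
proof (rule homogeneous_mat_lift[OF resolution_homogeneous[OF d', of i]])
  show h: "homogeneous_mat (sh' i) (sh (Suc i)) (\<phi> * d (Suc i))"
    by (rule homogeneous_mat_mult[OF phi resolution_homogeneous[OF d]])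
  fix c assume c: "c < length (sh (Suc i))"
  show "col (\<phi> * d (Suc i)) c \<in> mat_image (d' (Suc i))"
    unfolding resolution_exact[OF d']
    by (rule col_mem_kernel[OF _ homogeneous_mat_carrier[OF h] 0 c])
      (use resolution_carrier[OF d', of i] in auto)
qed (use that in blast)

text \<open>The induction carries \<open>\<psi> * \<phi> = 1 + E + d h\<close>, where
  \<open>E\<close> stands for the preceding homotopy composed with a differential. Of this origin
  two facts are retained: \<open>E\<close> annihilates the next differential and vanishes modulo the
  variables. The new term is \<open>E' = h * d (Suc i)\<close>, and the remainder \<open>Z\<close>
  lies in the kernel of \<open>d (Suc i)\<close>, so it lifts to the new homotopy. Homotopies are
  left ungraded: they matter only through products with minimal differentials, which have no
  constant terms.\<close>

lemma homotopy_step: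
  fixes d d' :: "nat \<Rightarrow> ('v, 'k::field) mpoly mat"
  assumes d: "minimal_graded_free_resolution sh d I" and d': "graded_free_resolution sh' d' I'"
    and phi: "homogeneous_mat (sh' i) (sh i) \<phi>" and psi: "homogeneous_mat (sh i) (sh' i) \<psi>"
    and phi': "homogeneous_mat (sh' (Suc i)) (sh (Suc i)) \<phi>'" "d' (Suc i) * \<phi>' = \<phi> * d (Suc i)"
    and psi': "homogeneous_mat (sh (Suc i)) (sh' (Suc i)) \<psi>'" "d (Suc i) * \<psi>' = \<psi> * d' (Suc i)"
    and E: "E \<in> carrier_mat (length (sh i)) (length (sh i))" "E * d (Suc i) = 0\<^sub>m (length (sh i)) (length (sh (Suc i)))"
    and h: "h \<in> carrier_mat (length (sh (Suc i))) (length (sh i))" "\<psi> * \<phi> = 1\<^sub>m (length (sh i)) + E + d (Suc i) * h"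
  obtains E' h' where "E' \<in> carrier_mat (length (sh (Suc i))) (length (sh (Suc i)))"
    "E' * d (Suc (Suc i)) = 0\<^sub>m (length (sh (Suc i))) (length (sh (Suc (Suc i))))"
    "map_mat const E' = 0\<^sub>m (length (sh (Suc i))) (length (sh (Suc i)))"
    "h' \<in> carrier_mat (length (sh (Suc (Suc i)))) (length (sh (Suc i)))"
    "\<psi>' * \<phi>' = 1\<^sub>m (length (sh (Suc i))) + E' + d (Suc (Suc i)) * h'"
proof -
  let ?n = "length (sh i)" and ?m = "length (sh (Suc i))" and ?l = "length (sh (Suc (Suc i)))"
    and ?n' = "length (sh' i)" and ?m' = "length (sh' (Suc i))"
  have dr: "graded_free_resolution sh d I" using d by (simp add: minimal_graded_free_resolution_def)
  have c: "d (Suc i) \<in> carrier_mat ?n ?m" "d (Suc (Suc i)) \<in> carrier_mat ?m ?l" "d' (Suc i) \<in> carrier_mat ?n' ?m'"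
    "\<phi> \<in> carrier_mat ?n' ?n" "\<psi> \<in> carrier_mat ?n ?n'" "\<phi>' \<in> carrier_mat ?m' ?m" "\<psi>' \<in> carrier_mat ?m ?m'"
    using resolution_carrier[OF dr, of "Suc i"] resolution_carrier[OF dr, of "Suc (Suc i)"]
      resolution_carrier[OF d', of "Suc i"] phi psi phi' psi' by (auto dest: homogeneous_mat_carrier)
  let ?D = "d (Suc i)"
  define E' where "E' = h * ?D"
  have E'c: "E' \<in> carrier_mat ?m ?m" using h c by (auto simp: E'_def)
  define Z where "Z = \<psi>' * \<phi>' - (1\<^sub>m ?m + E')"
  have Zc: "Z \<in> carrier_mat ?m ?m" using c E'c by (auto simp: Z_def)
  have "?D * (\<psi>' * \<phi>') = \<psi> * (d' (Suc i) * \<phi>')"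
    using c psi'(2) by (simp flip: assoc_mult_mat[OF c(1) c(7) c(6)] add: assoc_mult_mat[OF c(5) c(3) c(6)])
  also have "\<dots> = \<psi> * \<phi> * ?D" unfolding phi'(2) using c by (simp add: assoc_mult_mat[OF c(5) c(4) c(1)])
  \<comment> \<open>In \<open>(1 + E + D h) D\<close> the product \<open>E D\<close> vanishes, and
    \<open>(D h) D\<close> is regrouped as \<open>D (h D)\<close>.\<close>
  also have "\<dots> = ?D + ?D * E'"
    unfolding h(2) E'_def using c E h
    by (simp add: add_mult_distrib_mat[of _ ?n ?n _ _ ?m] assoc_mult_mat[OF c(1) h(1) c(1)])
  also have "\<dots> = ?D * (1\<^sub>m ?m + E')"
    using c by (subst mult_add_distrib_mat[OF c(1) one_carrier_mat E'c]) simp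
  finally have "?D * Z = 0\<^sub>m ?n ?m"
    unfolding Z_def using c E'c by (subst mult_minus_distrib_mat[OF c(1)]) auto
  then have "col Z k \<in> mat_image (d (Suc (Suc i)))" if "k < ?m" for k
    unfolding resolution_exact[OF dr] using col_mem_kernel[OF c(1) Zc _ that] by blast
  then obtain h' where h': "h' \<in> carrier_mat ?l ?m" "d (Suc (Suc i)) * h' = Z"
    using mat_lift[OF c(2) Zc] by blast
  have "\<psi>' * \<phi>' = 1\<^sub>m ?m + E' + Z"
    unfolding Z_def using c E'c by (intro eq_matI) (auto simp del: index_mult_mat(1))
  moreover have "E' * d (Suc (Suc i)) = 0\<^sub>m ?m ?l"
    using resolution_differential_squared[OF dr, of "Suc i"] c h
    by (simp add: E'_def assoc_mult_mat[OF h(1) c(1) c(2)])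
  moreover have "map_mat const E' = 0\<^sub>m ?m ?m"
    unfolding E'_def const_hom.mat_hom_mult[OF h(1) c(1)] minimal_resolution_const[OF d] using h(1) by simp
  ultimately show ?thesis using that E'c h' by metis
qed

lemma homotopy_imp_const_inverse:
  fixes d :: "nat \<Rightarrow> ('v, 'k::field) mpoly mat"
  assumes d: "minimal_graded_free_resolution sh d I"
    and E: "E \<in> carrier_mat (length (sh i)) (length (sh i))" "map_mat const E = 0\<^sub>m (length (sh i)) (length (sh i))"
    and h: "h \<in> carrier_mat (length (sh (Suc i))) (length (sh i))"
  shows "map_mat const (1\<^sub>m (length (sh i)) + E + d (Suc i) * h) = 1\<^sub>m (length (sh i))"
proof -
  have c: "d (Suc i) \<in> carrier_mat (length (sh i)) (length (sh (Suc i)))"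
    using resolution_carrier[of sh d I "Suc i"] d by (auto simp: minimal_graded_free_resolution_def)
  have "map_mat const (d (Suc i) * h) = 0\<^sub>m (length (sh i)) (length (sh i))"
    unfolding const_hom.mat_hom_mult[OF c h] minimal_resolution_const[OF d] using h by simp
  then have "const ((d (Suc i) * h) $$ (r, s)) = 0" if "r < length (sh i)" "s < length (sh i)" for r s
    using that c h arg_cong[of _ _ "\<lambda>A. A $$ (r, s)"] by (metis carrier_matD index_map_mat(1) index_mult_mat(2,3) index_zero_mat(1))
  moreover have "const (E $$ (r, s)) = 0" if "r < length (sh i)" "s < length (sh i)" for r s
    using that E by (metis carrier_matD index_map_mat(1) index_zero_mat(1))
  ultimately show ?thesis
    using c h E by (intro eq_matI) (auto simp del: index_mult_mat(1))
qed

text \<open>The maps in both directions and their homotopies are bundled into one statement because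
  each further homotopy depends on both maps chosen before. Of the commuting squares only the
  vanishing of the triple products is recorded, which is what the next lift asks for.\<close>

lemma minimal_resolutions_compare:
  fixes d d' :: "nat \<Rightarrow> ('v, 'k::field) mpoly mat"
  assumes md: "minimal_graded_free_resolution sh d I" and md': "minimal_graded_free_resolution sh' d' I"
  shows "\<exists>\<phi> \<psi> E h E' h'. homogeneous_mat (sh' i) (sh i) \<phi> \<and> homogeneous_mat (sh i) (sh' i) \<psi> \<and>
     d' i * (\<phi> * d (Suc i)) = 0\<^sub>m (dim_row (d' i)) (length (sh (Suc i))) \<and>
     d i * (\<psi> * d' (Suc i)) = 0\<^sub>m (dim_row (d i)) (length (sh' (Suc i))) \<and>
     E \<in> carrier_mat (length (sh i)) (length (sh i)) \<and> E * d (Suc i) = 0\<^sub>m (length (sh i)) (length (sh (Suc i))) \<and>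
     map_mat const E = 0\<^sub>m (length (sh i)) (length (sh i)) \<and>
     h \<in> carrier_mat (length (sh (Suc i))) (length (sh i)) \<and> \<psi> * \<phi> = 1\<^sub>m (length (sh i)) + E + d (Suc i) * h \<and>
     E' \<in> carrier_mat (length (sh' i)) (length (sh' i)) \<and> E' * d' (Suc i) = 0\<^sub>m (length (sh' i)) (length (sh' (Suc i))) \<and>
     map_mat const E' = 0\<^sub>m (length (sh' i)) (length (sh' i)) \<and>
     h' \<in> carrier_mat (length (sh' (Suc i))) (length (sh' i)) \<and> \<phi> * \<psi> = 1\<^sub>m (length (sh' i)) + E' + d' (Suc i) * h'"
proof (induction i)
  note r = md[unfolded minimal_graded_free_resolution_def, THEN conjunct1]
  note r' = md'[unfolded minimal_graded_free_resolution_def, THEN conjunct1]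
  \<comment> \<open>In degree 0 there is no earlier homotopy, so \<open>E\<close> is zero: both maps
    respect the augmentations, hence \<open>\<psi> * \<phi> - 1\<close> lands in the kernel of
    \<open>d 0\<close>. The resolutions are generic here so that both compositions are
    served.\<close>
  have homotopy: "\<exists>E h. E \<in> carrier_mat (length (sh 0)) (length (sh 0)) \<and> E * d (Suc 0) = 0\<^sub>m (length (sh 0)) (length (sh (Suc 0))) \<and>
     map_mat const E = 0\<^sub>m (length (sh 0)) (length (sh 0)) \<and>
     h \<in> carrier_mat (length (sh (Suc 0))) (length (sh 0)) \<and> \<psi> * \<phi> = 1\<^sub>m (length (sh 0)) + E + d (Suc 0) * h"
    if r: "graded_free_resolution sh d I" and r': "graded_free_resolution sh' d' I" and 
      phi: "homogeneous_mat (sh' 0) (sh 0) \<phi>" "d' 0 * \<phi> = d 0"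
      and psi: "homogeneous_mat (sh 0) (sh' 0) \<psi>" "d 0 * \<psi> = d' 0"
    for \<phi> \<psi> and sh sh' and d d' :: "nat \<Rightarrow> ('v, 'k::field) mpoly mat"
  proof -
    let ?n = "length (sh 0)"
    have c: "d 0 \<in> carrier_mat 1 ?n" "d (Suc 0) \<in> carrier_mat ?n (length (sh (Suc 0)))" "\<psi> * \<phi> \<in> carrier_mat ?n ?n"
      using resolution_carrier[OF r, of 0] resolution_carrier[OF r, of "Suc 0"] phi psi by (auto dest!: homogeneous_mat_carrier)
    define Z where "Z = \<psi> * \<phi> - 1\<^sub>m ?n"
    have Z: "Z \<in> carrier_mat ?n ?n" unfolding Z_def by (rule minus_carrier_mat) simp
    have "d 0 * (\<psi> * \<phi>) = d 0"
      using psi phi c by (subst assoc_mult_mat[symmetric, OF c(1)]) (auto dest!: homogeneous_mat_carrier)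
    then have "d 0 * Z = 0\<^sub>m 1 ?n"
      unfolding Z_def using c by (subst mult_minus_distrib_mat[OF c(1)]) auto
    then have "col Z k \<in> mat_image (d (Suc 0))" if "k < ?n" for k
      unfolding resolution_exact[OF r] using col_mem_kernel[OF c(1) Z _ that] by blast
    then obtain h where h: "h \<in> carrier_mat (length (sh (Suc 0))) ?n" "d (Suc 0) * h = Z"
      using mat_lift[OF c(2) Z] by blast
    have "\<psi> * \<phi> = 1\<^sub>m ?n + 0\<^sub>m ?n ?n + Z"
      unfolding Z_def using c by (intro eq_matI) (auto simp del: index_mult_mat(1))
    moreover have "map_mat const (0\<^sub>m ?n ?n :: ('v, 'k::field) mpoly mat) = 0\<^sub>m ?n ?n" by (intro eq_matI) auto
    ultimately show ?thesis using h c by (intro exI[of _ "0\<^sub>m ?n ?n"] exI[of _ h]) auto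
  qed
  case 0
  obtain \<phi> where phi: "homogeneous_mat (sh' 0) (sh 0) \<phi>" "d' 0 * \<phi> = d 0"
    using resolution_lift_aug[OF r r'] by blast
  obtain \<psi> where psi: "homogeneous_mat (sh 0) (sh' 0) \<psi>" "d 0 * \<psi> = d' 0"
    using resolution_lift_aug[OF r' r] by blast
  have zero: "d' 0 * (\<phi> * d (Suc 0)) = 0\<^sub>m (dim_row (d' 0)) (length (sh (Suc 0)))"
    if r: "graded_free_resolution sh d I" and r': "graded_free_resolution sh' d' I" and 
      phi: "homogeneous_mat (sh' 0) (sh 0) \<phi>" "d' 0 * \<phi> = d 0"
    for \<phi> and sh sh' and d d' :: "nat \<Rightarrow> ('v, 'k::field) mpoly mat"
  proof -
    have "d' 0 * (\<phi> * d (Suc 0)) = d' 0 * \<phi> * d (Suc 0)"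
      using phi resolution_carrier[OF r, of "Suc 0"] resolution_carrier[OF r', of 0]
      by (subst assoc_mult_mat) (auto dest!: homogeneous_mat_carrier)
    then show ?thesis using phi resolution_differential_squared[OF r, of 0]
      resolution_carrier[OF r, of 0] resolution_carrier[OF r', of 0] by simp
  qed
  obtain E h E' h' where "E \<in> carrier_mat (length (sh 0)) (length (sh 0)) \<and> E * d (Suc 0) = 0\<^sub>m (length (sh 0)) (length (sh (Suc 0))) \<and>
     map_mat const E = 0\<^sub>m (length (sh 0)) (length (sh 0)) \<and>
     h \<in> carrier_mat (length (sh (Suc 0))) (length (sh 0)) \<and> \<psi> * \<phi> = 1\<^sub>m (length (sh 0)) + E + d (Suc 0) * h"
    "E' \<in> carrier_mat (length (sh' 0)) (length (sh' 0)) \<and> E' * d' (Suc 0) = 0\<^sub>m (length (sh' 0)) (length (sh' (Suc 0))) \<and>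
     map_mat const E' = 0\<^sub>m (length (sh' 0)) (length (sh' 0)) \<and>
     h' \<in> carrier_mat (length (sh' (Suc 0))) (length (sh' 0)) \<and> \<phi> * \<psi> = 1\<^sub>m (length (sh' 0)) + E' + d' (Suc 0) * h'"
    using homotopy[OF r r' phi psi] homotopy[OF r' r psi phi] by blast
  then show ?case using phi(1) psi(1) zero[OF r r' phi] zero[OF r' r psi] by blast
next
  note r = md[unfolded minimal_graded_free_resolution_def, THEN conjunct1]
  note r' = md'[unfolded minimal_graded_free_resolution_def, THEN conjunct1]
  case (Suc i)
  then obtain \<phi> \<psi> E h E' h' where phi: "homogeneous_mat (sh' i) (sh i) \<phi>" and psi: "homogeneous_mat (sh i) (sh' i) \<psi>"
    and "d' i * (\<phi> * d (Suc i)) = 0\<^sub>m (dim_row (d' i)) (length (sh (Suc i)))"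
     "d i * (\<psi> * d' (Suc i)) = 0\<^sub>m (dim_row (d i)) (length (sh' (Suc i)))"
    and E: "E \<in> carrier_mat (length (sh i)) (length (sh i))" "E * d (Suc i) = 0\<^sub>m (length (sh i)) (length (sh (Suc i)))"
    and h: "h \<in> carrier_mat (length (sh (Suc i))) (length (sh i))" "\<psi> * \<phi> = 1\<^sub>m (length (sh i)) + E + d (Suc i) * h"
    and E': "E' \<in> carrier_mat (length (sh' i)) (length (sh' i))" "E' * d' (Suc i) = 0\<^sub>m (length (sh' i)) (length (sh' (Suc i)))"
    and h': "h' \<in> carrier_mat (length (sh' (Suc i))) (length (sh' i))" "\<phi> * \<psi> = 1\<^sub>m (length (sh' i)) + E' + d' (Suc i) * h'"
    by blast
  obtain \<phi>' where phi': "homogeneous_mat (sh' (Suc i)) (sh (Suc i)) \<phi>'" "d' (Suc i) * \<phi>' = \<phi> * d (Suc i)"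
    using resolution_lift[OF r r' phi] \<open>d' i * _ = _\<close> by blast
  obtain \<psi>' where psi': "homogeneous_mat (sh (Suc i)) (sh' (Suc i)) \<psi>'" "d (Suc i) * \<psi>' = \<psi> * d' (Suc i)"
    using resolution_lift[OF r' r psi] \<open>d i * _ = _\<close> by blast
  have zero: "d' (Suc i) * (\<phi>' * d (Suc (Suc i))) = 0\<^sub>m (dim_row (d' (Suc i))) (length (sh (Suc (Suc i))))"
    if r: "graded_free_resolution sh d I" and r': "graded_free_resolution sh' d' I" and phi: "homogeneous_mat (sh' i) (sh i) \<phi>" 
      and phi': "homogeneous_mat (sh' (Suc i)) (sh (Suc i)) \<phi>'" "d' (Suc i) * \<phi>' = \<phi> * d (Suc i)"
    for \<phi> \<phi>' and sh sh' and d d' :: "nat \<Rightarrow> ('v, 'k::field) mpoly mat"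
  proof -
    have c: "d' (Suc i) \<in> carrier_mat (length (sh' i)) (length (sh' (Suc i)))"
      "\<phi>' \<in> carrier_mat (length (sh' (Suc i))) (length (sh (Suc i)))" "d (Suc (Suc i)) \<in> carrier_mat (length (sh (Suc i))) (length (sh (Suc (Suc i))))"
      "\<phi> \<in> carrier_mat (length (sh' i)) (length (sh i))" "d (Suc i) \<in> carrier_mat (length (sh i)) (length (sh (Suc i)))"
      using phi phi' resolution_carrier[OF r, of "Suc i"] resolution_carrier[OF r, of "Suc (Suc i)"] resolution_carrier[OF r', of "Suc i"]
      by (auto dest!: homogeneous_mat_carrier)
    have "d' (Suc i) * (\<phi>' * d (Suc (Suc i))) = \<phi> * d (Suc i) * d (Suc (Suc i))"
      unfolding phi'(2)[symmetric] by (rule assoc_mult_mat[symmetric, OF c(1-3)])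
    also have "\<dots> = \<phi> * (d (Suc i) * d (Suc (Suc i)))" by (rule assoc_mult_mat[OF c(4,5,3)])
    finally show ?thesis using c resolution_differential_squared[OF r, of "Suc i"] by simp
  qed
  obtain E1 h1 where 1: "E1 \<in> carrier_mat (length (sh (Suc i))) (length (sh (Suc i)))"
    "E1 * d (Suc (Suc i)) = 0\<^sub>m (length (sh (Suc i))) (length (sh (Suc (Suc i))))"
    "map_mat const E1 = 0\<^sub>m (length (sh (Suc i))) (length (sh (Suc i)))"
    "h1 \<in> carrier_mat (length (sh (Suc (Suc i)))) (length (sh (Suc i)))"
    "\<psi>' * \<phi>' = 1\<^sub>m (length (sh (Suc i))) + E1 + d (Suc (Suc i)) * h1"
    by (rule homotopy_step[OF md r' phi psi phi' psi' E h])
  obtain E2 h2 where 2: "E2 \<in> carrier_mat (length (sh' (Suc i))) (length (sh' (Suc i)))"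
    "E2 * d' (Suc (Suc i)) = 0\<^sub>m (length (sh' (Suc i))) (length (sh' (Suc (Suc i))))"
    "map_mat const E2 = 0\<^sub>m (length (sh' (Suc i))) (length (sh' (Suc i)))"
    "h2 \<in> carrier_mat (length (sh' (Suc (Suc i)))) (length (sh' (Suc i)))"
    "\<phi>' * \<psi>' = 1\<^sub>m (length (sh' (Suc i))) + E2 + d' (Suc (Suc i)) * h2"
    by (rule homotopy_step[OF md' r psi phi psi' phi' E' h'])
  show ?case
    by (rule exI[of _ \<phi>'], rule exI[of _ \<psi>'], rule exI[of _ E1], rule exI[of _ h1], rule exI[of _ E2], rule exI[of _ h2])
      (intro conjI phi'(1) psi'(1) zero[OF r r' phi phi'] zero[OF r' r psi psi'] 1 2)
qed

text \<open>The comparison maps become mutually inverse modulo the variables, so the numbers of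
  generators of degree \<open>j\<close> bound each other.\<close>

lemma minimal_resolution_count_unique:
  fixes d d' :: "nat \<Rightarrow> ('v, 'k::field) mpoly mat"
  assumes md: "minimal_graded_free_resolution sh d I" and md': "minimal_graded_free_resolution sh' d' I"
  shows "count_list (sh i) j = count_list (sh' i) j"
proof -
  obtain \<phi> \<psi> E h E' h' where phi: "homogeneous_mat (sh' i) (sh i) \<phi>" and psi: "homogeneous_mat (sh i) (sh' i) \<psi>"
    and E: "E \<in> carrier_mat (length (sh i)) (length (sh i))" "map_mat const E = 0\<^sub>m (length (sh i)) (length (sh i))"
    and h: "h \<in> carrier_mat (length (sh (Suc i))) (length (sh i))" "\<psi> * \<phi> = 1\<^sub>m (length (sh i)) + E + d (Suc i) * h"
    and E': "E' \<in> carrier_mat (length (sh' i)) (length (sh' i))" "map_mat const E' = 0\<^sub>m (length (sh' i)) (length (sh' i))"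
    and h': "h' \<in> carrier_mat (length (sh' (Suc i))) (length (sh' i))" "\<phi> * \<psi> = 1\<^sub>m (length (sh' i)) + E' + d' (Suc i) * h'"
    using minimal_resolutions_compare[OF md md', of i] by blast
  show ?thesis
    using count_list_le_if_left_inverse[OF phi psi] count_list_le_if_left_inverse[OF psi phi]
      homotopy_imp_const_inverse[OF md E h(1)] homotopy_imp_const_inverse[OF md' E' h'(1)] h(2) h'(2)
    by (simp add: le_antisym)
qed

lemma betti_eq:
  assumes "minimal_graded_free_resolution sh d I"
  shows "betti I i j = (if i < 0 then 0 else count_list (sh (nat i)) j)"
proof -
  have "(THE b. \<exists>sh d. minimal_graded_free_resolution sh d I \<and> b = count_list (sh (nat i)) j) = count_list (sh (nat i)) j"
    using assms minimal_resolution_count_unique by (intro the_equality) blast+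
  then show ?thesis by (simp add: betti_def)
qed

section \<open>Existence of minimal resolutions of monomial ideals\<close>

text \<open>The exponent of the least common multiple. Inserting 0 makes the empty set yield the
  exponent \<open>0\<close>, and finiteness of the variable type makes the pointwise maximum
  finitely supported.\<close>

definition exp_lcm :: "('v::finite \<Rightarrow>\<^sub>0 nat) set \<Rightarrow> ('v \<Rightarrow>\<^sub>0 nat)" where
  "exp_lcm A = Abs_poly_mapping (\<lambda>v. Max (insert 0 ((\<lambda>e. Poly_Mapping.lookup e v) ` A)))"

lemma lookup_exp_lcm:
  "Poly_Mapping.lookup (exp_lcm A) v = Max (insert 0 ((\<lambda>e. Poly_Mapping.lookup e v) ` A))"
  by (simp add: exp_lcm_def)

text \<open>Subtraction of exponents is truncated, so \<open>a + (b - a) = b\<close> is a genuine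
  condition; it is the form in which divisibility is stated in this section.\<close>

lemma exp_le_imp_add: 
  fixes a b :: "'v \<Rightarrow>\<^sub>0 nat"
  assumes "\<And>v. Poly_Mapping.lookup a v \<le> Poly_Mapping.lookup b v"
  shows "a + (b - a) = b"
  using assms by (intro poly_mapping_eqI) (simp add: lookup_add lookup_minus)

lemma exp_add_diff_shift:
  fixes a b c m s :: "'v \<Rightarrow>\<^sub>0 nat"
  assumes "c + m = b" "b + s = a"
  shows "s + m = a - c"
  unfolding assms(1)[symmetric] assms(2)[symmetric] by (simp add: add.assoc add.commute[of s])

lemma exp_lcm_upper:
  assumes "finite A" "a \<in> A"
  shows "a + (exp_lcm A - a) = exp_lcm A"
  using assms by (intro exp_le_imp_add) (auto simp: lookup_exp_lcm intro!: Max_ge)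

lemma exp_lcm_least:
  assumes "finite A" "\<And>a. a \<in> A \<Longrightarrow> \<exists>m. a + m = b"
  shows "exp_lcm A + (b - exp_lcm A) = b"
proof (rule exp_le_imp_add)
  fix v
  have "Poly_Mapping.lookup a v \<le> Poly_Mapping.lookup b v" if "a \<in> A" for a
    using assms(2)[OF that] by (auto simp: lookup_add)
  then show "Poly_Mapping.lookup (exp_lcm A) v \<le> Poly_Mapping.lookup b v"
    using assms(1) by (simp add: lookup_exp_lcm)
qed

text \<open>The entry condition, with column degree \<open>a\<close> and row degree
  \<open>b\<close>, for a matrix that preserves degrees given by exponent vectors. Writing
  \<open>b + m = a\<close> instead of \<open>m = a - b\<close> forces \<open>f\<close> to vanish
  when \<open>b\<close> does not divide \<open>a\<close>, in spite of truncated subtraction.\<close>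

definition mdeg :: "('v \<Rightarrow>\<^sub>0 nat) \<Rightarrow> ('v \<Rightarrow>\<^sub>0 nat) \<Rightarrow> ('v, 'k::field) mpoly \<Rightarrow> bool" where
  "mdeg a b f \<longleftrightarrow> (\<forall>m\<in>Poly_Mapping.keys f. b + m = a)"

lemma mdeg_zero [simp]: "mdeg a b 0"
  by (simp add: mdeg_def)

lemma mdeg_diff: "mdeg a b f \<Longrightarrow> mdeg a b g \<Longrightarrow> mdeg a b (f - g)"
  using keys_diff[of f g] by (auto simp: mdeg_def)

lemma mdeg_eq_single:
  assumes "mdeg a b (f :: ('v, 'k::field) mpoly)" 
  shows "f = Poly_Mapping.single (a - b) (Poly_Mapping.lookup f (a - b))"
proof (rule poly_mapping_eqI)
  fix m
  show "Poly_Mapping.lookup f m = Poly_Mapping.lookup (Poly_Mapping.single (a - b) (Poly_Mapping.lookup f (a - b))) m"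
  proof (cases "m = a - b")
    case False
    then have "b + m \<noteq> a" by auto
    then show ?thesis using assms False by (auto simp: mdeg_def in_keys_iff lookup_single when_def)
  qed simp
qed

lemma mdeg_imp_homogeneous: "mdeg a b f \<Longrightarrow> homogeneous (int (monomial_degree a) - int (monomial_degree b)) f"
  by (auto simp: mdeg_def homogeneous_def monomial_degree_add)

definition mdeg_mat ::
  "('v \<Rightarrow>\<^sub>0 nat) list \<Rightarrow> ('v \<Rightarrow>\<^sub>0 nat) list \<Rightarrow> ('v, 'k::field) mpoly mat \<Rightarrow> bool" where
  "mdeg_mat rs cs D \<longleftrightarrow> D \<in> carrier_mat (length rs) (length cs) \<and>
     (\<forall>r<length rs. \<forall>c<length cs. mdeg (cs ! c) (rs ! r) (D $$ (r, c)))"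

definition mdeg_kernel ::
  "('v \<Rightarrow>\<^sub>0 nat) list \<Rightarrow> ('v, 'k::field) mpoly mat \<Rightarrow> ('v \<Rightarrow>\<^sub>0 nat) \<Rightarrow> ('v, 'k) mpoly vec set" where
  "mdeg_kernel cs D a = {v \<in> mat_kernel D. \<forall>c<length cs. mdeg a (cs ! c) (v $ c)}"

text \<open>No multihomogeneous relation among the columns has an invertible coefficient. This is
  minimality of the generating set, in the form that makes the next differential minimal.\<close>

definition irredundant_mat :: "('v \<Rightarrow>\<^sub>0 nat) list \<Rightarrow> ('v, 'k::field) mpoly mat \<Rightarrow> bool" where
  "irredundant_mat cs D \<longleftrightarrow> (\<forall>a. \<forall>v\<in>mdeg_kernel cs D a. \<forall>c<length cs. const (v $ c) = 0)"

text \<open>The span of the first components; the second components keep the multidegree of each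
  generator attached to it.\<close>

definition generated :: "nat \<Rightarrow> (('v, 'k::field) mpoly vec \<times> 'e) set \<Rightarrow> ('v, 'k) mpoly vec set" where
  "generated n C = {v \<in> carrier_vec n. \<exists>w. \<forall>r<n. v $ r = (\<Sum>p\<in>C. w p * fst p $ r)}"

lemma generatedI: "v \<in> carrier_vec n \<Longrightarrow> (\<And>r. r < n \<Longrightarrow> v $ r = (\<Sum>p\<in>C. w p * fst p $ r)) \<Longrightarrow> v \<in> generated n C"
  unfolding generated_def by blast

lemma generatedE:
  assumes "v \<in> generated n C"
  obtains w where "v \<in> carrier_vec n" "\<forall>r<n. v $ r = (\<Sum>p\<in>C. w p * fst p $ r)"
  using assms unfolding generated_def by blast

lemma generated_zero: "0\<^sub>v n \<in> generated n C"
  by (rule generatedI[where w = "\<lambda>_. 0"]) auto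

lemma generated_add_smult:
  assumes "u \<in> generated n C" "v \<in> generated n C"
  shows "vec n (\<lambda>i. u $ i + x * v $ i) \<in> generated n C"
proof -
  obtain w where w: "u \<in> carrier_vec n" "\<forall>r<n. u $ r = (\<Sum>p\<in>C. w p * fst p $ r)" using assms(1) by (rule generatedE)
  obtain w' where w': "v \<in> carrier_vec n" "\<forall>r<n. v $ r = (\<Sum>p\<in>C. w' p * fst p $ r)" using assms(2) by (rule generatedE)
  show ?thesis
    by (rule generatedI[where w = "\<lambda>p. w p + x * w' p"])
      (auto simp: w w' sum.distrib sum_distrib_left algebra_simps)
qed

lemma generated_base:
  assumes "finite C" "p \<in> C" "fst p \<in> carrier_vec n"
  shows "fst p \<in> generated n C"
proof (rule generatedI[where w = "\<lambda>q. if q = p then 1 else 0"])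
  fix r assume "r < n"
  have "(\<Sum>q\<in>C. (if q = p then 1 else 0) * fst q $ r) = (\<Sum>q\<in>C. if q = p then fst q $ r else 0)"
    by (rule sum.cong) auto
  then show "fst p $ r = (\<Sum>q\<in>C. (if q = p then 1 else 0) * fst q $ r)" using assms by simp
qed (use assms in auto)

lemma generated_sum:
  assumes "finite Z" "\<And>a. a \<in> Z \<Longrightarrow> g a \<in> generated n C"
  shows "vec n (\<lambda>i. \<Sum>a\<in>Z. g a $ i) \<in> generated n C"
  using assms
proof (induction Z rule: finite_induct)
  case empty
  have "vec n (\<lambda>i. \<Sum>a\<in>{}. g a $ i) = 0\<^sub>v n" by (rule eq_vecI) auto
  then show ?case using generated_zero by metis
next
  case (insert a Z)
  have "vec n (\<lambda>i. vec n (\<lambda>i. \<Sum>a\<in>Z. g a $ i) $ i + 1 * g a $ i) = vec n (\<lambda>i. \<Sum>a\<in>insert a Z. g a $ i)"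
    using insert by (intro eq_vecI) (auto simp: add.commute)
  then show ?case using generated_add_smult[of "vec n (\<lambda>i. \<Sum>a\<in>Z. g a $ i)" n C "g a" 1] insert by simp
qed

lemma const_mdeg_nonzero:
  assumes "mdeg a b (f :: ('v, 'k::field) mpoly)" "const f \<noteq> 0"
  shows "f = Poly_Mapping.single 0 (const f)"
proof -
  have "0 \<in> Poly_Mapping.keys f" using assms(2) by (simp add: const_def in_keys_iff)
  then have "a = b" using assms(1) by (auto simp: mdeg_def)
  then show ?thesis using mdeg_eq_single[OF assms(1)] by (simp add: const_def)
qed

text \<open>A relation whose coefficient at \<open>p\<close> is a nonzero scalar expresses the
  generator \<open>p\<close> through the others.\<close>

lemma generated_remove:
  fixes w :: "('v, 'k::field) mpoly vec \<times> ('v \<Rightarrow>\<^sub>0 nat) \<Rightarrow> ('v, 'k) mpoly"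
  assumes C: "finite C" "p \<in> C"
    and rel: "\<And>r. r < n \<Longrightarrow> (\<Sum>q\<in>C. w q * fst q $ r) = 0"
    and unit: "w p = Poly_Mapping.single 0 k" "k \<noteq> 0"
  shows "generated n (C - {p}) = generated n C"
proof (intro equalityI subsetI)
  fix v assume "v \<in> generated n (C - {p})"
  then obtain u where u: "v \<in> carrier_vec n" "\<forall>r<n. v $ r = (\<Sum>q\<in>C - {p}. u q * fst q $ r)" by (rule generatedE)
  show "v \<in> generated n C"
  proof (rule generatedI[where w = "u(p := 0)"])
    fix r assume "r < n"
    then show "v $ r = (\<Sum>q\<in>C. (u(p := 0)) q * fst q $ r)"
      unfolding sum.remove[OF C] using u(2) by (auto intro!: sum.cong)
  qed (rule u)
next
  fix v assume "v \<in> generated n C"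
  then obtain u where u: "v \<in> carrier_vec n" "\<forall>r<n. v $ r = (\<Sum>q\<in>C. u q * fst q $ r)" by (rule generatedE)
  let ?c = "Poly_Mapping.single 0 (inverse k) :: ('v, 'k) mpoly"
  have ck: "?c * w p = 1" using unit by (simp add: mult_single)
  show "v \<in> generated n (C - {p})"
  \<comment> \<open>Subtracting \<open>u p / k\<close> times the relation leaves the value unchanged
    and makes the coefficient at \<open>p\<close> zero.\<close>
  proof (rule generatedI[where w = "\<lambda>q. u q - u p * ?c * w q"])
    fix r assume r: "r < n"
    have "(\<Sum>q\<in>C. u q * fst q $ r) = (\<Sum>q\<in>C. u q * fst q $ r) - u p * ?c * (\<Sum>q\<in>C. w q * fst q $ r)"
      using rel[OF r] by simp
    also have "\<dots> = (\<Sum>q\<in>C. (u q - u p * ?c * w q) * fst q $ r)"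
      by (simp add: sum_subtractf sum_distrib_left algebra_simps)
    also have "\<dots> = (\<Sum>q\<in>C - {p}. (u q - u p * ?c * w q) * fst q $ r)"
      unfolding sum.remove[OF C] using ck by (simp add: mult.assoc)
    finally show "v $ r = (\<Sum>q\<in>C - {p}. (u q - u p * ?c * w q) * fst q $ r)" using u(2) r by simp
  qed (rule u)
qed

text \<open>Elimination in the role of Nakayama's lemma: a multihomogeneous coefficient with nonzero
  constant term is a scalar, so its generator can be removed, and finiteness of \<open>C\<close>
  ends the process.\<close>

lemma generated_trim:
  fixes C :: "(('v, 'k::field) mpoly vec \<times> ('v \<Rightarrow>\<^sub>0 nat)) set"
  assumes "finite C"
  shows "\<exists>C'\<subseteq>C. generated n C' = generated n C \<and>
     (\<forall>a w. (\<forall>p\<in>C'. mdeg a (snd p) (w p)) \<and> (\<forall>r<n. (\<Sum>p\<in>C'. w p * fst p $ r) = 0) \<longrightarrow> (\<forall>p\<in>C'. const (w p) = 0))"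
  using assms
proof (induction C rule: finite_psubset_induct)
  case (psubset C)
  show ?case
  proof (cases "\<forall>a w. (\<forall>p\<in>C. mdeg a (snd p) (w p)) \<and> (\<forall>r<n. (\<Sum>p\<in>C. w p * fst p $ r) = 0) \<longrightarrow> (\<forall>p\<in>C. const (w p) = 0)")
    case True
    then show ?thesis by (intro exI[of _ C]) simp
  next
    case False
    then obtain a w p where w: "\<forall>p\<in>C. mdeg a (snd p) (w p)" "\<forall>r<n. (\<Sum>p\<in>C. w p * fst p $ r) = 0"
      and p: "p \<in> C" "const (w p) \<noteq> 0" by (simp only: not_all not_imp bex_simps ball_simps simp_thms) blast
    have eq: "generated n (C - {p}) = generated n C"
    proof (rule generated_remove[OF psubset.hyps p(1) _ _ p(2)])
      show "w p = Poly_Mapping.single 0 (const (w p))" using const_mdeg_nonzero[of a "snd p" "w p"] w(1) p by blast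
    qed (use w(2) in blast)
    have "C - {p} \<subset> C" using p by blast
    from psubset.IH[OF this] show ?thesis
      unfolding eq by (elim exE conjE) (intro exI conjI, erule order_trans, auto)
  qed
qed

text \<open>The trimmed generators, listed without repetition, become the columns. A kernel vector
  of this matrix is a relation among them, which is why trimming yields
  \<open>irredundant_mat\<close>.\<close>

lemma generated_to_mat:
  fixes C :: "(('v, 'k::field) mpoly vec \<times> ('v \<Rightarrow>\<^sub>0 nat)) set"
  assumes fin: "finite C" and deg: "\<And>p r. p \<in> C \<Longrightarrow> r < length rs \<Longrightarrow> mdeg (snd p) (rs ! r) (fst p $ r)"
  obtains cs D where "mdeg_mat rs cs D" "mat_image D = generated (length rs) C" "irredundant_mat cs D"
proof -
  obtain C' where C': "C' \<subseteq> C" "generated (length rs) C' = generated (length rs) C"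
    and irr: "\<forall>a w. (\<forall>p\<in>C'. mdeg a (snd p) (w p)) \<and> (\<forall>r<length rs. (\<Sum>p\<in>C'. w p * fst p $ r) = 0) \<longrightarrow> (\<forall>p\<in>C'. const (w p) = 0)"
    using generated_trim[OF fin, of "length rs"] by (elim exE conjE) (rule that, assumption+)
  have "finite C'" using C' fin finite_subset by blast
  then obtain ps where ps: "set ps = C'" "distinct ps" using finite_distinct_list by blast
  define cs where "cs = map snd ps"
  define D where "D = mat (length rs) (length ps) (\<lambda>(r, c). fst (ps ! c) $ r)"
  have D: "D \<in> carrier_mat (length rs) (length cs)" by (simp add: D_def cs_def)
  have bij: "bij_betw ((!) ps) {..<length ps} C'" using ps by (intro bij_betw_nth) auto
  \<comment> \<open>Converts a vector indexed by list positions into a coefficient function on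
    generators; distinctness of \<open>ps\<close> makes the conversion faithful.\<close>
  define w where "w = (\<lambda>(v :: ('v, 'k::field) mpoly vec) p. v $ the_inv_into {..<length ps} ((!) ps) p)"
  have w: "w v (ps ! c) = v $ c" if "c < length ps" for v c
    using the_inv_into_f_f[of "(!) ps" "{..<length ps}" c] bij that by (auto simp: w_def bij_betw_def)
  have Dv: "(D *\<^sub>v v) $ r = (\<Sum>p\<in>C'. u p * fst p $ r)" 
    if v: "v \<in> carrier_vec (length ps)" and r: "r < length rs" and vu: "\<And>c. c < length ps \<Longrightarrow> u (ps ! c) = v $ c" for v u r
  proof -
    have "(D *\<^sub>v v) $ r = (\<Sum>c<length ps. u (ps ! c) * fst (ps ! c) $ r)"
      using v r by (subst index_mult_mat_vec_sum[OF D]) (auto simp: cs_def D_def vu mult.commute)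
    then show ?thesis using sum.reindex_bij_betw[OF bij, of "\<lambda>p. u p * fst p $ r"] by simp
  qed
  have "mdeg_mat rs cs D"
    unfolding mdeg_mat_def
  proof (intro conjI allI impI D)
    fix r c assume rc: "r < length rs" "c < length cs"
    then have "ps ! c \<in> C" using C'(1) ps(1) by (auto simp: cs_def)
    then show "mdeg (cs ! c) (rs ! r) (D $$ (r, c))" using deg rc by (simp add: cs_def D_def)
  qed
  moreover have "mat_image D = generated (length rs) C'"
  proof (intro equalityI subsetI)
    fix u assume "u \<in> mat_image D"
    then obtain v where v: "v \<in> carrier_vec (length ps)" "u = D *\<^sub>v v" using D by (auto simp: mat_image_def cs_def)
    show "u \<in> generated (length rs) C'"
      by (rule generatedI[where w = "w v"]) (use v w Dv[of v _ "w v"] mult_mat_vec_carrier[OF D, of v] in \<open>auto simp: cs_def simp del: index_mult_mat_vec\<close>)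
  next
    fix u assume "u \<in> generated (length rs) C'"
    then obtain x where x: "u \<in> carrier_vec (length rs)" "\<forall>r<length rs. u $ r = (\<Sum>p\<in>C'. x p * fst p $ r)" by (rule generatedE)
    define v where "v = vec (length ps) (\<lambda>c. x (ps ! c))"
    have v: "v \<in> carrier_vec (length ps)" by (simp add: v_def)
    have "D *\<^sub>v v = u"
    proof (rule eq_vecI)
      fix r assume "r < dim_vec u"
      then show "(D *\<^sub>v v) $ r = u $ r" using x by (subst Dv[OF v, of _ x]) (auto simp: v_def)
    qed (use x D in auto)
    then show "u \<in> mat_image D" using v D unfolding mat_image_def cs_def by auto
  qed
  moreover have "irredundant_mat cs D"
    unfolding irredundant_mat_def
  proof (intro allI ballI impI)
    fix a v c assume v: "v \<in> mdeg_kernel cs D a" and c: "c < length cs"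
    have vc: "v \<in> carrier_vec (length ps)" "D *\<^sub>v v = 0\<^sub>v (length rs)" using v D by (auto simp: mdeg_kernel_def mat_kernel_def cs_def)
    have "\<forall>p\<in>C'. const (w v p) = 0"
    proof (rule irr[THEN spec[of _ a], THEN spec[of _ "w v"], THEN mp], intro conjI ballI allI impI)
      fix p assume "p \<in> C'"
      then obtain c where c: "c < length ps" "p = ps ! c" using ps by (metis in_set_conv_nth)
      then show "mdeg a (snd p) (w v p)" using v w by (auto simp: mdeg_kernel_def cs_def)
    next
      fix r assume "r < length rs"
      then show "(\<Sum>p\<in>C'. w v p * fst p $ r) = 0" using Dv[OF vc(1) _ w, of r] vc by simp
    qed
    moreover have "ps ! c \<in> C'" using c ps(1) by (auto simp: cs_def)
    ultimately show "const (v $ c) = 0" using c w[of c v] by (auto simp: cs_def)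
  qed
  ultimately show ?thesis using that C' by metis
qed

text \<open>A kernel vector of degree \<open>a\<close> is divisible by the monomial
  \<open>mon s\<close> as soon as \<open>b\<close> is still a common multiple of the column degrees
  in its support. The quotient stays in the kernel since a monomial is not a zero divisor.\<close>

lemma mdeg_kernel_shift:
  fixes D :: "('v, 'k::field) mpoly mat"
  assumes D: "D \<in> carrier_mat n (length cs)" and v: "v \<in> mdeg_kernel cs D a" and ba: "b + s = a"
    and le: "\<And>c. c < length cs \<Longrightarrow> v $ c \<noteq> 0 \<Longrightarrow> cs ! c + (b - cs ! c) = b"
  obtains v' where "v' \<in> mdeg_kernel cs D b" "\<And>c. c < length cs \<Longrightarrow> v $ c = mon s * v' $ c"
proof -
  let ?N = "length cs"
  define v' where "v' = vec ?N (\<lambda>c. Poly_Mapping.single (b - cs ! c) (Poly_Mapping.lookup (v $ c) (a - cs ! c)))"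
  have vc: "v \<in> carrier_vec ?N" and Dv: "D *\<^sub>v v = 0\<^sub>v n" and dv: "\<And>c. c < ?N \<Longrightarrow> mdeg a (cs ! c) (v $ c)"
    using v D by (auto simp: mdeg_kernel_def mat_kernel_def)
  have sv: "v $ c = mon s * v' $ c" if c: "c < ?N" for c
  proof (cases "v $ c = 0")
    case False
    have "s + (b - cs ! c) = a - cs ! c"
      using le[OF c False] ba by (rule exp_add_diff_shift)
    then show ?thesis using mdeg_eq_single[OF dv[OF c]] c by (simp add: v'_def mult_single)
  qed (use c in \<open>simp add: v'_def\<close>)
  have v'c: "v' \<in> carrier_vec ?N" by (simp add: v'_def)
  have "D *\<^sub>v v' = 0\<^sub>v n"
  proof (rule eq_vecI)
    fix r assume "r < dim_vec (0\<^sub>v n :: ('v, 'k::field) mpoly vec)"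
    then have r: "r < n" by simp
    have "mon s * (D *\<^sub>v v') $ r = (\<Sum>c<?N. D $$ (r, c) * (mon s * v' $ c))"
      by (simp add: index_mult_mat_vec_sum[OF D v'c r] sum_distrib_left mult.left_commute del: index_mult_mat_vec)
    also have "\<dots> = (D *\<^sub>v v) $ r"
      unfolding index_mult_mat_vec_sum[OF D vc r] by (rule sum.cong) (auto simp: sv)
    finally have "mon s * (D *\<^sub>v v') $ r = mon s * 0" using Dv r by simp
    then have "(D *\<^sub>v v') $ r = 0" by (rule single_times_cancel)
    then show "(D *\<^sub>v v') $ r = 0\<^sub>v n $ r" using r by simp
  qed (use D in auto)
  moreover have "mdeg b (cs ! c) (v' $ c)" if c: "c < ?N" for c
  proof (cases "v $ c = 0")
    case False
    then show ?thesis using le[OF c] c by (auto simp: v'_def mdeg_def split: if_splits)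
  qed (use c in \<open>simp add: v'_def\<close>)
  ultimately have "v' \<in> mdeg_kernel cs D b" using v'c D by (auto simp: mdeg_kernel_def mat_kernel_def)
  then show ?thesis using that sv by blast
qed

section \<open>Finite generation of kernels of multigraded matrices\<close>

lemma mat_kernel_iff_sum:
  assumes "D \<in> carrier_mat n k"
  shows "v \<in> mat_kernel D \<longleftrightarrow> v \<in> carrier_vec k \<and> (\<forall>r<n. (\<Sum>c<k. D $$ (r, c) * v $ c) = 0)"
proof -
  have "D *\<^sub>v v = 0\<^sub>v n \<longleftrightarrow> (\<forall>r<n. (D *\<^sub>v v) $ r = 0)"
    using assms by (auto simp: vec_eq_iff simp del: index_mult_mat_vec)
  moreover have "(D *\<^sub>v v) $ r = (\<Sum>c<k. D $$ (r, c) * v $ c)" if "v \<in> carrier_vec k" "r < n" for r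
    using index_mult_mat_vec_sum[OF assms that] .
  ultimately show ?thesis unfolding mat_kernel[OF assms] mem_Collect_eq by metis
qed

text \<open>One generator for each possible support suffices: subtracting a multiple of the chosen
  kernel vector with the same support makes the support of a multihomogeneous kernel vector
  smaller. The degree of the chosen vector is the least one possible for its support.\<close>

lemma mdeg_kernel_finitely_generated:
  fixes D :: "('v::finite, 'k::field) mpoly mat"
  assumes D: "mdeg_mat rs cs D"
  obtains C where "finite C" "\<And>p c. p \<in> C \<Longrightarrow> c < length cs \<Longrightarrow> mdeg (snd p) (cs ! c) (fst p $ c)"
    "generated (length cs) C = mat_kernel D"
proof -
  let ?N = "length cs" and ?n = "length rs"
  have Dc: "D \<in> carrier_mat ?n ?N" using D by (simp add: mdeg_mat_def)
  define supp where "supp = (\<lambda>v :: ('v, 'k) mpoly vec. {c. c < ?N \<and> v $ c \<noteq> 0})"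
  have supp_fin: "finite (supp v)" for v by (simp add: supp_def)
  \<comment> \<open>The degree \<open>a\<close> ranges over infinitely many exponents, but the
    supports are sets of column indices, so there are finitely many of them.\<close>
  define \<T> where "\<T> = {T. \<exists>a. \<exists>v\<in>mdeg_kernel cs D a. supp v = T}"
  define lc where "lc = (\<lambda>T. exp_lcm ((!) cs ` T))"
  have lcm_le: "lc (supp v) + (a - lc (supp v)) = a" if "v \<in> mdeg_kernel cs D a" for a v
    unfolding lc_def
  proof (rule exp_lcm_least)
    fix b assume "b \<in> (!) cs ` supp v"
    then obtain c where c: "c < ?N" "v $ c \<noteq> 0" "b = cs ! c" by (auto simp: supp_def)
    then obtain m where "m \<in> Poly_Mapping.keys (v $ c)" by (metis poly_mapping_eqI in_keys_iff lookup_zero)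
    then show "\<exists>m. b + m = a" using that c by (auto simp: mdeg_kernel_def mdeg_def)
  qed (simp add: supp_fin)
  \<comment> \<open>Any witness for \<open>T\<close> is divided by the excess of its degree over the
    least common multiple; the support does not change.\<close>
  have "\<exists>v. v \<in> mdeg_kernel cs D (lc T) \<and> supp v = T" if TT: "T \<in> \<T>" for T
  proof -
    obtain a v where v: "v \<in> mdeg_kernel cs D a" "supp v = T" using TT unfolding \<T>_def by blast
    obtain v' where v': "v' \<in> mdeg_kernel cs D (lc T)" "\<And>c. c < ?N \<Longrightarrow> v $ c = mon (a - lc T) * v' $ c"
    proof (rule mdeg_kernel_shift[OF Dc v(1)])
      show "lc T + (a - lc T) = a" using lcm_le[OF v(1)] v(2) by simp
      show "cs ! c + (lc T - cs ! c) = lc T" if "c < ?N" "v $ c \<noteq> 0" for c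
        unfolding lc_def using that v(2) supp_fin[of v] by (intro exp_lcm_upper) (auto simp: supp_def)
    qed (use that in blast)
    have "supp v' = T"
    proof -
      have "v $ c = 0 \<longleftrightarrow> v' $ c = 0" if "c < ?N" for c
        using v'(2)[OF that] single_times_cancel[of "a - lc T" "v' $ c" 0] by auto
      then show ?thesis using v(2) by (auto simp: supp_def)
    qed
    then show ?thesis using v' by blast
  qed
  then obtain g where g: "\<And>T. T \<in> \<T> \<Longrightarrow> g T \<in> mdeg_kernel cs D (lc T)" "\<And>T. T \<in> \<T> \<Longrightarrow> supp (g T) = T"
    by metis
  define C where "C = (\<lambda>T. (g T, lc T)) ` \<T>"
  have "\<T> \<subseteq> Pow {..<?N}" by (auto simp: \<T>_def supp_def)
  then have finC: "finite C" unfolding C_def by (intro finite_imageI) (rule finite_subset, auto)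
  have kerC: "fst p \<in> mdeg_kernel cs D (snd p)" if "p \<in> C" for p using that g by (auto simp: C_def)
  have "u \<in> generated ?N C" if "u \<in> mdeg_kernel cs D a" for u a
    using that
  proof (induction "card (supp u)" arbitrary: u rule: less_induct)
    case less
    have uc: "u \<in> carrier_vec ?N" using less.prems Dc by (auto simp: mdeg_kernel_def mat_kernel_def)
    show ?case
    proof (cases "supp u = {}")
      case True
      then have "u = 0\<^sub>v ?N" using uc by (intro eq_vecI) (auto simp: supp_def)
      then show ?thesis using generated_zero by metis
    next
      case False
      then obtain c0 where c0: "c0 \<in> supp u" by blast
      define T where "T = supp u"
      have T: "T \<in> \<T>" using less.prems by (auto simp: \<T>_def T_def)
      let ?t = "g T" and ?l = "lc T"
      define s where "s = a - ?l"
      have ls: "?l + s = a" using lcm_le[OF less.prems] by (simp add: s_def T_def)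
      have tc: "?t \<in> carrier_vec ?N" using g(1)[OF T] Dc by (auto simp: mdeg_kernel_def mat_kernel_def)
      \<comment> \<open>At \<open>c0\<close> both vectors consist of a single term, with
        coefficients \<open>k\<close> and \<open>k'\<close>. The multiple of the chosen vector by
        \<open>k / k'\<close> times \<open>mon s\<close> has the degree of \<open>u\<close> and
        cancels that entry; equality of supports prevents new entries.\<close>
      define k k' where "k = Poly_Mapping.lookup (u $ c0) (a - cs ! c0)" and "k' = Poly_Mapping.lookup (?t $ c0) (?l - cs ! c0)"
      have c0': "c0 < ?N" "u $ c0 \<noteq> 0" "?t $ c0 \<noteq> 0" using c0 g(2)[OF T] by (auto simp: T_def supp_def)
      have du: "\<And>c. c < ?N \<Longrightarrow> mdeg a (cs ! c) (u $ c)" and dt: "\<And>c. c < ?N \<Longrightarrow> mdeg ?l (cs ! c) (?t $ c)"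
        using less.prems g(1)[OF T] by (auto simp: mdeg_kernel_def)
      have uk: "u $ c0 = Poly_Mapping.single (a - cs ! c0) k" and tk: "?t $ c0 = Poly_Mapping.single (?l - cs ! c0) k'"
        using mdeg_eq_single[OF du] mdeg_eq_single[OF dt] c0'(1) by (simp_all add: k_def k'_def)
      have k': "k' \<noteq> 0" using c0' tk by auto
      let ?x = "Poly_Mapping.single s (k / k') :: ('v, 'k) mpoly"
      define u' where "u' = vec ?N (\<lambda>c. u $ c - ?x * ?t $ c)"
      have u'0: "u' $ c0 = 0"
      proof -
        have "s + (?l - cs ! c0) = a - cs ! c0"
        proof -
          have "cs ! c0 + (?l - cs ! c0) = ?l"
            unfolding lc_def T_def using supp_fin[of u] c0 by (intro exp_lcm_upper) auto
          then show ?thesis using ls by (rule exp_add_diff_shift)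
        qed
        then show ?thesis using c0' k' by (simp add: u'_def uk tk mult_single)
      qed
      have "supp u' \<subseteq> T - {c0}"
      proof
        fix c assume c: "c \<in> supp u'"
        then have "c \<noteq> c0" "c < ?N" using u'0 by (auto simp: supp_def)
        moreover have "c \<in> T"
        proof (rule ccontr)
          assume "c \<notin> T"
          then have "c \<notin> supp u" "c \<notin> supp ?t" using g(2)[OF T] by (auto simp: T_def)
          then show False using c by (auto simp: supp_def u'_def)
        qed
        ultimately show "c \<in> T - {c0}" by blast
      qed
      moreover have "T - {c0} \<subset> T" using c0 by (auto simp: T_def)
      ultimately have "supp u' \<subset> supp u" unfolding T_def by blast
      then have "card (supp u') < card (supp u)" using supp_fin psubset_card_mono by blast
      moreover have "u' \<in> mdeg_kernel cs D a"
      proof -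
        have "mdeg a (cs ! c) (u' $ c)" if c: "c < ?N" for c
        proof -
          have "mdeg a (cs ! c) (?x * ?t $ c)"
            using dt[OF c] ls by (auto simp: mdeg_def elim!: keys_times split: if_splits) (metis add.commute add.left_commute)
          then show ?thesis using du[OF c] c by (simp add: u'_def mdeg_diff)
        qed
        moreover have "u' \<in> mat_kernel D"
          unfolding mat_kernel_iff_sum[OF Dc]
        proof (intro conjI allI impI)
          fix r assume r: "r < ?n"
          have "(\<Sum>c<?N. D $$ (r, c) * u' $ c) = (\<Sum>c<?N. D $$ (r, c) * u $ c) - ?x * (\<Sum>c<?N. D $$ (r, c) * ?t $ c)"
            by (simp add: u'_def sum_subtractf sum_distrib_left algebra_simps)
          also have "\<dots> = 0"
            using less.prems g(1)[OF T] r by (simp add: mdeg_kernel_def mat_kernel_iff_sum[OF Dc])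
          finally show "(\<Sum>c<?N. D $$ (r, c) * u' $ c) = 0" .
        qed (simp add: u'_def)
        ultimately show ?thesis by (simp add: mdeg_kernel_def)
      qed
      ultimately have "u' \<in> generated ?N C" by (rule less.hyps)
      moreover have "?t \<in> generated ?N C"
        using generated_base[OF finC, of "(?t, ?l)"] T tc by (auto simp: C_def)
      ultimately have "vec ?N (\<lambda>i. u' $ i + ?x * ?t $ i) \<in> generated ?N C" by (rule generated_add_smult)
      also have "vec ?N (\<lambda>i. u' $ i + ?x * ?t $ i) = u" using uc by (intro eq_vecI) (auto simp: u'_def)
      finally show ?thesis .
    qed
  qed
  note gen = this
  have "mat_kernel D = generated ?N C"
  proof (intro equalityI subsetI)
    fix f assume f: "f \<in> mat_kernel D"
    then have fc: "f \<in> carrier_vec ?N" using mat_kernel_iff_sum[OF Dc] by blast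
    \<comment> \<open>The finitely many multidegrees occurring in \<open>f\<close>. As
      \<open>D\<close> preserves multidegrees, each component \<open>h a\<close> is again in the
      kernel, and \<open>f\<close> is the sum of these components.\<close>
    define Z where "Z = (\<Union>c<?N. (+) (cs ! c) ` Poly_Mapping.keys (f $ c))"
    have Z: "finite Z" by (simp add: Z_def)
    define h where "h = (\<lambda>a. vec ?N (\<lambda>c. restr {m. cs ! c + m = a} (f $ c)))"
    have "h a \<in> generated ?N C" for a
    proof (rule gen[of _ a])
      have "h a \<in> mat_kernel D"
        unfolding mat_kernel_iff_sum[OF Dc]
      proof (intro conjI allI impI)
        fix r assume r: "r < ?n"
        have "(\<Sum>c<?N. D $$ (r, c) * h a $ c) = (\<Sum>c<?N. restr {m. rs ! r + m = a} (D $$ (r, c) * f $ c))"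
        proof (rule sum.cong[OF refl])
          fix c assume "c \<in> {..<?N}"
          then have c: "c < ?N" by simp
          have "restr {m. rs ! r + m = a} (D $$ (r, c) * f $ c) = D $$ (r, c) * restr {m. cs ! c + m = a} (f $ c)"
          proof (rule restr_times)
            fix m m' assume "m \<in> Poly_Mapping.keys (D $$ (r, c))"
            then have "rs ! r + m = cs ! c" using D r c by (auto simp: mdeg_mat_def mdeg_def)
            then show "m + m' \<in> {m. rs ! r + m = a} \<longleftrightarrow> m' \<in> {m. cs ! c + m = a}" by (auto simp flip: add.assoc)
          qed
          then show "D $$ (r, c) * h a $ c = restr {m. rs ! r + m = a} (D $$ (r, c) * f $ c)" using c by (simp add: h_def)
        qed
        also have "\<dots> = restr {m. rs ! r + m = a} (\<Sum>c<?N. D $$ (r, c) * f $ c)" by (simp add: restr_sum)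
        also have "\<dots> = 0" using f r by (simp add: mat_kernel_iff_sum[OF Dc])
        finally show "(\<Sum>c<?N. D $$ (r, c) * h a $ c) = 0" .
      qed (simp add: h_def)
      then show "h a \<in> mdeg_kernel cs D a" by (auto simp: mdeg_kernel_def h_def mdeg_def keys_restr)
    qed
    then have "vec ?N (\<lambda>i. \<Sum>a\<in>Z. h a $ i) \<in> generated ?N C" by (intro generated_sum Z) auto
    also have "vec ?N (\<lambda>i. \<Sum>a\<in>Z. h a $ i) = f"
    proof (rule eq_vecI)
      fix c assume "c < dim_vec f"
      then have c: "c < ?N" using fc by simp
      have "(\<Sum>a\<in>Z. restr {m. cs ! c + m = a} (f $ c)) = f $ c"
      proof (rule poly_mapping_eqI)
        fix m
        have "Poly_Mapping.lookup (\<Sum>a\<in>Z. restr {m. cs ! c + m = a} (f $ c)) m = (\<Sum>a\<in>Z. if cs ! c + m = a then Poly_Mapping.lookup (f $ c) m else 0)"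
          by (simp add: lookup_sum lookup_restr)
        also have "\<dots> = (if cs ! c + m \<in> Z then Poly_Mapping.lookup (f $ c) m else 0)" using Z by simp
        also have "\<dots> = Poly_Mapping.lookup (f $ c) m"
        proof (cases "m \<in> Poly_Mapping.keys (f $ c)")
          case True
          then have "cs ! c + m \<in> Z" using c unfolding Z_def by blast
          then show ?thesis by simp
        qed (simp add: in_keys_iff)
        finally show "Poly_Mapping.lookup (\<Sum>a\<in>Z. restr {m. cs ! c + m = a} (f $ c)) m = Poly_Mapping.lookup (f $ c) m" .
      qed
      then show "vec ?N (\<lambda>i. \<Sum>a\<in>Z. h a $ i) $ c = f $ c" using c by (simp add: h_def)
    qed (use fc in auto)
    finally show "f \<in> generated ?N C" .
  next
    fix f assume "f \<in> generated ?N C"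
    then obtain w where w: "f \<in> carrier_vec ?N" "\<forall>c<?N. f $ c = (\<Sum>p\<in>C. w p * fst p $ c)" by (rule generatedE)
    show "f \<in> mat_kernel D"
      unfolding mat_kernel_iff_sum[OF Dc]
    proof (intro conjI allI impI w(1))
      fix r assume r: "r < ?n"
      have "(\<Sum>c<?N. D $$ (r, c) * f $ c) = (\<Sum>c<?N. \<Sum>p\<in>C. w p * (D $$ (r, c) * fst p $ c))"
        by (intro sum.cong) (auto simp: w(2) sum_distrib_left mult.left_commute)
      also have "\<dots> = (\<Sum>p\<in>C. w p * (\<Sum>c<?N. D $$ (r, c) * fst p $ c))"
        by (subst sum.swap) (simp add: sum_distrib_left)
      also have "\<dots> = 0"
      proof (rule sum.neutral, rule ballI)
        fix p assume "p \<in> C"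
        then have "fst p \<in> mat_kernel D" using kerC by (auto simp: mdeg_kernel_def)
        then show "w p * (\<Sum>c<?N. D $$ (r, c) * fst p $ c) = 0" using r by (simp add: mat_kernel_iff_sum[OF Dc])
      qed
      finally show "(\<Sum>c<?N. D $$ (r, c) * f $ c) = 0" .
    qed
  qed
  then show ?thesis using that[OF finC] kerC by (auto simp: mdeg_kernel_def)
qed

lemma mdeg_mat_next:
  fixes D :: "('v::finite, 'k::field) mpoly mat"
  assumes D: "mdeg_mat rs cs D"
  obtains cs' D' where "mdeg_mat cs cs' D'" "irredundant_mat cs' D'" "mat_image D' = mat_kernel D"
proof -
  obtain C where C: "finite C" "\<And>p c. p \<in> C \<Longrightarrow> c < length cs \<Longrightarrow> mdeg (snd p) (cs ! c) (fst p $ c)"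
    "generated (length cs) C = mat_kernel D"
    using mdeg_kernel_finitely_generated[OF D] by blast
  obtain cs' D' where "mdeg_mat cs cs' D'" "mat_image D' = generated (length cs) C" "irredundant_mat cs' D'"
    using generated_to_mat[OF C(1,2)] by blast
  then show ?thesis using that C(3) by simp
qed

lemma mdeg_mat_exp_ideal:
  fixes E :: "('v \<Rightarrow>\<^sub>0 nat) set"
  assumes E: "finite E"
  obtains cs and D :: "('v, 'k::field) mpoly mat" where "mdeg_mat [0] cs D" "irredundant_mat cs D"
    "mat_image D = {v \<in> carrier_vec 1. v $ 0 \<in> exp_ideal (up_closure E)}"
proof -
  let ?I = "exp_ideal (up_closure E) :: ('v, 'k) mpoly set"
  define C where "C = (\<lambda>e. (vec 1 (\<lambda>_. mon e :: ('v, 'k) mpoly), e)) ` E"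
  have C: "finite C" using E by (simp add: C_def)
  obtain cs D where D: "mdeg_mat [0] cs D" "mat_image D = generated (length [0 :: 'v \<Rightarrow>\<^sub>0 nat]) C" "irredundant_mat cs D"
    by (rule generated_to_mat[OF C, of "[0]"]) (auto simp: C_def mdeg_def)
  have I: "ideal ?I poly_ring" by (intro ideal_exp_ideal up_closure_add)
  have "generated 1 C = {v \<in> carrier_vec 1. v $ 0 \<in> ?I}"
  proof (intro equalityI subsetI)
    fix v assume "v \<in> generated 1 C"
    then obtain w where w: "v \<in> carrier_vec 1" "\<forall>r<1. v $ r = (\<Sum>p\<in>C. w p * fst p $ r)" by (rule generatedE)
    have "(\<Sum>p\<in>C. w p * fst p $ 0) \<in> ?I"
    proof (rule ideal_sum[OF I])
      fix p assume "p \<in> C"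
      then have "fst p $ 0 \<in> ?I" by (auto simp: C_def up_closure_self)
      then show "w p * fst p $ 0 \<in> ?I" using I by (auto simp: ideal_poly_ring_iff)
    qed
    then show "v \<in> {v \<in> carrier_vec 1. v $ 0 \<in> ?I}" using w by simp
  next
    fix v assume v: "v \<in> {v \<in> carrier_vec 1. v $ 0 \<in> ?I}"
    \<comment> \<open>The polynomials reached by \<open>C\<close> form an ideal containing the
      generators, so leastness of the generated ideal gives the inclusion.\<close>
    let ?J = "{f. vec 1 (\<lambda>_. f) \<in> generated 1 C}"
    have add: "f + x * g \<in> ?J" if "f \<in> ?J" "g \<in> ?J" for f g x
    proof -
      have "vec 1 (\<lambda>i. vec 1 (\<lambda>_. f) $ i + x * vec 1 (\<lambda>_. g) $ i) \<in> generated 1 C"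
        using that by (intro generated_add_smult) auto
      also have "vec 1 (\<lambda>i. vec 1 (\<lambda>_. f) $ i + x * vec 1 (\<lambda>_. g) $ i) = vec 1 (\<lambda>_. f + x * g)" by (rule eq_vecI) auto
      finally show ?thesis by simp
    qed
    have zero: "0 \<in> ?J"
    proof -
      have "vec 1 (\<lambda>_. 0) = (0\<^sub>v 1 :: ('v, 'k) mpoly vec)" by (rule eq_vecI) auto
      then show ?thesis using generated_zero by simp
    qed
    have "ideal ?J poly_ring"
      unfolding ideal_poly_ring_iff using add[of _ _ 1] add[OF zero] zero by auto
    moreover have "mon ` E \<subseteq> ?J"
    proof clarify
      fix e assume e: "e \<in> E"
      then show "vec 1 (\<lambda>_. mon e) \<in> generated 1 C"
        using generated_base[OF C, of "(vec 1 (\<lambda>_. mon e), e)" 1] by (auto simp: C_def)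
    qed
    ultimately have "?I \<subseteq> ?J" unfolding Idl_mon[symmetric] by (rule Idl_least)
    moreover have "v = vec 1 (\<lambda>_. v $ 0)" using v by (intro eq_vecI) auto
    ultimately show "v \<in> generated 1 C" using v by auto
  qed
  then show ?thesis using that D by simp
qed

text \<open>A stage stores row degrees, column degrees and a matrix. Dependent choice continues with
  a trimmed generating matrix of the kernel, whose row degrees are the previous column
  degrees.\<close>

lemma exists_minimal_resolution:
  fixes E :: "('v::finite \<Rightarrow>\<^sub>0 nat) set"
  assumes E: "finite E"
  shows "\<exists>sh d. minimal_graded_free_resolution sh d (exp_ideal (up_closure E) :: ('v, 'k::field) mpoly set)"
proof -
  let ?I = "exp_ideal (up_closure E) :: ('v, 'k) mpoly set"
  let ?P = "\<lambda>i (rs, cs, D). mdeg_mat rs cs D \<and> irredundant_mat cs D \<and>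
    (i = (0::nat) \<longrightarrow> rs = [0] \<and> mat_image D = {v \<in> carrier_vec 1. v $ 0 \<in> ?I})"
  let ?Q = "\<lambda>(i::nat) (rs, cs, D) (rs', cs', D'). rs' = cs \<and> mat_image D' = mat_kernel D"
  have "\<exists>f. \<forall>i. ?P i (f i) \<and> ?Q i (f i) (f (Suc i))"
  proof (rule dependent_nat_choice)
    obtain cs and D :: "('v, 'k) mpoly mat" where "mdeg_mat [0] cs D" "irredundant_mat cs D"
      "mat_image D = {v \<in> carrier_vec 1. v $ 0 \<in> ?I}"
      by (rule mdeg_mat_exp_ideal[OF E])
    then show "\<exists>s. ?P 0 s" by (intro exI[of _ "([0], cs, D)"]) simp
    fix s i assume s: "?P i s"
    obtain rs cs D where sD: "s = (rs, cs, D)" by (cases s)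
    obtain cs' D' where "mdeg_mat cs cs' D'" "irredundant_mat cs' D'" "mat_image D' = mat_kernel D"
      using mdeg_mat_next[of rs cs D] s sD by blast
    then show "\<exists>s'. ?P (Suc i) s' \<and> ?Q i s s'" unfolding sD by (intro exI[of _ "(cs, cs', D')"]) simp
  qed
  then obtain f where "\<forall>i. ?P i (f i) \<and> ?Q i (f i) (f (Suc i))" by (rule exE)
  then have f: "?P i (f i)" "?Q i (f i) (f (Suc i))" for i by simp_all
  define cs D where "cs = (\<lambda>i. fst (snd (f i)))" and "D = (\<lambda>i. snd (snd (f i)))"
  have D0: "mdeg_mat [0] (cs 0) (D 0)" "mat_image (D 0) = {v \<in> carrier_vec 1. v $ 0 \<in> ?I}"
    using f(1)[of 0] by (auto simp: cs_def D_def split_def)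
  have irr: "irredundant_mat (cs i) (D i)" for i using f(1)[of i] by (auto simp: cs_def D_def split_def)
  have Suc: "mdeg_mat (cs i) (cs (Suc i)) (D (Suc i))" "mat_image (D (Suc i)) = mat_kernel (D i)" for i
    using f(1)[of "Suc i"] f(2)[of i] by (auto simp: cs_def D_def split_def)
  define sh where "sh = (\<lambda>i. map (\<lambda>e. int (monomial_degree e)) (cs i))"
  have c0: "D 0 \<in> carrier_mat 1 (length (cs 0))" using D0 by (auto simp: mdeg_mat_def)
  have cS: "D (Suc i) \<in> carrier_mat (length (cs i)) (length (cs (Suc i)))" for i using Suc[of i] by (auto simp: mdeg_mat_def)
  have "graded_free_resolution sh D ?I"
    unfolding graded_free_resolution_def
  proof (intro conjI allI impI)
    show "D 0 \<in> carrier_mat 1 (length (sh 0))" using c0 by (simp add: sh_def)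
    fix c assume "c < length (sh 0)"
    then have c: "c < length (cs 0)" by (simp add: sh_def)
    then have "mdeg (cs 0 ! c) 0 (D 0 $$ (0, c))" using D0 by (auto simp: mdeg_mat_def)
    from mdeg_imp_homogeneous[OF this] show "homogeneous (sh 0 ! c) (D 0 $$ (0, c))" using c by (simp add: sh_def)
  next
    have "(\<lambda>v. (D 0 *\<^sub>v v) $ 0) ` carrier_vec (length (sh 0)) = (\<lambda>v. v $ 0) ` mat_image (D 0)"
      using c0 by (simp add: mat_image_def image_image sh_def)
    also have "\<dots> = ?I"
    proof (intro equalityI subsetI)
      fix g assume "g \<in> ?I"
      then have "vec 1 (\<lambda>_. g) \<in> mat_image (D 0)" "g = vec 1 (\<lambda>_. g) $ 0" by (auto simp: D0(2))
      then show "g \<in> (\<lambda>v. v $ 0) ` mat_image (D 0)" by blast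
    qed (auto simp: D0(2))
    finally show "(\<lambda>v. (D 0 *\<^sub>v v) $ 0) ` carrier_vec (length (sh 0)) = ?I" .
  next
    fix i
    show "D (Suc i) \<in> carrier_mat (length (sh i)) (length (sh (Suc i)))" using cS by (simp add: sh_def)
    show "(\<lambda>v. D (Suc i) *\<^sub>v v) ` carrier_vec (length (sh (Suc i))) = mat_kernel (D i)"
      using Suc(2)[of i] cS[of i] by (simp add: mat_image_def sh_def)
    fix r c assume "r < length (sh i)" "c < length (sh (Suc i))"
    then have rc: "r < length (cs i)" "c < length (cs (Suc i))" by (simp_all add: sh_def)
    then have "mdeg (cs (Suc i) ! c) (cs i ! r) (D (Suc i) $$ (r, c))" using Suc(1)[of i] by (auto simp: mdeg_mat_def)
    from mdeg_imp_homogeneous[OF this] show "homogeneous (sh (Suc i) ! c - sh i ! r) (D (Suc i) $$ (r, c))"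
      using rc by (simp add: sh_def)
  qed
  \<comment> \<open>Column \<open>c\<close> of \<open>D (Suc i)\<close> is a multihomogeneous
    relation among the columns of \<open>D i\<close>. It is therefore the irredundancy of
    \<open>D i\<close>, one step earlier, that makes its constant terms vanish.\<close>
  moreover have "D (Suc i) $$ (r, c) \<in> Idl\<^bsub>poly_ring\<^esub> (range var)" if "r < length (sh i)" "c < length (sh (Suc i))" for i r c
  proof (rule Idl_var_if_const)
    have rc: "r < length (cs i)" "c < length (cs (Suc i))" using that by (simp_all add: sh_def)
    have "D (Suc i) *\<^sub>v unit_vec (length (cs (Suc i))) c \<in> mat_image (D (Suc i))"
      using cS[of i] by (auto simp: mat_image_def)
    then have "col (D (Suc i)) c \<in> mat_kernel (D i)" by (simp add: mult_mat_unit_vec[OF cS rc(2)] Suc(2))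
    moreover have "mdeg (cs (Suc i) ! c) (cs i ! r') (col (D (Suc i)) c $ r')" if "r' < length (cs i)" for r'
      using Suc(1)[of i] that rc cS[of i] by (auto simp: mdeg_mat_def)
    ultimately have "col (D (Suc i)) c \<in> mdeg_kernel (cs i) (D i) (cs (Suc i) ! c)" by (simp add: mdeg_kernel_def)
    then have "const (col (D (Suc i)) c $ r) = 0" using irr[of i] rc by (auto simp: irredundant_mat_def)
    then show "const (D (Suc i) $$ (r, c)) = 0" using rc cS[of i] by simp
  qed
  ultimately have "minimal_graded_free_resolution sh D ?I" by (simp add: minimal_graded_free_resolution_def)
  then show ?thesis by blast
qed

text \<open>The intersection is generated by the least common multiples of pairs of generators.
  Finiteness is the point: it gives the intersection of two monomial ideals a minimal resolution as
  well.\<close>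

lemma up_closure_inter:
  fixes E E' :: "('v::finite \<Rightarrow>\<^sub>0 nat) set"
  assumes "finite E" "finite E'"
  obtains E'' where "finite E''" "up_closure E \<inter> up_closure E' = up_closure E''"
proof
  let ?E = "(\<lambda>(e, e'). exp_lcm {e, e'}) ` (E \<times> E')"
  show "finite ?E" using assms by simp
  show "up_closure E \<inter> up_closure E' = up_closure ?E"
  proof (intro equalityI subsetI)
    fix m assume "m \<in> up_closure E \<inter> up_closure E'"
    then obtain e b e' b' where e: "e \<in> E" "m = e + b" "e' \<in> E'" "m = e' + b'" unfolding up_closure_def by blast
    then have "exp_lcm {e, e'} + (m - exp_lcm {e, e'}) = m" by (intro exp_lcm_least) auto
    moreover have "exp_lcm {e, e'} \<in> ?E" using e by auto
    ultimately show "m \<in> up_closure ?E" by (metis up_closureI)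
  next
    fix m assume "m \<in> up_closure ?E"
    then obtain e e' b where e: "e \<in> E" "e' \<in> E'" "m = exp_lcm {e, e'} + b" by (auto simp: up_closure_def)
    have "exp_lcm {e, e'} \<in> up_closure E" "exp_lcm {e, e'} \<in> up_closure E'"
      using exp_lcm_upper[of "{e, e'}" e] exp_lcm_upper[of "{e, e'}" e'] e
        up_closureI[OF e(1), of "exp_lcm {e, e'} - e"] up_closureI[OF e(2), of "exp_lcm {e, e'} - e'"] by simp_all
    then show "m \<in> up_closure E \<inter> up_closure E'" using e(3) by (auto intro: up_closure_add)
  qed
qed

section \<open>Mapping cones\<close>

lemma mult_mat_vec_add_smult:
  fixes A :: "'a::comm_ring_1 mat"
  assumes A: "A \<in> carrier_mat n m" and x: "x \<in> carrier_vec m" and y: "y \<in> carrier_vec m"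
  shows "A *\<^sub>v (x + k \<cdot>\<^sub>v y) = A *\<^sub>v x + k \<cdot>\<^sub>v (A *\<^sub>v y)"
proof (rule eq_vecI)
  fix i assume "i < dim_vec (A *\<^sub>v x + k \<cdot>\<^sub>v (A *\<^sub>v y))"
  then have i: "i < n" using A by simp
  have "(A *\<^sub>v (x + k \<cdot>\<^sub>v y)) $ i = (\<Sum>j<m. A $$ (i, j) * (x + k \<cdot>\<^sub>v y) $ j)"
    by (rule index_mult_mat_vec_sum[OF A _ i]) (use x y in simp)
  also have "\<dots> = (\<Sum>j<m. A $$ (i, j) * x $ j + k * (A $$ (i, j) * y $ j))"
    using x y by (intro sum.cong) (auto simp: distrib_left mult.left_commute)
  also have "\<dots> = (\<Sum>j<m. A $$ (i, j) * x $ j) + k * (\<Sum>j<m. A $$ (i, j) * y $ j)"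
    by (simp add: sum.distrib sum_distrib_left)
  finally have "(A *\<^sub>v (x + k \<cdot>\<^sub>v y)) $ i = (\<Sum>j<m. A $$ (i, j) * x $ j) + k * (\<Sum>j<m. A $$ (i, j) * y $ j)" .
  then show "(A *\<^sub>v (x + k \<cdot>\<^sub>v y)) $ i = (A *\<^sub>v x + k \<cdot>\<^sub>v (A *\<^sub>v y)) $ i"
    using i A by (simp add: index_mult_mat_vec_sum[OF A x i] index_mult_mat_vec_sum[OF A y i] del: index_mult_mat_vec)
qed (use A in auto)

lemma mult_mat_vec_smult:
  fixes A :: "'a::comm_ring_1 mat"
  assumes A: "A \<in> carrier_mat n m" and y: "y \<in> carrier_vec m"
  shows "A *\<^sub>v (k \<cdot>\<^sub>v y) = k \<cdot>\<^sub>v (A *\<^sub>v y)"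
proof (rule eq_vecI)
  fix i assume "i < dim_vec (k \<cdot>\<^sub>v (A *\<^sub>v y))"
  then have i: "i < n" using A by simp
  show "(A *\<^sub>v (k \<cdot>\<^sub>v y)) $ i = (k \<cdot>\<^sub>v (A *\<^sub>v y)) $ i"
    using i A y index_mult_mat_vec_sum[OF A y i]
    by (subst index_mult_mat_vec_sum[OF A _ i]) (auto simp: sum_distrib_left algebra_simps simp del: index_mult_mat_vec intro!: sum.cong)
qed (use A in auto)

lemma smult_mat_mult_vec:
  fixes A :: "'a::comm_ring_1 mat"
  assumes A: "A \<in> carrier_mat n m" and y: "y \<in> carrier_vec m"
  shows "(k \<cdot>\<^sub>m A) *\<^sub>v y = k \<cdot>\<^sub>v (A *\<^sub>v y)"
proof (rule eq_vecI)
  fix i assume "i < dim_vec (k \<cdot>\<^sub>v (A *\<^sub>v y))"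
  then have i: "i < n" using A by simp
  have kA: "k \<cdot>\<^sub>m A \<in> carrier_mat n m" using A by simp
  show "((k \<cdot>\<^sub>m A) *\<^sub>v y) $ i = (k \<cdot>\<^sub>v (A *\<^sub>v y)) $ i"
    using i A y index_mult_mat_vec_sum[OF A y i]
    by (subst index_mult_mat_vec_sum[OF kA y i]) (auto simp: sum_distrib_left algebra_simps simp del: index_mult_mat_vec intro!: sum.cong)
qed (use A in auto)

lemma vec_add_smult_eq_zero_iff:
  fixes f g :: "'a::comm_ring_1 vec"
  assumes "f \<in> carrier_vec n" "g \<in> carrier_vec n"
  shows "f + k \<cdot>\<^sub>v g = 0\<^sub>v n \<longleftrightarrow> f = (- k) \<cdot>\<^sub>v g"
proof -
  have "f + k \<cdot>\<^sub>v g = 0\<^sub>v n \<longleftrightarrow> (\<forall>i<n. f $ i + k * g $ i = 0)"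
    using assms by (auto simp: vec_eq_iff)
  also have "\<dots> \<longleftrightarrow> (\<forall>i<n. f $ i = - k * g $ i)" by (simp add: eq_neg_iff_add_eq_0)
  also have "\<dots> \<longleftrightarrow> f = (- k) \<cdot>\<^sub>v g" using assms by (auto simp: vec_eq_iff)
  finally show ?thesis .
qed

lemma vec_eq_add_smult_if:
  fixes f g :: "'a::comm_ring_1 vec"
  assumes "f \<in> carrier_vec n" "g \<in> carrier_vec n" "f + (- k) \<cdot>\<^sub>v g = f'"
  shows "f = f' + k \<cdot>\<^sub>v g"
  unfolding assms(3)[symmetric] using assms(1,2) by (intro eq_vecI) auto

lemma smult_add_smult_uminus:
  fixes e :: "'a::comm_ring_1 vec"
  assumes "e \<in> carrier_vec n"
  shows "w \<cdot>\<^sub>v e + w \<cdot>\<^sub>v ((-1) \<cdot>\<^sub>v e) = 0\<^sub>v n"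
  using assms by (intro eq_vecI) auto

lemma smult_smult_cancel:
  fixes e :: "'a::comm_ring_1 vec"
  assumes "e \<in> carrier_vec n"
  shows "v \<cdot>\<^sub>v (u \<cdot>\<^sub>v e) + u \<cdot>\<^sub>v ((- v) \<cdot>\<^sub>v e) = 0\<^sub>v n"
  using assms by (intro eq_vecI) (auto simp: algebra_simps)

lemma smult_zero_vec: "(k :: 'a::comm_ring_1) \<cdot>\<^sub>v 0\<^sub>v n = 0\<^sub>v n"
  by (intro eq_vecI) auto

lemma mult_mat_zero_vec:
  fixes A :: "'a::comm_ring_1 mat"
  assumes A: "A \<in> carrier_mat n m"
  shows "A *\<^sub>v 0\<^sub>v m = 0\<^sub>v n"
proof (rule eq_vecI)
  fix i assume "i < dim_vec (0\<^sub>v n :: 'a vec)"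
  then show "(A *\<^sub>v 0\<^sub>v m) $ i = 0\<^sub>v n $ i" by (subst index_mult_mat_vec_sum[OF A]) auto
qed (use A in auto)

lemma zero_mat_mult_vec:
  fixes e :: "'a::comm_ring_1 vec"
  assumes "e \<in> carrier_vec m"
  shows "0\<^sub>m n m *\<^sub>v e = 0\<^sub>v n"
  using assms by (intro eq_vecI) auto

lemma vec_split3:
  assumes "x \<in> carrier_vec (a + b + c)"
  obtains f g h where "f \<in> carrier_vec a" "g \<in> carrier_vec b" "h \<in> carrier_vec c" "x = (f @\<^sub>v g) @\<^sub>v h"
proof -
  let ?y = "vec_first x (a + b)"
  have "x = (vec_first ?y a @\<^sub>v vec_last ?y b) @\<^sub>v vec_last x c"
    using assms by (simp add: vec_first_last_append[where n = a and m = b])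
  then show ?thesis using that[of "vec_first ?y a" "vec_last ?y b" "vec_last x c"] by simp
qed

lemma zero_vec_append: "0\<^sub>v (n + m) = (0\<^sub>v n :: 'a::zero vec) @\<^sub>v 0\<^sub>v m"
  by (rule eq_vecI) auto

text \<open>Both free modules are twisted by \<open>k\<close>, and multiplication by a form of
  degree \<open>e\<close> raises the source degrees by a further \<open>e\<close>. The cone uses
  \<open>e = 1\<close> for the entries multiplied by \<open>u\<close> or \<open>v\<close> and
  \<open>e = 0\<close> for the differentials.\<close>

lemma homogeneous_mat_shift:
  assumes "homogeneous_mat rs cs A" "homogeneous e u"
  shows "homogeneous_mat (map ((+) k) rs) (map ((+) (k + e)) cs) (u \<cdot>\<^sub>m A)"
  unfolding homogeneous_mat_def
proof (intro conjI allI impI)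
  note A = homogeneous_mat_carrier[OF assms(1)]
  show "u \<cdot>\<^sub>m A \<in> carrier_mat (length (map ((+) k) rs)) (length (map ((+) (k + e)) cs))" using A by simp
  fix r c assume "r < length (map ((+) k) rs)" "c < length (map ((+) (k + e)) cs)"
  then have rc: "r < length rs" "c < length cs" by simp_all
  then have "homogeneous (e + (cs ! c - rs ! r)) (u * A $$ (r, c))"
    using assms by (intro homogeneous_times) (auto simp: homogeneous_mat_def)
  moreover have "map ((+) (k + e)) cs ! c - map ((+) k) rs ! r = e + (cs ! c - rs ! r)" using rc by simp
  ultimately show "homogeneous (map ((+) (k + e)) cs ! c - map ((+) k) rs ! r) ((u \<cdot>\<^sub>m A) $$ (r, c))"
    using rc A by simp
qed

lemma homogeneous_one: "homogeneous 0 (1 :: ('v, 'k::field) mpoly)"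
  by (auto simp: homogeneous_def)

lemma homogeneous_mat_zero: "homogeneous_mat rs cs (0\<^sub>m (length rs) (length cs))"
  by (simp add: homogeneous_mat_def)

lemma homogeneous_mat_four_block:
  assumes "homogeneous_mat r1 c1 A" "homogeneous_mat r1 c2 B" "homogeneous_mat r2 c1 C" "homogeneous_mat r2 c2 D"
  shows "homogeneous_mat (r1 @ r2) (c1 @ c2) (four_block_mat A B C D)"
  unfolding homogeneous_mat_def
proof (intro conjI allI impI)
  note c = assms[THEN homogeneous_mat_carrier]
  show "four_block_mat A B C D \<in> carrier_mat (length (r1 @ r2)) (length (c1 @ c2))" using c by simp
  fix r c assume "r < length (r1 @ r2)" "c < length (c1 @ c2)"
  then show "homogeneous ((c1 @ c2) ! c - (r1 @ r2) ! r) (four_block_mat A B C D $$ (r, c))"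
    using assms c by (auto simp: homogeneous_mat_def nth_append)
qed

lemma homogeneous_mat_append_rows:
  assumes "homogeneous_mat r1 cs A" "homogeneous_mat r2 cs B"
  shows "homogeneous_mat (r1 @ r2) cs (A @\<^sub>r B)"
proof -
  note c = assms[THEN homogeneous_mat_carrier]
  have "homogeneous_mat (r1 @ r2) (cs @ []) (A @\<^sub>r B)"
    unfolding append_rows_def using c assms homogeneous_mat_zero[of r1 "[]"] homogeneous_mat_zero[of r2 "[]"]
    by (intro homogeneous_mat_four_block) auto
  then show ?thesis by simp
qed

text \<open>The entry condition of minimality, in a form that passes through block matrices.\<close>

definition const_free :: "('v, 'k::field) mpoly mat \<Rightarrow> bool" where
  "const_free A \<longleftrightarrow> (\<forall>r<dim_row A. \<forall>c<dim_col A. const (A $$ (r, c)) = 0)"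

lemma const_free_zero [simp]: "const_free (0\<^sub>m n m)"
  by (simp add: const_free_def)

lemma const_free_smult: "const u = 0 \<or> const_free A \<Longrightarrow> const_free (u \<cdot>\<^sub>m A)"
  by (auto simp: const_free_def)

lemma const_free_four_block:
  assumes "A \<in> carrier_mat n1 m1" "B \<in> carrier_mat n1 m2" "C \<in> carrier_mat n2 m1" "D \<in> carrier_mat n2 m2"
    and "const_free A" "const_free B" "const_free C" "const_free D"
  shows "const_free (four_block_mat A B C D)"
  using assms by (auto simp: const_free_def)

lemma const_free_append_rows:
  assumes "A \<in> carrier_mat n1 m" "B \<in> carrier_mat n2 m" "const_free A" "const_free B"
  shows "const_free (A @\<^sub>r B)"
  unfolding append_rows_def using assms by (intro const_free_four_block[of _ n1 m _ 0 _ n2]) auto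

lemma const_free_minimal:
  assumes "minimal_graded_free_resolution sh d I"
  shows "const_free (d (Suc i))"
  using assms resolution_carrier[of sh d I "Suc i"]
  by (auto simp: minimal_graded_free_resolution_def const_free_def intro: const_Idl_var)

text \<open>The target resolution comes first, the source second: \<phi> covers the inclusion of the
  ideal resolved by \<open>d'\<close> into the ideal resolved by \<open>d\<close>.\<close>

definition chain_lift ::
  "(nat \<Rightarrow> int list) \<Rightarrow> (nat \<Rightarrow> ('v, 'k::field) mpoly mat) \<Rightarrow> (nat \<Rightarrow> int list) \<Rightarrow> (nat \<Rightarrow> ('v, 'k) mpoly mat)
    \<Rightarrow> (nat \<Rightarrow> ('v, 'k) mpoly mat) \<Rightarrow> bool" where
  "chain_lift sh d sh' d' \<phi> \<longleftrightarrow> (\<forall>i. homogeneous_mat (sh i) (sh' i) (\<phi> i)) \<and> d 0 * \<phi> 0 = d' 0 \<and>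
     (\<forall>i. d (Suc i) * \<phi> (Suc i) = \<phi> i * d' (Suc i))"

lemma exists_chain_lift:
  assumes d': "graded_free_resolution sh' d' I'" and d: "graded_free_resolution sh d I" and sub: "I' \<subseteq> I"
  shows "\<exists>\<phi>. chain_lift sh d sh' d' \<phi>"
proof -
  \<comment> \<open>The vanishing of \<open>d i * (\<phi> * d' (Suc i))\<close> is carried along
    because it permits the next lift; the commuting squares are recorded in
    \<open>?Q\<close>.\<close>
  let ?P = "\<lambda>i \<phi>. homogeneous_mat (sh i) (sh' i) \<phi> \<and>
     d i * (\<phi> * d' (Suc i)) = 0\<^sub>m (dim_row (d i)) (length (sh' (Suc i))) \<and> (i = 0 \<longrightarrow> d 0 * \<phi> = d' 0)"
  let ?Q = "\<lambda>i \<phi> \<phi>'. d (Suc i) * \<phi>' = \<phi> * d' (Suc i)"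
  have "\<exists>f. \<forall>i. ?P i (f i) \<and> ?Q i (f i) (f (Suc i))"
  proof (rule dependent_nat_choice)
    obtain \<phi> where phi: "homogeneous_mat (sh 0) (sh' 0) \<phi>" "d 0 * \<phi> = d' 0"
      using resolution_lift_aug[OF d' d sub] by blast
    have "d 0 * (\<phi> * d' (Suc 0)) = d 0 * \<phi> * d' (Suc 0)"
      using phi resolution_carrier[OF d, of 0] resolution_carrier[OF d', of "Suc 0"]
      by (subst assoc_mult_mat) (auto dest!: homogeneous_mat_carrier)
    then show "\<exists>\<phi>. ?P 0 \<phi>" using phi resolution_differential_squared[OF d', of 0]
      resolution_carrier[OF d, of 0] resolution_carrier[OF d', of 0] by (intro exI[of _ \<phi>]) simp
  next
    fix \<phi> i assume phi: "?P i \<phi>"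
    obtain \<phi>' where phi': "homogeneous_mat (sh (Suc i)) (sh' (Suc i)) \<phi>'" "d (Suc i) * \<phi>' = \<phi> * d' (Suc i)"
      using resolution_lift[OF d' d, of i \<phi>] phi by blast
    have c: "d (Suc i) \<in> carrier_mat (length (sh i)) (length (sh (Suc i)))"
      "\<phi>' \<in> carrier_mat (length (sh (Suc i))) (length (sh' (Suc i)))" "d' (Suc (Suc i)) \<in> carrier_mat (length (sh' (Suc i))) (length (sh' (Suc (Suc i))))"
      "\<phi> \<in> carrier_mat (length (sh i)) (length (sh' i))" "d' (Suc i) \<in> carrier_mat (length (sh' i)) (length (sh' (Suc i)))"
      using phi phi' resolution_carrier[OF d', of "Suc i"] resolution_carrier[OF d', of "Suc (Suc i)"] resolution_carrier[OF d, of "Suc i"]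
      by (auto dest!: homogeneous_mat_carrier)
    have "d (Suc i) * (\<phi>' * d' (Suc (Suc i))) = \<phi> * d' (Suc i) * d' (Suc (Suc i))"
      unfolding phi'(2)[symmetric] by (rule assoc_mult_mat[symmetric, OF c(1-3)])
    also have "\<dots> = \<phi> * (d' (Suc i) * d' (Suc (Suc i)))" by (rule assoc_mult_mat[OF c(4,5,3)])
    finally show "\<exists>\<phi>'. ?P (Suc i) \<phi>' \<and> ?Q i \<phi> \<phi>'"
      using c phi' resolution_differential_squared[OF d', of "Suc i"] by (intro exI[of _ \<phi>']) simp
  qed
  then show ?thesis unfolding chain_lift_def by blast
qed

text \<open>One component of a mapping cone, with source \<open>d'\<close> and target
  \<open>d\<close>. The scalar \<open>w\<close> in the lemmas below is the factor multiplying the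
  chain map, later \<open>u\<close> or \<open>- v\<close>.\<close>

locale lifted_resolution =
  fixes sh d and I :: "('v, 'k::field) mpoly set" and sh' d' I' \<phi>
  assumes res: "graded_free_resolution sh d I" and res': "graded_free_resolution sh' d' I'"
    and lift: "chain_lift sh d sh' d' \<phi>"
begin

lemma carriers:
  "d 0 \<in> carrier_mat 1 (length (sh 0))" "d (Suc i) \<in> carrier_mat (length (sh i)) (length (sh (Suc i)))"
  "d' 0 \<in> carrier_mat 1 (length (sh' 0))" "d' (Suc i) \<in> carrier_mat (length (sh' i)) (length (sh' (Suc i)))"
  "\<phi> i \<in> carrier_mat (length (sh i)) (length (sh' i))"
  using resolution_carrier[OF res, of 0] resolution_carrier[OF res, of "Suc i"]
    resolution_carrier[OF res', of 0] resolution_carrier[OF res', of "Suc i"] lift homogeneous_mat_carrier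
  by (auto simp: chain_lift_def)

lemma lift_aug:
  assumes "h \<in> carrier_vec (length (sh' 0))"
  shows "d 0 *\<^sub>v (\<phi> 0 *\<^sub>v h) = d' 0 *\<^sub>v h"
  using lift assoc_mult_mat_vec[OF carriers(1,5) assms] by (simp add: chain_lift_def)

lemma lift_Suc:
  assumes "h \<in> carrier_vec (length (sh' (Suc i)))"
  shows "d (Suc i) *\<^sub>v (\<phi> (Suc i) *\<^sub>v h) = \<phi> i *\<^sub>v (d' (Suc i) *\<^sub>v h)"
  using lift assoc_mult_mat_vec[OF carriers(2,5) assms] assoc_mult_mat_vec[OF carriers(5,4) assms]
  by (simp add: chain_lift_def)

lemma exactD:
  assumes "f \<in> carrier_vec (length (sh i))" "d i *\<^sub>v f = 0\<^sub>v (dim_row (d i))"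
  obtains f' where "f' \<in> carrier_vec (length (sh (Suc i)))" "f = d (Suc i) *\<^sub>v f'"
proof -
  have "dim_col (d i) = length (sh i)" using resolution_carrier[OF res, of i] by auto
  then have "f \<in> mat_image (d (Suc i))"
    unfolding resolution_exact[OF res] mat_kernel_def using assms by simp
  then show ?thesis using that carriers(2)[of i] by (auto simp: mat_image_def)
qed

lemma squared:
  assumes "f \<in> carrier_vec (length (sh (Suc i)))"
  shows "d i *\<^sub>v (d (Suc i) *\<^sub>v f) = 0\<^sub>v (dim_row (d i))"
proof -
  have "d (Suc i) *\<^sub>v f \<in> mat_image (d (Suc i))" using assms carriers(2)[of i] by (auto simp: mat_image_def)
  then show ?thesis unfolding resolution_exact[OF res] by (simp add: mat_kernel_def)
qed

lemma aug_of_image: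
  assumes f: "f \<in> carrier_vec (length (sh (Suc 0)))" and h: "h \<in> carrier_vec (length (sh' 0))"
  shows "d 0 *\<^sub>v (d (Suc 0) *\<^sub>v f + w \<cdot>\<^sub>v (\<phi> 0 *\<^sub>v h)) = w \<cdot>\<^sub>v (d' 0 *\<^sub>v h)"
proof -
  have d: "d' 0 *\<^sub>v h \<in> carrier_vec 1" using carriers(3) by (intro carrier_vecI) auto
  have "d 0 *\<^sub>v (d (Suc 0) *\<^sub>v f + w \<cdot>\<^sub>v (\<phi> 0 *\<^sub>v h)) = d 0 *\<^sub>v (d (Suc 0) *\<^sub>v f) + w \<cdot>\<^sub>v (d 0 *\<^sub>v (\<phi> 0 *\<^sub>v h))"
    by (rule mult_mat_vec_add_smult[OF carriers(1)]) (use f h carriers(2,5)[of 0] in auto)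
  then show ?thesis using squared[OF f] carriers(1) d by (simp add: lift_aug[OF h])
qed

text \<open>The augmentation kills \<open>f - w \<phi> h\<close>, since \<phi> respects
  augmentations; exactness then supplies \<open>f'\<close>.\<close>

lemma aug_exact:
  assumes f: "f \<in> carrier_vec (length (sh 0))" and h: "h \<in> carrier_vec (length (sh' 0))"
    and eq: "d 0 *\<^sub>v f = w \<cdot>\<^sub>v (d' 0 *\<^sub>v h)"
  obtains f' where "f' \<in> carrier_vec (length (sh (Suc 0)))" "f = d (Suc 0) *\<^sub>v f' + w \<cdot>\<^sub>v (\<phi> 0 *\<^sub>v h)"
proof -
  have c: "\<phi> 0 *\<^sub>v h \<in> carrier_vec (length (sh 0))" using carriers(5)[of 0] h by auto
  have d: "d' 0 *\<^sub>v h \<in> carrier_vec 1" using carriers(3) by (intro carrier_vecI) auto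
  have "d 0 *\<^sub>v (f + (- w) \<cdot>\<^sub>v (\<phi> 0 *\<^sub>v h)) = d 0 *\<^sub>v f + (- w) \<cdot>\<^sub>v (d' 0 *\<^sub>v h)"
    by (simp add: mult_mat_vec_add_smult[OF carriers(1) f c] lift_aug[OF h])
  also have "\<dots> = 0\<^sub>v 1"
    by (subst vec_add_smult_eq_zero_iff[of _ 1]) (use eq d in auto)
  finally obtain f' where "f' \<in> carrier_vec (length (sh (Suc 0)))" "f + (- w) \<cdot>\<^sub>v (\<phi> 0 *\<^sub>v h) = d (Suc 0) *\<^sub>v f'"
    using exactD[of "f + (- w) \<cdot>\<^sub>v (\<phi> 0 *\<^sub>v h)" 0] f c carriers(1) by auto
  then show ?thesis using that vec_eq_add_smult_if[OF f c] by blast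
qed

text \<open>The sign on \<open>d'\<close> makes the two copies of \<open>w \<phi> d' h\<close>
  cancel; the other term vanishes because \<open>d\<close> squares to zero.\<close>

lemma cone_squared:
  assumes f: "f \<in> carrier_vec (length (sh (Suc (Suc i))))" and h: "h \<in> carrier_vec (length (sh' (Suc i)))"
  shows "d (Suc i) *\<^sub>v (d (Suc (Suc i)) *\<^sub>v f + w \<cdot>\<^sub>v (\<phi> (Suc i) *\<^sub>v h)) +
    w \<cdot>\<^sub>v (\<phi> i *\<^sub>v ((-1) \<cdot>\<^sub>v (d' (Suc i) *\<^sub>v h))) = 0\<^sub>v (length (sh i))"
proof -
  have c: "d' (Suc i) *\<^sub>v h \<in> carrier_vec (length (sh' i))" using carriers(4)[of i] h by auto
  have e: "\<phi> i *\<^sub>v (d' (Suc i) *\<^sub>v h) \<in> carrier_vec (length (sh i))" using carriers(5)[of i] c by auto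
  have "d (Suc i) *\<^sub>v (d (Suc (Suc i)) *\<^sub>v f + w \<cdot>\<^sub>v (\<phi> (Suc i) *\<^sub>v h)) =
      d (Suc i) *\<^sub>v (d (Suc (Suc i)) *\<^sub>v f) + w \<cdot>\<^sub>v (d (Suc i) *\<^sub>v (\<phi> (Suc i) *\<^sub>v h))"
    by (rule mult_mat_vec_add_smult[OF carriers(2)]) (use f h carriers(2)[of "Suc i"] carriers(5)[of "Suc i"] in auto)
  also have "\<dots> = w \<cdot>\<^sub>v (\<phi> i *\<^sub>v (d' (Suc i) *\<^sub>v h))"
    using squared[OF f] carriers(2)[of i] e by (simp add: lift_Suc[OF h])
  finally show ?thesis
    unfolding mult_mat_vec_smult[OF carriers(5) c] by (simp only: smult_add_smult_uminus[OF e])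
qed

text \<open>By the commuting square, the equation says that \<open>f - w \<phi> h\<close> is a
  cycle; exactness of \<open>d\<close> makes it a boundary.\<close>

lemma cone_exact:
  assumes f: "f \<in> carrier_vec (length (sh (Suc i)))" and h: "h \<in> carrier_vec (length (sh' (Suc i)))"
    and eq: "d (Suc i) *\<^sub>v f + w \<cdot>\<^sub>v (\<phi> i *\<^sub>v ((-1) \<cdot>\<^sub>v (d' (Suc i) *\<^sub>v h))) = 0\<^sub>v (length (sh i))"
  obtains f' where "f' \<in> carrier_vec (length (sh (Suc (Suc i))))"
    "f = d (Suc (Suc i)) *\<^sub>v f' + w \<cdot>\<^sub>v (\<phi> (Suc i) *\<^sub>v h)"
proof -
  have c: "\<phi> (Suc i) *\<^sub>v h \<in> carrier_vec (length (sh (Suc i)))" using carriers(5)[of "Suc i"] h by auto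
  have c': "d' (Suc i) *\<^sub>v h \<in> carrier_vec (length (sh' i))" using carriers(4)[of i] h by auto
  have e: "\<phi> i *\<^sub>v (d' (Suc i) *\<^sub>v h) \<in> carrier_vec (length (sh i))" using carriers(5)[of i] c' by auto
  have "d (Suc i) *\<^sub>v (f + (- w) \<cdot>\<^sub>v (\<phi> (Suc i) *\<^sub>v h)) = d (Suc i) *\<^sub>v f + (- w) \<cdot>\<^sub>v (\<phi> i *\<^sub>v (d' (Suc i) *\<^sub>v h))"
    by (simp add: mult_mat_vec_add_smult[OF carriers(2) f c] lift_Suc[OF h])
  also have "\<dots> = d (Suc i) *\<^sub>v f + w \<cdot>\<^sub>v (\<phi> i *\<^sub>v ((-1) \<cdot>\<^sub>v (d' (Suc i) *\<^sub>v h)))"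
    unfolding mult_mat_vec_smult[OF carriers(5) c'] using e by (simp add: smult_smult_assoc)
  finally obtain f' where "f' \<in> carrier_vec (length (sh (Suc (Suc i))))"
      "f + (- w) \<cdot>\<^sub>v (\<phi> (Suc i) *\<^sub>v h) = d (Suc (Suc i)) *\<^sub>v f'"
    using exactD[of "f + (- w) \<cdot>\<^sub>v (\<phi> (Suc i) *\<^sub>v h)" "Suc i"] f c carriers(2)[of i] eq by auto
  then show ?thesis using that vec_eq_add_smult_if[OF f c] by blast
qed

end

text \<open>The cone of the chain map \<open>(u \<phi>, - v \<psi>)\<close> from a resolution of \<open>P \<inter> Q\<close> to the direct sum of
  resolutions of \<open>P\<close> and \<open>Q\<close> resolves \<open>v P + u Q\<close>, because \<open>v P \<inter> u Q = u v (P \<inter> Q)\<close>. It is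
  minimal whatever the lifts \<open>\<phi>\<close> and \<open>\<psi>\<close> are, because of the factors \<open>u\<close> and \<open>v\<close>.\<close>

locale splitting_cone =
  F: lifted_resolution shF F P shH H R \<phi> + G: lifted_resolution shG G Q shH H R \<psi>
  for shF F and P :: "('v, 'k::field) mpoly set" and shG G Q shH H R \<phi> \<psi> +
  fixes u v :: "('v, 'k) mpoly" and I :: "('v, 'k) mpoly set"
  assumes homu: "homogeneous 1 u" and homv: "homogeneous 1 v"
    and cancelu: "\<And>f. u * f = 0 \<Longrightarrow> f = 0"
    and syzygy: "\<And>p q. p \<in> P \<Longrightarrow> q \<in> Q \<Longrightarrow> v * p + u * q = 0 \<Longrightarrow> \<exists>r\<in>R. p = u * r \<and> q = - v * r"
    and I: "I = {v * p + u * q | p q. p \<in> P \<and> q \<in> Q}"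
    and minF: "minimal_graded_free_resolution shF F P" and minG: "minimal_graded_free_resolution shG G Q"
    and minH: "minimal_graded_free_resolution shH H R"
begin

abbreviation "nF i \<equiv> length (shF i)"
abbreviation "nG i \<equiv> length (shG i)"
abbreviation "nH i \<equiv> length (shH i)"

text \<open>The cone places \<open>H\<close> one homological degree higher, with nothing in degree
  0.\<close>

fun prevH :: "nat \<Rightarrow> int list" where
  "prevH 0 = []" | "prevH (Suc i) = shH i"

text \<open>The shifts by 1 come from the factors \<open>v\<close> and \<open>u\<close> of the two
  summands, the shift by 2 from the factor \<open>u * v\<close> of their intersection.\<close>

definition sh :: "nat \<Rightarrow> int list" where
  "sh i = (map ((+) 1) (shF i) @ map ((+) 1) (shG i)) @ map ((+) 2) (prevH i)"

text \<open>At \<open>0\<close> this is a matrix without rows, so that \<open>D (Suc 0)\<close> has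
  the same block shape as the later differentials.\<close>

fun dH :: "nat \<Rightarrow> ('v, 'k) mpoly mat" where
  "dH 0 = 0\<^sub>m 0 (nH 0)" | "dH (Suc i) = (-1) \<cdot>\<^sub>m H (Suc i)"

definition dFG :: "nat \<Rightarrow> ('v, 'k) mpoly mat" where
  "dFG i = four_block_mat (F (Suc i)) (0\<^sub>m (nF i) (nG (Suc i))) (0\<^sub>m (nG i) (nF (Suc i))) (G (Suc i))"

text \<open>The opposite signs make the composite with the augmentation equal to
  \<open>v u H 0 - u v H 0 = 0\<close>.\<close>

definition \<chi> :: "nat \<Rightarrow> ('v, 'k) mpoly mat" where
  "\<chi> i = (u \<cdot>\<^sub>m \<phi> i) @\<^sub>r ((- v) \<cdot>\<^sub>m \<psi> i)"

text \<open>The lower blocks of \<open>D 0\<close> have no rows; they place the two one-row matrices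
  side by side while the block lemmas still apply.\<close>

fun D :: "nat \<Rightarrow> ('v, 'k) mpoly mat" where
  "D 0 = four_block_mat (v \<cdot>\<^sub>m F 0) (u \<cdot>\<^sub>m G 0) (0\<^sub>m 0 (nF 0)) (0\<^sub>m 0 (nG 0))"
| "D (Suc i) = four_block_mat (dFG i) (\<chi> i) (0\<^sub>m (length (prevH i)) (nF (Suc i) + nG (Suc i))) (dH i)"

section \<open>Action, kernel and image of the block matrices; exactness of the cone\<close>

lemma dH_carrier: "dH i \<in> carrier_mat (length (prevH i)) (nH i)"
  using F.carriers(4) by (cases i) auto

lemma dFG_carrier: "dFG i \<in> carrier_mat (nF i + nG i) (nF (Suc i) + nG (Suc i))"
  unfolding dFG_def using F.carriers(2) G.carriers(2) by (intro four_block_carrier_mat) auto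

lemma chi_carrier: "\<chi> i \<in> carrier_mat (nF i + nG i) (nH i)"
  unfolding \<chi>_def using F.carriers(5) G.carriers(5) by (intro carrier_append_rows) auto

lemma D_Suc_carrier: "D (Suc i) \<in> carrier_mat (nF i + nG i + length (prevH i)) (nF (Suc i) + nG (Suc i) + nH i)"
  using dFG_carrier[of i] dH_carrier[of i] by simp

lemma D_0_carrier: "D 0 \<in> carrier_mat 1 (nF 0 + nG 0)"
proof -
  have "D 0 \<in> carrier_mat (1 + 0) (nF 0 + nG 0)"
    unfolding D.simps using F.carriers(1) G.carriers(1) by (intro four_block_carrier_mat) auto
  then show ?thesis by simp
qed

lemma D_Suc_mult:
  assumes f: "f \<in> carrier_vec (nF (Suc i))" and g: "g \<in> carrier_vec (nG (Suc i))" and h: "h \<in> carrier_vec (nH i)"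
  shows "D (Suc i) *\<^sub>v ((f @\<^sub>v g) @\<^sub>v h) = ((F (Suc i) *\<^sub>v f + u \<cdot>\<^sub>v (\<phi> i *\<^sub>v h)) @\<^sub>v
    (G (Suc i) *\<^sub>v g + (- v) \<cdot>\<^sub>v (\<psi> i *\<^sub>v h))) @\<^sub>v (dH i *\<^sub>v h)"
proof -
  have fg: "f @\<^sub>v g \<in> carrier_vec (nF (Suc i) + nG (Suc i))" using f g by simp
  have c: "F (Suc i) *\<^sub>v f \<in> carrier_vec (nF i)" "G (Suc i) *\<^sub>v g \<in> carrier_vec (nG i)"
    "\<phi> i *\<^sub>v h \<in> carrier_vec (nF i)" "\<psi> i *\<^sub>v h \<in> carrier_vec (nG i)" "dH i *\<^sub>v h \<in> carrier_vec (length (prevH i))"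
    using F.carriers(2,5)[of i] G.carriers(2,5)[of i] dH_carrier[of i] f g h by auto
  have 1: "dFG i *\<^sub>v (f @\<^sub>v g) = (F (Suc i) *\<^sub>v f) @\<^sub>v (G (Suc i) *\<^sub>v g)"
    unfolding dFG_def using c f g
    by (subst four_block_mat_mult_vec[OF F.carriers(2) zero_carrier_mat zero_carrier_mat G.carriers(2) f g])
      (simp add: zero_mat_mult_vec)
  have 2: "\<chi> i *\<^sub>v h = (u \<cdot>\<^sub>v (\<phi> i *\<^sub>v h)) @\<^sub>v ((- v) \<cdot>\<^sub>v (\<psi> i *\<^sub>v h))"
    unfolding \<chi>_def using F.carriers(5)[of i] G.carriers(5)[of i] h
    by (subst mat_mult_append[of _ "nF i" "nH i" _ "nG i"])
      (auto simp: smult_mat_mult_vec[OF F.carriers(5) h] smult_mat_mult_vec[OF G.carriers(5) h])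
  show ?thesis
    unfolding D.simps
    by (subst four_block_mat_mult_vec[OF dFG_carrier chi_carrier zero_carrier_mat dH_carrier fg h])
      (use c fg in \<open>simp add: 1 2 zero_mat_mult_vec append_vec_add[of _ "nF i" _ _ "nG i"]\<close>)
qed

lemma D_0_mult:
  assumes f: "f \<in> carrier_vec (nF 0)" and g: "g \<in> carrier_vec (nG 0)"
  shows "D 0 *\<^sub>v (f @\<^sub>v g) = v \<cdot>\<^sub>v (F 0 *\<^sub>v f) + u \<cdot>\<^sub>v (G 0 *\<^sub>v g)"
proof -
  have c: "v \<cdot>\<^sub>m F 0 \<in> carrier_mat 1 (nF 0)" "u \<cdot>\<^sub>m G 0 \<in> carrier_mat 1 (nG 0)"
    using F.carriers(1) G.carriers(1) by auto
  have "D 0 *\<^sub>v (f @\<^sub>v g) = ((v \<cdot>\<^sub>m F 0) *\<^sub>v f + (u \<cdot>\<^sub>m G 0) *\<^sub>v g) @\<^sub>v (0\<^sub>m 0 (nF 0) *\<^sub>v f + 0\<^sub>m 0 (nG 0) *\<^sub>v g)"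
    unfolding D.simps by (rule four_block_mat_mult_vec[OF c zero_carrier_mat zero_carrier_mat f g])
  also have "\<dots> = (v \<cdot>\<^sub>m F 0) *\<^sub>v f + (u \<cdot>\<^sub>m G 0) *\<^sub>v g"
    by (rule eq_vecI) auto
  finally show ?thesis by (simp add: smult_mat_mult_vec[OF F.carriers(1) f] smult_mat_mult_vec[OF G.carriers(1) g])
qed

lemma D_Suc_kernel:
  assumes "f \<in> carrier_vec (nF (Suc i))" "g \<in> carrier_vec (nG (Suc i))" "h \<in> carrier_vec (nH i)"
  shows "(f @\<^sub>v g) @\<^sub>v h \<in> mat_kernel (D (Suc i)) \<longleftrightarrow>
    F (Suc i) *\<^sub>v f + u \<cdot>\<^sub>v (\<phi> i *\<^sub>v h) = 0\<^sub>v (nF i) \<and> G (Suc i) *\<^sub>v g + (- v) \<cdot>\<^sub>v (\<psi> i *\<^sub>v h) = 0\<^sub>v (nG i) \<and>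
    dH i *\<^sub>v h = 0\<^sub>v (length (prevH i))"
proof -
  have c: "F (Suc i) *\<^sub>v f + u \<cdot>\<^sub>v (\<phi> i *\<^sub>v h) \<in> carrier_vec (nF i)"
    "G (Suc i) *\<^sub>v g + (- v) \<cdot>\<^sub>v (\<psi> i *\<^sub>v h) \<in> carrier_vec (nG i)"
    using F.carriers(2,5)[of i] G.carriers(2,5)[of i] assms by auto
  have x: "(f @\<^sub>v g) @\<^sub>v h \<in> carrier_vec (nF (Suc i) + nG (Suc i) + nH i)" using assms by simp
  have "(f @\<^sub>v g) @\<^sub>v h \<in> mat_kernel (D (Suc i)) \<longleftrightarrow>
      D (Suc i) *\<^sub>v ((f @\<^sub>v g) @\<^sub>v h) = (0\<^sub>v (nF i) @\<^sub>v 0\<^sub>v (nG i)) @\<^sub>v 0\<^sub>v (length (prevH i))"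
    unfolding mat_kernel[OF D_Suc_carrier] using x by (simp add: zero_vec_append del: D.simps)
  also have "\<dots> \<longleftrightarrow> F (Suc i) *\<^sub>v f + u \<cdot>\<^sub>v (\<phi> i *\<^sub>v h) = 0\<^sub>v (nF i) \<and>
      G (Suc i) *\<^sub>v g + (- v) \<cdot>\<^sub>v (\<psi> i *\<^sub>v h) = 0\<^sub>v (nG i) \<and> dH i *\<^sub>v h = 0\<^sub>v (length (prevH i))"
    unfolding D_Suc_mult[OF assms]
    by (subst append_vec_eq[of _ "nF i + nG i"], use c in simp, simp, subst append_vec_eq[of _ "nF i"], use c in simp, simp, simp only: conj_assoc)
  finally show ?thesis .
qed

lemma D_Suc_image:
  "mat_image (D (Suc i)) = {(((F (Suc i) *\<^sub>v f + u \<cdot>\<^sub>v (\<phi> i *\<^sub>v h)) @\<^sub>v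
    (G (Suc i) *\<^sub>v g + (- v) \<cdot>\<^sub>v (\<psi> i *\<^sub>v h))) @\<^sub>v (dH i *\<^sub>v h)) | f g h.
    f \<in> carrier_vec (nF (Suc i)) \<and> g \<in> carrier_vec (nG (Suc i)) \<and> h \<in> carrier_vec (nH i)}"
proof (intro equalityI subsetI)
  fix y assume "y \<in> mat_image (D (Suc i))"
  then obtain x where x: "x \<in> carrier_vec (nF (Suc i) + nG (Suc i) + nH i)" "y = D (Suc i) *\<^sub>v x"
    unfolding mat_image_def carrier_matD(2)[OF D_Suc_carrier] by blast
  from x(1) obtain f g h where fgh: "f \<in> carrier_vec (nF (Suc i))" "g \<in> carrier_vec (nG (Suc i))" "h \<in> carrier_vec (nH i)"
    and xe: "x = (f @\<^sub>v g) @\<^sub>v h" by (rule vec_split3)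
  have "y = ((F (Suc i) *\<^sub>v f + u \<cdot>\<^sub>v (\<phi> i *\<^sub>v h)) @\<^sub>v (G (Suc i) *\<^sub>v g + (- v) \<cdot>\<^sub>v (\<psi> i *\<^sub>v h))) @\<^sub>v (dH i *\<^sub>v h)"
    unfolding x(2) xe by (rule D_Suc_mult[OF fgh])
  then show "y \<in> {(((F (Suc i) *\<^sub>v f + u \<cdot>\<^sub>v (\<phi> i *\<^sub>v h)) @\<^sub>v
    (G (Suc i) *\<^sub>v g + (- v) \<cdot>\<^sub>v (\<psi> i *\<^sub>v h))) @\<^sub>v (dH i *\<^sub>v h)) | f g h.
    f \<in> carrier_vec (nF (Suc i)) \<and> g \<in> carrier_vec (nG (Suc i)) \<and> h \<in> carrier_vec (nH i)}" using fgh by blast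
next
  fix y assume "y \<in> {(((F (Suc i) *\<^sub>v f + u \<cdot>\<^sub>v (\<phi> i *\<^sub>v h)) @\<^sub>v
    (G (Suc i) *\<^sub>v g + (- v) \<cdot>\<^sub>v (\<psi> i *\<^sub>v h))) @\<^sub>v (dH i *\<^sub>v h)) | f g h.
    f \<in> carrier_vec (nF (Suc i)) \<and> g \<in> carrier_vec (nG (Suc i)) \<and> h \<in> carrier_vec (nH i)}"
  then obtain f g h where fgh: "f \<in> carrier_vec (nF (Suc i))" "g \<in> carrier_vec (nG (Suc i))" "h \<in> carrier_vec (nH i)"
    and y: "y = ((F (Suc i) *\<^sub>v f + u \<cdot>\<^sub>v (\<phi> i *\<^sub>v h)) @\<^sub>v (G (Suc i) *\<^sub>v g + (- v) \<cdot>\<^sub>v (\<psi> i *\<^sub>v h))) @\<^sub>v (dH i *\<^sub>v h)"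
    by blast
  have "(f @\<^sub>v g) @\<^sub>v h \<in> carrier_vec (nF (Suc i) + nG (Suc i) + nH i)" using fgh by simp
  then show "y \<in> mat_image (D (Suc i))"
    unfolding y D_Suc_mult[OF fgh, symmetric] mat_image_def carrier_matD(2)[OF D_Suc_carrier] by (rule imageI)
qed

text \<open>A kernel element \<open>(f, g)\<close> yields \<open>p\<close> and \<open>q\<close> with
  \<open>v p + u q = 0\<close>. The assumption \<open>syzygy\<close> supplies \<open>r\<close>, and
  a preimage \<open>h\<close> of \<open>r\<close> under the augmentation of \<open>H\<close> reduces
  \<open>f\<close> and \<open>g\<close> to boundaries.\<close>

lemma exact_0: "mat_image (D (Suc 0)) = mat_kernel (D 0)"
proof (intro equalityI subsetI)
  fix y assume "y \<in> mat_image (D (Suc 0))"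
  then obtain f g h where fgh: "f \<in> carrier_vec (nF (Suc 0))" "g \<in> carrier_vec (nG (Suc 0))" "h \<in> carrier_vec (nH 0)"
    and y: "y = ((F (Suc 0) *\<^sub>v f + u \<cdot>\<^sub>v (\<phi> 0 *\<^sub>v h)) @\<^sub>v (G (Suc 0) *\<^sub>v g + (- v) \<cdot>\<^sub>v (\<psi> 0 *\<^sub>v h))) @\<^sub>v (dH 0 *\<^sub>v h)"
    unfolding D_Suc_image by blast
  let ?f = "F (Suc 0) *\<^sub>v f + u \<cdot>\<^sub>v (\<phi> 0 *\<^sub>v h)" and ?g = "G (Suc 0) *\<^sub>v g + (- v) \<cdot>\<^sub>v (\<psi> 0 *\<^sub>v h)"
  have c: "?f \<in> carrier_vec (nF 0)" "?g \<in> carrier_vec (nG 0)"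
    using F.carriers(2,5)[of 0] G.carriers(2,5)[of 0] fgh by auto
  have y': "y = ?f @\<^sub>v ?g" unfolding y by (rule eq_vecI) auto
  have H: "H 0 *\<^sub>v h \<in> carrier_vec 1" using F.carriers(3) by (intro carrier_vecI) auto
  have "D 0 *\<^sub>v y = v \<cdot>\<^sub>v (u \<cdot>\<^sub>v (H 0 *\<^sub>v h)) + u \<cdot>\<^sub>v ((- v) \<cdot>\<^sub>v (H 0 *\<^sub>v h))"
    unfolding y' D_0_mult[OF c] F.aug_of_image[OF fgh(1,3)] G.aug_of_image[OF fgh(2,3)] ..
  also have "\<dots> = 0\<^sub>v 1" by (rule smult_smult_cancel[OF H])
  finally show "y \<in> mat_kernel (D 0)" using c unfolding y' mat_kernel[OF D_0_carrier] by simp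
next
  fix y assume y: "y \<in> mat_kernel (D 0)"
  then have yc: "y \<in> carrier_vec (nF 0 + nG 0)" and D0: "D 0 *\<^sub>v y = 0\<^sub>v 1" using mat_kernelD[OF D_0_carrier] by auto
  define f g where "f = vec_first y (nF 0)" and "g = vec_last y (nG 0)"
  have fg: "f \<in> carrier_vec (nF 0)" "g \<in> carrier_vec (nG 0)" "y = f @\<^sub>v g"
    using yc vec_first_last_append[OF yc] by (simp_all add: f_def g_def)
  have Ff: "F 0 *\<^sub>v f \<in> mat_image (F 0)" and Gg: "G 0 *\<^sub>v g \<in> mat_image (G 0)"
    using fg F.carriers(1) G.carriers(1) by (auto simp: mat_image_def)
  define p q where "p = (F 0 *\<^sub>v f) $ 0" and "q = (G 0 *\<^sub>v g) $ 0"
  have pq: "p \<in> P" "q \<in> Q" using Ff Gg by (simp_all add: resolution_image[OF F.res] resolution_image[OF G.res] p_def q_def)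
  have "(v \<cdot>\<^sub>v (F 0 *\<^sub>v f) + u \<cdot>\<^sub>v (G 0 *\<^sub>v g)) $ 0 = 0" using D0 fg by (simp add: D_0_mult del: index_mult_mat_vec D.simps)
  then have "v * p + u * q = 0" using F.carriers(1) G.carriers(1) by (simp add: p_def q_def del: index_mult_mat_vec)
  then obtain r where r: "r \<in> R" "p = u * r" "q = - v * r" using syzygy[OF pq] by blast
  have "vec 1 (\<lambda>_. r) \<in> mat_image (H 0)" using r by (simp add: resolution_image[OF F.res'])
  then obtain h where h: "h \<in> carrier_vec (nH 0)" "H 0 *\<^sub>v h = vec 1 (\<lambda>_. r)"
    using F.carriers(3) by (auto simp: mat_image_def)
  have one: "x = k \<cdot>\<^sub>v vec 1 (\<lambda>_. r)" if "x \<in> carrier_vec 1" "x $ 0 = k * r" for x k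
    using that by (auto simp: vec_eq_iff)
  have "F 0 *\<^sub>v f = u \<cdot>\<^sub>v (H 0 *\<^sub>v h)"
    unfolding h(2) by (rule one) (use F.carriers(1) r p_def in \<open>auto intro!: carrier_vecI simp del: index_mult_mat_vec\<close>)
  then obtain f' where f': "f' \<in> carrier_vec (nF (Suc 0))" "f = F (Suc 0) *\<^sub>v f' + u \<cdot>\<^sub>v (\<phi> 0 *\<^sub>v h)"
    by (rule F.aug_exact[OF fg(1) h(1)])
  have "G 0 *\<^sub>v g = (- v) \<cdot>\<^sub>v (H 0 *\<^sub>v h)"
    unfolding h(2) by (rule one) (use G.carriers(1) r q_def in \<open>auto intro!: carrier_vecI simp del: index_mult_mat_vec\<close>)
  then obtain g' where g': "g' \<in> carrier_vec (nG (Suc 0))" "g = G (Suc 0) *\<^sub>v g' + (- v) \<cdot>\<^sub>v (\<psi> 0 *\<^sub>v h)"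
    by (rule G.aug_exact[OF fg(2) h(1)])
  have "y = ((F (Suc 0) *\<^sub>v f' + u \<cdot>\<^sub>v (\<phi> 0 *\<^sub>v h)) @\<^sub>v (G (Suc 0) *\<^sub>v g' + (- v) \<cdot>\<^sub>v (\<psi> 0 *\<^sub>v h))) @\<^sub>v (dH 0 *\<^sub>v h)"
    unfolding fg(3) f'(2)[symmetric] g'(2)[symmetric] by (rule eq_vecI) auto
  then show "y \<in> mat_image (D (Suc 0))" unfolding D_Suc_image using f'(1) g'(1) h(1) by blast
qed

lemma H_exact:
  assumes h: "h \<in> carrier_vec (nH i)" and 0: "H i *\<^sub>v h = 0\<^sub>v (dim_row (H i))"
  obtains h' where "h' \<in> carrier_vec (nH (Suc i))" "h = (-1) \<cdot>\<^sub>v (H (Suc i) *\<^sub>v h')"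
proof -
  have "dim_col (H i) = nH i" using resolution_carrier[OF F.res', of i] by auto
  then have "h \<in> mat_image (H (Suc i))"
    unfolding resolution_exact[OF F.res'] mat_kernel_def using h 0 by simp
  then obtain k where k: "k \<in> carrier_vec (nH (Suc i))" "h = H (Suc i) *\<^sub>v k"
    using F.carriers(4)[of i] by (auto simp: mat_image_def)
  have "h = (-1) \<cdot>\<^sub>v (H (Suc i) *\<^sub>v ((-1) \<cdot>\<^sub>v k))"
    unfolding mult_mat_vec_smult[OF F.carriers(4) k(1)] k(2) by (auto simp: vec_eq_iff simp del: index_mult_mat_vec)
  then show ?thesis using that k(1) smult_carrier_vec by blast
qed

lemma exact_Suc: "mat_image (D (Suc (Suc i))) = mat_kernel (D (Suc i))"
proof (intro equalityI subsetI)
  fix y assume "y \<in> mat_image (D (Suc (Suc i)))"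
  then obtain f g h where fgh: "f \<in> carrier_vec (nF (Suc (Suc i)))" "g \<in> carrier_vec (nG (Suc (Suc i)))" "h \<in> carrier_vec (nH (Suc i))"
    and y: "y = ((F (Suc (Suc i)) *\<^sub>v f + u \<cdot>\<^sub>v (\<phi> (Suc i) *\<^sub>v h)) @\<^sub>v (G (Suc (Suc i)) *\<^sub>v g + (- v) \<cdot>\<^sub>v (\<psi> (Suc i) *\<^sub>v h))) @\<^sub>v (dH (Suc i) *\<^sub>v h)"
    unfolding D_Suc_image by blast
  have c: "F (Suc (Suc i)) *\<^sub>v f + u \<cdot>\<^sub>v (\<phi> (Suc i) *\<^sub>v h) \<in> carrier_vec (nF (Suc i))"
    "G (Suc (Suc i)) *\<^sub>v g + (- v) \<cdot>\<^sub>v (\<psi> (Suc i) *\<^sub>v h) \<in> carrier_vec (nG (Suc i))"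
    using F.carriers(2,5)[of "Suc i"] G.carriers(2,5)[of "Suc i"] fgh by auto
  have Hh: "H (Suc i) *\<^sub>v h \<in> carrier_vec (nH i)" using F.carriers(4)[of i] fgh by auto
  have dH: "dH (Suc i) *\<^sub>v h = (-1) \<cdot>\<^sub>v (H (Suc i) *\<^sub>v h)"
    by (simp add: smult_mat_mult_vec[OF F.carriers(4) fgh(3)])
  have dHc: "(-1) \<cdot>\<^sub>v (H (Suc i) *\<^sub>v h) \<in> carrier_vec (nH i)" using Hh by simp
  have "dH i *\<^sub>v ((-1) \<cdot>\<^sub>v (H (Suc i) *\<^sub>v h)) = 0\<^sub>v (length (prevH i))"
  proof (cases i)
    case 0
    then show ?thesis by (auto simp: vec_eq_iff)
  next
    case (Suc k)
    have "H (Suc i) *\<^sub>v h \<in> mat_image (H (Suc i))" using fgh F.carriers(4)[of i] by (auto simp: mat_image_def)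
    then have "H i *\<^sub>v (H (Suc i) *\<^sub>v h) = 0\<^sub>v (nH k)"
      unfolding resolution_exact[OF F.res'] using Suc F.carriers(4)[of k] by (simp add: mat_kernel_def)
    then show ?thesis
      using mult_mat_vec_smult[OF dH_carrier Hh, of "-1"] smult_mat_mult_vec[OF F.carriers(4)[of k], of "H (Suc i) *\<^sub>v h" "-1"] Hh Suc
      by (simp add: smult_zero_vec)
  qed
  then show "y \<in> mat_kernel (D (Suc i))"
    unfolding y dH D_Suc_kernel[OF c dHc]
    using F.cone_squared[OF fgh(1,3)] G.cone_squared[OF fgh(2,3)] by blast
next
  fix y assume y: "y \<in> mat_kernel (D (Suc i))"
  then have "y \<in> carrier_vec (nF (Suc i) + nG (Suc i) + nH i)" using mat_kernelD(1)[OF D_Suc_carrier] by blast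
  then obtain f g h where fgh: "f \<in> carrier_vec (nF (Suc i))" "g \<in> carrier_vec (nG (Suc i))" "h \<in> carrier_vec (nH i)"
    and ye: "y = (f @\<^sub>v g) @\<^sub>v h" by (rule vec_split3)
  have k: "F (Suc i) *\<^sub>v f + u \<cdot>\<^sub>v (\<phi> i *\<^sub>v h) = 0\<^sub>v (nF i)" "G (Suc i) *\<^sub>v g + (- v) \<cdot>\<^sub>v (\<psi> i *\<^sub>v h) = 0\<^sub>v (nG i)"
    "dH i *\<^sub>v h = 0\<^sub>v (length (prevH i))" using y unfolding ye D_Suc_kernel[OF fgh] by auto
  \<comment> \<open>For \<open>i > 0\<close> the lower block says that \<open>h\<close> is a cycle.
    For \<open>i = 0\<close> that block is empty and the \<open>F\<close> block is used instead:
    applying \<open>F 0\<close> leaves \<open>u\<close> times the augmentation of \<open>h\<close>,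
    and \<open>u\<close> can be cancelled.\<close>
  have "H i *\<^sub>v h = 0\<^sub>v (dim_row (H i))"
  proof (cases i)
    case 0
    have H: "H 0 *\<^sub>v h \<in> carrier_vec 1" using F.carriers(3) by (intro carrier_vecI) auto
    have "u \<cdot>\<^sub>v (H 0 *\<^sub>v h) = F 0 *\<^sub>v 0\<^sub>v (nF 0)"
      using F.aug_of_image[of f h u] fgh k(1) 0 by simp
    also have "\<dots> = 0\<^sub>v 1" by (rule mult_mat_zero_vec[OF F.carriers(1)])
    finally have "u * (H 0 *\<^sub>v h) $ 0 = 0" using H by (auto simp: vec_eq_iff simp del: index_mult_mat_vec)
    then have "(H 0 *\<^sub>v h) $ 0 = 0" by (rule cancelu)
    then show ?thesis using H 0 F.carriers(3) by (auto simp: vec_eq_iff simp del: index_mult_mat_vec)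
  next
    case (Suc j)
    then have "(-1) \<cdot>\<^sub>v (H i *\<^sub>v h) = 0\<^sub>v (nH j)"
      using k(3) smult_mat_mult_vec[OF F.carriers(4)[of j], of h "-1"] fgh by simp
    then show ?thesis using Suc F.carriers(4)[of j] by (auto simp: vec_eq_iff simp del: index_mult_mat_vec)
  qed
  then obtain h' where h': "h' \<in> carrier_vec (nH (Suc i))" "h = (-1) \<cdot>\<^sub>v (H (Suc i) *\<^sub>v h')"
    using H_exact[OF fgh(3)] by blast
  obtain f' where f': "f' \<in> carrier_vec (nF (Suc (Suc i)))" "f = F (Suc (Suc i)) *\<^sub>v f' + u \<cdot>\<^sub>v (\<phi> (Suc i) *\<^sub>v h')"
    using F.cone_exact[OF fgh(1) h'(1)] k(1) unfolding h'(2) by blast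
  obtain g' where g': "g' \<in> carrier_vec (nG (Suc (Suc i)))" "g = G (Suc (Suc i)) *\<^sub>v g' + (- v) \<cdot>\<^sub>v (\<psi> (Suc i) *\<^sub>v h')"
    using G.cone_exact[OF fgh(2) h'(1)] k(2) unfolding h'(2) by blast
  have "h = dH (Suc i) *\<^sub>v h'"
    unfolding h'(2) by (simp add: smult_mat_mult_vec[OF F.carriers(4) h'(1)])
  then show "y \<in> mat_image (D (Suc (Suc i)))" unfolding ye D_Suc_image using f' g' h'(1) by blast
qed

lemma aug_image: "(\<lambda>x. (D 0 *\<^sub>v x) $ 0) ` carrier_vec (nF 0 + nG 0) = I"
proof (intro equalityI subsetI)
  have val: "(D 0 *\<^sub>v (f @\<^sub>v g)) $ 0 = v * (F 0 *\<^sub>v f) $ 0 + u * (G 0 *\<^sub>v g) $ 0"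
    if "f \<in> carrier_vec (nF 0)" "g \<in> carrier_vec (nG 0)" for f g
    unfolding D_0_mult[OF that] using F.carriers(1) G.carriers(1) by (simp del: index_mult_mat_vec)
  {
    fix z assume "z \<in> (\<lambda>x. (D 0 *\<^sub>v x) $ 0) ` carrier_vec (nF 0 + nG 0)"
    then obtain x where x: "x \<in> carrier_vec (nF 0 + nG 0)" "z = (D 0 *\<^sub>v x) $ 0" by blast
    define f g where "f = vec_first x (nF 0)" and "g = vec_last x (nG 0)"
    have fg: "f \<in> carrier_vec (nF 0)" "g \<in> carrier_vec (nG 0)" "x = f @\<^sub>v g"
      using x vec_first_last_append[OF x(1)] by (simp_all add: f_def g_def)
    have "F 0 *\<^sub>v f \<in> mat_image (F 0)" and "G 0 *\<^sub>v g \<in> mat_image (G 0)"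
      using fg F.carriers(1) G.carriers(1) by (auto simp: mat_image_def)
    then have "(F 0 *\<^sub>v f) $ 0 \<in> P" "(G 0 *\<^sub>v g) $ 0 \<in> Q"
      by (simp_all add: resolution_image[OF F.res] resolution_image[OF G.res])
    then show "z \<in> I" unfolding x(2) fg(3) val[OF fg(1,2)] I by blast
  next
    fix z assume "z \<in> I"
    then obtain p q where pq: "p \<in> P" "q \<in> Q" "z = v * p + u * q" unfolding I by blast
    have "vec 1 (\<lambda>_. p) \<in> mat_image (F 0)" "vec 1 (\<lambda>_. q) \<in> mat_image (G 0)"
      using pq by (simp_all add: resolution_image[OF F.res] resolution_image[OF G.res])
    then obtain f g where fg: "f \<in> carrier_vec (nF 0)" "g \<in> carrier_vec (nG 0)"
      "vec 1 (\<lambda>_. p) = F 0 *\<^sub>v f" "vec 1 (\<lambda>_. q) = G 0 *\<^sub>v g"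
      using F.carriers(1) G.carriers(1) by (auto simp: mat_image_def)
    have "z = (D 0 *\<^sub>v (f @\<^sub>v g)) $ 0" unfolding val[OF fg(1,2)] fg(3,4)[symmetric] pq(3) by simp
    moreover have "f @\<^sub>v g \<in> carrier_vec (nF 0 + nG 0)" using fg by simp
    ultimately show "z \<in> (\<lambda>x. (D 0 *\<^sub>v x) $ 0) ` carrier_vec (nF 0 + nG 0)" by (rule image_eqI)
  }
qed

section \<open>Grading and minimality of the cone\<close>

lemma D_0_homogeneous: "homogeneous_mat [0] (sh 0) (D 0)"
proof -
  have "homogeneous_mat ([0] @ []) (map ((+) 1) (shF 0) @ map ((+) 1) (shG 0)) (D 0)"
    unfolding D.simps
  proof (rule homogeneous_mat_four_block)
    show "homogeneous_mat [0] (map ((+) 1) (shF 0)) (v \<cdot>\<^sub>m F 0)"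
      using homogeneous_mat_shift[OF resolution_homogeneous_aug[OF F.res] homv, of 0] by simp
    show "homogeneous_mat [0] (map ((+) 1) (shG 0)) (u \<cdot>\<^sub>m G 0)"
      using homogeneous_mat_shift[OF resolution_homogeneous_aug[OF G.res] homu, of 0] by simp
  qed (simp_all add: homogeneous_mat_def)
  then show ?thesis by (simp add: sh_def)
qed

lemma D_Suc_homogeneous: "homogeneous_mat (sh i) (sh (Suc i)) (D (Suc i))"
  unfolding sh_def D.simps prevH.simps
proof (rule homogeneous_mat_four_block)
  have smult1: "1 \<cdot>\<^sub>m A = A" for A :: "('v, 'k) mpoly mat" by (rule eq_matI) auto
  have F: "homogeneous_mat (map ((+) 1) (shF i)) (map ((+) 1) (shF (Suc i))) (F (Suc i))"
    using homogeneous_mat_shift[OF resolution_homogeneous[OF F.res] homogeneous_one, of 1] by (simp add: smult1)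
  have G: "homogeneous_mat (map ((+) 1) (shG i)) (map ((+) 1) (shG (Suc i))) (G (Suc i))"
    using homogeneous_mat_shift[OF resolution_homogeneous[OF G.res] homogeneous_one, of 1] by (simp add: smult1)
  show "homogeneous_mat (map ((+) 1) (shF i) @ map ((+) 1) (shG i)) (map ((+) 1) (shF (Suc i)) @ map ((+) 1) (shG (Suc i))) (dFG i)"
    unfolding dFG_def by (rule homogeneous_mat_four_block[OF F _ _ G]) (simp_all add: homogeneous_mat_def)
  show "homogeneous_mat (map ((+) 1) (shF i) @ map ((+) 1) (shG i)) (map ((+) 2) (shH i)) (\<chi> i)"
    unfolding \<chi>_def
  proof (rule homogeneous_mat_append_rows)
    show "homogeneous_mat (map ((+) 1) (shF i)) (map ((+) 2) (shH i)) (u \<cdot>\<^sub>m \<phi> i)"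
      using homogeneous_mat_shift[OF _ homu, of "shF i" "shH i" "\<phi> i" 1] F.lift by (simp add: chain_lift_def)
    have "homogeneous 1 (- v)" using homv by simp
    then show "homogeneous_mat (map ((+) 1) (shG i)) (map ((+) 2) (shH i)) ((- v) \<cdot>\<^sub>m \<psi> i)"
      using homogeneous_mat_shift[of "shG i" "shH i" "\<psi> i" 1 "- v" 1] G.lift by (simp add: chain_lift_def)
  qed
  show "homogeneous_mat (map ((+) 2) (prevH i)) (map ((+) 1) (shF (Suc i)) @ map ((+) 1) (shG (Suc i)))
     (0\<^sub>m (length (prevH i)) (nF (Suc i) + nG (Suc i)))"
    by (simp add: homogeneous_mat_def)
  show "homogeneous_mat (map ((+) 2) (prevH i)) (map ((+) 2) (shH i)) (dH i)"
  proof (cases i)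
    case (Suc j)
    have "homogeneous 0 (-1 :: ('v, 'k) mpoly)" using homogeneous_one by simp
    then show ?thesis
      using homogeneous_mat_shift[OF resolution_homogeneous[OF F.res', of j], of 0 "-1" 2] Suc by simp
  qed (simp add: homogeneous_mat_def)
qed

lemma D_Suc_const_free: "const_free (D (Suc i))"
  unfolding D.simps
proof (rule const_free_four_block[OF dFG_carrier chi_carrier zero_carrier_mat dH_carrier])
  show "const_free (dFG i)" unfolding dFG_def
    by (rule const_free_four_block[OF F.carriers(2) zero_carrier_mat zero_carrier_mat G.carriers(2)])
      (simp_all add: const_free_minimal[OF minF] const_free_minimal[OF minG])
  have "const u = 0" "const v = 0" using homu homv const_homogeneous by fastforce+
  then show "const_free (\<chi> i)" unfolding \<chi>_def using F.carriers(5)[of i] G.carriers(5)[of i]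
    by (intro const_free_append_rows[of _ "nF i" "nH i" _ "nG i"] const_free_smult) auto
  show "const_free (dH i)"
    by (cases i) (auto intro: const_free_smult const_free_minimal[OF minH])
qed simp

lemma minimal_resolution: "minimal_graded_free_resolution sh D I"
proof -
  have len: "length (sh 0) = nF 0 + nG 0" by (simp add: sh_def)
  have "graded_free_resolution sh D I"
    unfolding graded_free_resolution_def
  proof (intro conjI allI impI)
    show "D 0 \<in> carrier_mat 1 (length (sh 0))" using D_0_homogeneous by (auto simp: homogeneous_mat_def)
    show "homogeneous (sh 0 ! c) (D 0 $$ (0, c))" if "c < length (sh 0)" for c
      using D_0_homogeneous that by (auto simp: homogeneous_mat_def)
    show "(\<lambda>v. (D 0 *\<^sub>v v) $ 0) ` carrier_vec (length (sh 0)) = I" unfolding len by (rule aug_image)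
    fix i
    show c: "D (Suc i) \<in> carrier_mat (length (sh i)) (length (sh (Suc i)))"
      by (rule homogeneous_mat_carrier[OF D_Suc_homogeneous])
    show "homogeneous (sh (Suc i) ! c - sh i ! r) (D (Suc i) $$ (r, c))"
      if "r < length (sh i)" "c < length (sh (Suc i))" for r c
      using D_Suc_homogeneous that by (auto simp: homogeneous_mat_def)
    have "mat_image (D (Suc i)) = mat_kernel (D i)" using exact_0 exact_Suc by (cases i) blast+
    then show "(\<lambda>v. D (Suc i) *\<^sub>v v) ` carrier_vec (length (sh (Suc i))) = mat_kernel (D i)"
      unfolding mat_image_def carrier_matD(2)[OF c] .
  qed
  moreover have "D (Suc i) $$ (r, c) \<in> Idl\<^bsub>poly_ring\<^esub> (range var)"
    if "r < length (sh i)" "c < length (sh (Suc i))" for i r c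
    using D_Suc_const_free[of i] that homogeneous_mat_carrier[OF D_Suc_homogeneous, of i]
    by (intro Idl_var_if_const) (auto simp: const_free_def simp del: D.simps)
  ultimately show ?thesis by (simp add: minimal_graded_free_resolution_def)
qed

end

section \<open>Betti numbers of the two parts of a splitting\<close>

lemma mon_dvd_if_keys:
  fixes p :: "('v, 'k::field) mpoly"
  assumes "\<And>m. m \<in> Poly_Mapping.keys p \<Longrightarrow> \<exists>m'. m = a + m'"
  obtains r where "p = mon a * r"
proof
  \<comment> \<open>The quotient by \<open>mon a\<close>: its coefficient at \<open>m\<close> is
    that of \<open>p\<close> at \<open>a + m\<close>. Injectivity of the translation keeps the
    support finite.\<close>
  let ?r = "Poly_Mapping.map_key ((+) a) p"
  have inj: "inj ((+) a)" by (simp add: inj_on_def)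
  show "p = mon a * ?r"
  proof (rule poly_mapping_eqI)
    fix m
    show "Poly_Mapping.lookup p m = Poly_Mapping.lookup (mon a * ?r) m"
    proof (cases "\<exists>m'. m = a + m'")
      case True
      then obtain m' where "m = a + m'" by blast
      then show ?thesis using inj by (simp add: lookup_single_times map_key.rep_eq)
    next
      case False
      then have "m \<notin> Poly_Mapping.keys p" "m \<notin> Poly_Mapping.keys (mon a * ?r)"
        using assms by (auto simp: keys_single_times)
      then show ?thesis by (simp add: in_keys_iff)
    qed
  qed
qed

lemma mon_times_exp_ideal:
  "(\<lambda>f. mon a * f) ` exp_ideal (up_closure E) = (exp_ideal (up_closure ((+) a ` E)) :: ('v, 'k::field) mpoly set)"
proof (intro equalityI subsetI)
  fix f assume "f \<in> (\<lambda>f. mon a * f) ` (exp_ideal (up_closure E) :: ('v, 'k) mpoly set)"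
  then obtain g :: "('v, 'k) mpoly" where g: "g \<in> exp_ideal (up_closure E)" "f = mon a * g" by blast
  have "a + m \<in> up_closure ((+) a ` E)" if mE: "m \<in> up_closure E" for m
  proof -
    obtain e b where "e \<in> E" "m = e + b" using mE unfolding up_closure_def by blast
    then show ?thesis using up_closureI[of "a + e" "(+) a ` E" b] by (simp add: add.assoc)
  qed
  then show "f \<in> exp_ideal (up_closure ((+) a ` E))"
    using g(1) unfolding g(2) exp_ideal_def mem_Collect_eq keys_single_times by blast
next
  fix f :: "('v, 'k) mpoly" assume f: "f \<in> exp_ideal (up_closure ((+) a ` E))"
  have ex: "\<exists>m'\<in>up_closure E. m = a + m'" if "m \<in> Poly_Mapping.keys f" for m
  proof -
    have "m \<in> up_closure ((+) a ` E)" using f that by (auto simp: exp_ideal_def)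
    then obtain e b where "e \<in> E" "m = a + e + b" unfolding up_closure_def by blast
    then show ?thesis using up_closureI[of e E b] by (auto simp: add.assoc)
  qed
  then obtain r where r: "f = mon a * r" using mon_dvd_if_keys[of f a] by blast
  have "r \<in> exp_ideal (up_closure E)"
    unfolding exp_ideal_def
  proof clarify
    fix m assume "m \<in> Poly_Mapping.keys r"
    then have "a + m \<in> Poly_Mapping.keys f" unfolding r keys_single_times by blast
    then show "m \<in> up_closure E" using ex by fastforce
  qed
  then show "f \<in> (\<lambda>f. mon a * f) ` exp_ideal (up_closure E)" using r by blast
qed

text \<open>The generators do not involve \<open>s\<close>, so the extra factor lies in the cofactor
  \<open>b\<close> and can be cancelled there: the ideal equals its own colon by this
  variable.\<close>

lemma up_closure_saturated:
  assumes E: "\<And>e. e \<in> E \<Longrightarrow> Poly_Mapping.lookup e s = 0" and m: "Poly_Mapping.single s 1 + m \<in> up_closure E"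
  shows "m \<in> up_closure E"
proof -
  obtain e b where eb: "e \<in> E" "Poly_Mapping.single s 1 + m = e + b" using m unfolding up_closure_def by blast
  have s: "Poly_Mapping.lookup b s \<ge> 1"
    using arg_cong[OF eb(2), of "\<lambda>m. Poly_Mapping.lookup m s"] E[OF eb(1)] by (simp add: lookup_add)
  have "b = Poly_Mapping.single s 1 + (b - Poly_Mapping.single s 1)"
    using s by (intro poly_mapping_eqI) (auto simp: lookup_add lookup_minus lookup_single when_def)
  then have "Poly_Mapping.single s 1 + m = Poly_Mapping.single s 1 + (e + (b - Poly_Mapping.single s 1))"
    using eb(2) by (metis add.left_commute)
  then have "m = e + (b - Poly_Mapping.single s 1)" by (rule add_left_imp_eq)
  then show ?thesis using up_closureI[OF eb(1)] by metis
qed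

lemma exp_ideal_saturated:
  fixes r :: "('v, 'k::field) mpoly"
  assumes E: "\<And>e. e \<in> E \<Longrightarrow> Poly_Mapping.lookup e s = 0" and "var s * r \<in> exp_ideal (up_closure E)"
  shows "r \<in> exp_ideal (up_closure E)"
  using assms(2) up_closure_saturated[of E s, OF E]
  by (auto simp: exp_ideal_def var_def keys_single_times)

lemma homogeneous_var: "homogeneous 1 (var s :: ('v, 'k::field) mpoly)"
  by (auto simp: homogeneous_def var_def monomial_degree_def)

text \<open>Multiplication by \<open>u\<close> is an isomorphism from \<open>I\<close>, twisted by
  \<open>e\<close>, onto its image. Only the augmentation changes, and its kernel stays the same
  because \<open>u\<close> can be cancelled.\<close>

lemma resolution_smult:
  fixes u :: "('v, 'k::field) mpoly"
  assumes min: "minimal_graded_free_resolution sh d I" and hom: "homogeneous e u"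
    and cancel: "\<And>f. u * f = 0 \<Longrightarrow> f = 0"
  shows "minimal_graded_free_resolution (\<lambda>i. map ((+) e) (sh i)) (\<lambda>i. if i = 0 then u \<cdot>\<^sub>m d 0 else d i) ((\<lambda>f. u * f) ` I)"
proof -
  have res: "graded_free_resolution sh d I" using min by (simp add: minimal_graded_free_resolution_def)
  have c0: "d 0 \<in> carrier_mat 1 (length (sh 0))" using resolution_carrier[OF res, of 0] by simp
  have cS: "d (Suc i) \<in> carrier_mat (length (sh i)) (length (sh (Suc i)))" for i using resolution_carrier[OF res, of "Suc i"] by simp
  have smult1: "1 \<cdot>\<^sub>m A = A" for A :: "('v, 'k) mpoly mat" by (rule eq_matI) auto
  have h0: "homogeneous_mat [0] (map ((+) e) (sh 0)) (u \<cdot>\<^sub>m d 0)"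
    using homogeneous_mat_shift[OF resolution_homogeneous_aug[OF res] hom, of 0] by simp
  have hS: "homogeneous_mat (map ((+) e) (sh i)) (map ((+) e) (sh (Suc i))) (d (Suc i))" for i
    using homogeneous_mat_shift[OF resolution_homogeneous[OF res] homogeneous_one, of e] by (simp add: smult1)
  have kernel: "mat_kernel (u \<cdot>\<^sub>m d 0) = mat_kernel (d 0)"
  proof -
    have uc: "u \<cdot>\<^sub>m d 0 \<in> carrier_mat 1 (length (sh 0))" using c0 by simp
    have "(u \<cdot>\<^sub>m d 0) *\<^sub>v x = 0\<^sub>v 1 \<longleftrightarrow> d 0 *\<^sub>v x = 0\<^sub>v 1" if x: "x \<in> carrier_vec (length (sh 0))" for x
    proof -
      define y where "y = d 0 *\<^sub>v x"
      have y: "y \<in> carrier_vec 1" using c0 by (auto simp: y_def intro!: carrier_vecI)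
      have "u \<cdot>\<^sub>v y = 0\<^sub>v 1 \<longleftrightarrow> u * y $ 0 = 0" using y by (auto simp: vec_eq_iff)
      also have "\<dots> \<longleftrightarrow> y $ 0 = 0" using cancel by auto
      also have "\<dots> \<longleftrightarrow> y = 0\<^sub>v 1" using y by (auto simp: vec_eq_iff)
      finally show ?thesis unfolding smult_mat_mult_vec[OF c0 x] y_def .
    qed
    then show ?thesis unfolding mat_kernel[OF uc] mat_kernel[OF c0] by blast
  qed
  show ?thesis
    unfolding minimal_graded_free_resolution_def graded_free_resolution_def
  proof (intro conjI allI impI, goal_cases)
    case 3
    have "((u \<cdot>\<^sub>m d 0) *\<^sub>v x) $ 0 = u * (d 0 *\<^sub>v x) $ 0" if "x \<in> carrier_vec (length (sh 0))" for x
      unfolding smult_mat_mult_vec[OF c0 that] using c0 by (simp del: index_mult_mat_vec)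
    then have "(\<lambda>x. ((u \<cdot>\<^sub>m d 0) *\<^sub>v x) $ 0) ` carrier_vec (length (sh 0)) = (\<lambda>f. u * f) ` ((\<lambda>x. (d 0 *\<^sub>v x) $ 0) ` carrier_vec (length (sh 0)))"
      unfolding image_image by (intro image_cong) auto
    then show ?case using res by (simp add: graded_free_resolution_def del: index_mult_mat_vec)
  next
    case (6 i)
    have "mat_image (d (Suc i)) = mat_kernel (if i = 0 then u \<cdot>\<^sub>m d 0 else d i)"
      using resolution_exact[OF res, of i] kernel by auto
    then show ?case using carrier_matD(2)[OF cS[of i]] by (simp add: mat_image_def)
  next
    case (7 i r c)
    then show ?case using min by (simp add: minimal_graded_free_resolution_def)
  qed (use h0 hS in \<open>auto simp: homogeneous_mat_def\<close>)
qed

text \<open>All four ideals receive explicit minimal resolutions: the cone for the sum, twists by 1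
  for the two summands, a twist by 2 for the intersection. The formula then compares lists of
  shifts. In the application \<open>s\<close> is \<open>x n\<close> and \<open>t\<close> is
  \<open>y n\<close>.\<close>

lemma betti_of_splitting:
  fixes EP EQ :: "('v::finite \<Rightarrow>\<^sub>0 nat) set" and i j :: int
  assumes fin: "finite EP" "finite EQ"
    and sP: "\<And>e. e \<in> EP \<Longrightarrow> Poly_Mapping.lookup e s = 0" and sQ: "\<And>e. e \<in> EQ \<Longrightarrow> Poly_Mapping.lookup e s = 0"
    and tQ: "\<And>e. e \<in> EQ \<Longrightarrow> Poly_Mapping.lookup e t = 0" and st: "s \<noteq> t"
  defines "P \<equiv> (\<lambda>f. var t * f) ` (exp_ideal (up_closure EP) :: ('v, 'k::field) mpoly set)"
    and "Q \<equiv> (\<lambda>f. var s * f) ` (exp_ideal (up_closure EQ) :: ('v, 'k::field) mpoly set)"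
  shows "betti (P <+>\<^bsub>poly_ring\<^esub> Q) i j = betti P i j + betti Q i j + betti (P \<inter> Q) (i - 1) j"
proof -
  let ?P = "exp_ideal (up_closure EP) :: ('v, 'k) mpoly set" and ?Q = "exp_ideal (up_closure EQ) :: ('v, 'k) mpoly set"
  define R where "R = ?P \<inter> ?Q"
  obtain ER where ER: "finite ER" "up_closure EP \<inter> up_closure EQ = up_closure ER" using up_closure_inter[OF fin] by blast
  have R: "R = exp_ideal (up_closure ER)" unfolding R_def exp_ideal_inter ER(2) ..
  have ideals: "ideal ?P poly_ring" "ideal ?Q poly_ring" by (intro ideal_exp_ideal up_closure_add; assumption)+
  obtain shF and F :: "nat \<Rightarrow> ('v, 'k) mpoly mat" where F: "minimal_graded_free_resolution shF F ?P"
    using exists_minimal_resolution[OF fin(1)] by blast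
  obtain shG and G :: "nat \<Rightarrow> ('v, 'k) mpoly mat" where G: "minimal_graded_free_resolution shG G ?Q"
    using exists_minimal_resolution[OF fin(2)] by blast
  obtain shH and H :: "nat \<Rightarrow> ('v, 'k) mpoly mat" where H: "minimal_graded_free_resolution shH H R"
    using exists_minimal_resolution[OF ER(1)] unfolding R by blast
  note res = F[unfolded minimal_graded_free_resolution_def, THEN conjunct1]
    G[unfolded minimal_graded_free_resolution_def, THEN conjunct1]
    H[unfolded minimal_graded_free_resolution_def, THEN conjunct1]
  obtain \<phi> where phi: "chain_lift shF F shH H \<phi>" using exists_chain_lift[OF res(3,1)] by (auto simp: R_def)
  obtain \<psi> where psi: "chain_lift shG G shH H \<psi>" using exists_chain_lift[OF res(3,2)] by (auto simp: R_def)
  have cancel: "f = 0" if "var v * f = 0" for v and f :: "('v, 'k) mpoly" using that var_times_cancel[of v f 0] by simp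
  \<comment> \<open>Since \<open>s\<close> and \<open>t\<close> are distinct variables,
    \<open>s\<close> divides \<open>p\<close>, say \<open>p = s r\<close>, and then
    \<open>q = - t r\<close>. Saturation with respect to \<open>s\<close> puts \<open>r\<close> into
    \<open>?P\<close>, saturation with respect to \<open>t\<close> puts it into
    \<open>?Q\<close>.\<close>
  have syzygy: "\<exists>r\<in>R. p = var s * r \<and> q = - var t * r" if pq: "p \<in> ?P" "q \<in> ?Q" "var t * p + var s * q = 0" for p q
  proof -
    have eq: "var t * p = var s * (- q)" using pq(3) by (simp add: eq_neg_iff_add_eq_0)
    have "\<exists>m'. m = Poly_Mapping.single s 1 + m'" if m: "m \<in> Poly_Mapping.keys p" for m
    proof -
      have "Poly_Mapping.single t 1 + m \<in> Poly_Mapping.keys (var t * p)" using m unfolding var_def keys_single_times by blast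
      then obtain m' where m': "Poly_Mapping.single t 1 + m = Poly_Mapping.single s 1 + m'"
        unfolding eq unfolding var_def keys_single_times by blast
      have "Poly_Mapping.lookup m s \<ge> 1"
        using arg_cong[OF m', of "\<lambda>m. Poly_Mapping.lookup m s"] st by (simp add: lookup_add lookup_single)
      then have "m = Poly_Mapping.single s 1 + (m - Poly_Mapping.single s 1)"
        by (intro poly_mapping_eqI) (auto simp: lookup_add lookup_minus lookup_single when_def)
      then show ?thesis by blast
    qed
    then obtain r where r: "p = var s * r" using mon_dvd_if_keys[of p "Poly_Mapping.single s 1"] unfolding var_def by blast
    have "var s * (var t * r + q) = 0" using pq(3) unfolding r by (simp add: algebra_simps)
    then have "var t * r + q = 0" by (rule cancel)
    then have q: "q = - var t * r" by (simp add: eq_neg_iff_add_eq_0 add.commute)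
    have "r \<in> ?P" using exp_ideal_saturated[OF sP] pq(1) unfolding r by blast
    moreover have "- r \<in> ?Q" using exp_ideal_saturated[where r = "- r", OF tQ] pq(2) unfolding q by simp
    then have "(-1) * (- r) \<in> ?Q" using ideals(2) unfolding ideal_poly_ring_iff by blast
    ultimately have "r \<in> R" by (simp add: R_def)
    then show ?thesis using r q by blast
  qed
  have I: "P <+>\<^bsub>poly_ring\<^esub> Q = {var t * p + var s * q | p q. p \<in> ?P \<and> q \<in> ?Q}"
    unfolding P_def Q_def by (auto simp: set_add_def')
  interpret splitting_cone shF F ?P shG G ?Q shH H R \<phi> \<psi> "var s" "var t" "P <+>\<^bsub>poly_ring\<^esub> Q"
    by unfold_locales (fact res phi psi homogeneous_var cancel syzygy I F G H)+
  \<comment> \<open>An element of the intersection has the form \<open>t p = s q\<close>, which is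
    the same syzygy for \<open>p\<close> and \<open>- q\<close>.\<close>
  have inter: "P \<inter> Q = (\<lambda>f. (var s * var t) * f) ` R"
  proof (intro equalityI subsetI)
    fix f assume "f \<in> P \<inter> Q"
    then obtain p q where pq: "p \<in> ?P" "q \<in> ?Q" "f = var t * p" "f = var s * q" unfolding P_def Q_def by blast
    have "(-1) * q \<in> ?Q" using ideals(2) pq(2) unfolding ideal_poly_ring_iff by blast
    then obtain r where "r \<in> R" "p = var s * r" using syzygy[OF pq(1), of "- q"] pq(3,4) by auto
    then show "f \<in> (\<lambda>f. (var s * var t) * f) ` R" using pq(3) by (intro image_eqI[of _ _ r]) (auto simp: algebra_simps)
  next
    fix f assume "f \<in> (\<lambda>f. (var s * var t) * f) ` R"
    then obtain r where r: "r \<in> ?P" "r \<in> ?Q" "f = var t * (var s * r)" "f = var s * (var t * r)"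
      by (auto simp: R_def algebra_simps)
    moreover have "var s * r \<in> ?P" "var t * r \<in> ?Q" using r ideals unfolding ideal_poly_ring_iff by blast+
    ultimately show "f \<in> P \<inter> Q" unfolding P_def Q_def by blast
  qed
  have hst: "homogeneous 2 (var s * var t :: ('v, 'k) mpoly)"
    using homogeneous_times[OF homogeneous_var homogeneous_var, of s t] by simp
  have bI: "betti (P <+>\<^bsub>poly_ring\<^esub> Q) i j = (if i < 0 then 0 else count_list (sh (nat i)) j)"
    by (rule betti_eq[OF minimal_resolution])
  have bP: "betti P i j = (if i < 0 then 0 else count_list (map ((+) 1) (shF (nat i))) j)"
    unfolding P_def by (rule betti_eq[OF resolution_smult[OF F homogeneous_var cancel]])
  have bQ: "betti Q i j = (if i < 0 then 0 else count_list (map ((+) 1) (shG (nat i))) j)"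
    unfolding Q_def by (rule betti_eq[OF resolution_smult[OF G homogeneous_var cancel]])
  have bR: "betti (P \<inter> Q) (i - 1) j = (if i - 1 < 0 then 0 else count_list (map ((+) 2) (shH (nat (i - 1)))) j)"
    unfolding inter
  proof (rule betti_eq[OF resolution_smult[OF H hst]])
    fix f :: "('v, 'k) mpoly" assume "var s * var t * f = 0"
    then have "var s * (var t * f) = 0" by (simp add: mult.assoc)
    then show "f = 0" using cancel by blast
  qed
  show ?thesis
  \<comment> \<open>At \<open>i = 0\<close> the two conventions agree: \<open>betti\<close> is 0 in
    degree -1 and \<open>prevH 0\<close> is empty. For positive \<open>i\<close> the list
    \<open>prevH (nat i)\<close> is \<open>shH (nat (i - 1))\<close>.\<close>
  proof (cases "i < 1")
    case True
    then show ?thesis unfolding bI bP bQ bR by (auto simp: sh_def)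
  next
    case False
    then have "nat i = Suc (nat (i - 1))" by simp
    then show ?thesis using False unfolding bI bP bQ bR sh_def by simp
  qed
qed

section \<open>Minimal vertex covers\<close>

lemma standard_labellingD:
  assumes std: "standard_labelling G n x y"
  shows "inj_on x {1..n}" "inj_on y {1..n}" "x ` {1..n} \<inter> y ` {1..n} = {}"
    "verts G = x ` {1..n} \<union> y ` {1..n}"
    "minimal_vertex_cover G (x ` {1..n})" "independent_set G (y ` {1..n})"
    "\<And>i. i \<in> {1..n} \<Longrightarrow> {x i, y i} \<in> edges G"
    "\<And>i j. i \<in> {1..n} \<Longrightarrow> j \<in> {1..n} \<Longrightarrow> {x i, y j} \<in> edges G \<Longrightarrow> i \<le> j"
    "\<And>i j k z. i \<in> {1..n} \<Longrightarrow> j \<in> {1..n} \<Longrightarrow> k \<in> {1..n} \<Longrightarrow> z \<in> {x i, y i} \<Longrightarrow>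
      i \<noteq> j \<Longrightarrow> j \<noteq> k \<Longrightarrow> i \<noteq> k \<Longrightarrow> {z, x j} \<in> edges G \<Longrightarrow> {y j, x k} \<in> edges G \<Longrightarrow> {z, x k} \<in> edges G"
proof -
  show "inj_on x {1..n}" using std unfolding standard_labelling_def by (elim conjE)
  show "inj_on y {1..n}" using std unfolding standard_labelling_def by (elim conjE)
  show "x ` {1..n} \<inter> y ` {1..n} = {}" using std unfolding standard_labelling_def by (elim conjE)
  show "verts G = x ` {1..n} \<union> y ` {1..n}" using std unfolding standard_labelling_def by (elim conjE)
  show "minimal_vertex_cover G (x ` {1..n})" using std unfolding standard_labelling_def by (elim conjE)
  show "independent_set G (y ` {1..n})"
    using std unfolding standard_labelling_def maximal_independent_set_def by (elim conjE)
  have "\<forall>i\<in>{1..n}. {x i, y i} \<in> edges G" using std unfolding standard_labelling_def by (elim conjE)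
  then show "\<And>i. i \<in> {1..n} \<Longrightarrow> {x i, y i} \<in> edges G" by blast
  have "\<forall>i\<in>{1..n}. \<forall>j\<in>{1..n}. {x i, y j} \<in> edges G \<longrightarrow> i \<le> j"
    using std unfolding standard_labelling_def by (elim conjE)
  then show "\<And>i j. i \<in> {1..n} \<Longrightarrow> j \<in> {1..n} \<Longrightarrow> {x i, y j} \<in> edges G \<Longrightarrow> i \<le> j" by blast
  have "\<forall>i\<in>{1..n}. \<forall>j\<in>{1..n}. \<forall>k\<in>{1..n}. \<forall>z\<in>{x i, y i}.
      i \<noteq> j \<and> j \<noteq> k \<and> i \<noteq> k \<and> {z, x j} \<in> edges G \<and> {y j, x k} \<in> edges G \<longrightarrow> {z, x k} \<in> edges G"
    using std unfolding standard_labelling_def by (elim conjE)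
  then show "\<And>i j k z. i \<in> {1..n} \<Longrightarrow> j \<in> {1..n} \<Longrightarrow> k \<in> {1..n} \<Longrightarrow> z \<in> {x i, y i} \<Longrightarrow>
      i \<noteq> j \<Longrightarrow> j \<noteq> k \<Longrightarrow> i \<noteq> k \<Longrightarrow> {z, x j} \<in> edges G \<Longrightarrow> {y j, x k} \<in> edges G \<Longrightarrow> {z, x k} \<in> edges G"
    by blast
qed

lemma edge_pair:
  assumes "simple_graph G" "e \<in> edges G" "s \<in> e"
  obtains t where "e = {s, t}" "s \<noteq> t"
proof -
  have "card e = 2" using assms by (auto simp: simple_graph_def)
  then obtain a b where "e = {a, b}" "a \<noteq> b" by (auto simp: card_2_iff)
  then show ?thesis using that[of a] that[of b] assms(3) by (auto simp: insert_commute)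
qed

text \<open>The \<open>x\<close>-vertices form a minimal cover, so every minimal cover has
  \<open>n\<close> elements. It meets each of the \<open>n\<close> pairwise disjoint edges
  \<open>{x i, y i}\<close>, hence each exactly once.\<close>

lemma unmixed_cover_one_of_each_pair:
  assumes std: "standard_labelling G n x y" and unm: "unmixed G"
    and C: "minimal_vertex_cover G C" and a: "a \<in> {1..n}" "x a \<in> C"
  shows "y a \<notin> C"
proof
  assume ya: "y a \<in> C"
  have X: "minimal_vertex_cover G (x ` {1..n})" and inj: "inj_on x {1..n}" "inj_on y {1..n}" "x ` {1..n} \<inter> y ` {1..n} = {}"
    and xy: "\<And>i. i \<in> {1..n} \<Longrightarrow> {x i, y i} \<in> edges G" and V: "verts G = x ` {1..n} \<union> y ` {1..n}"
    by (fact standard_labellingD[OF std])+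
  have "card C = n" using unm C X card_image[OF inj(1)] by (metis unmixed_def card_atLeastAtMost diff_Suc_1 Suc_eq_plus1)
  have disj: "{x i, y i} \<inter> {x j, y j} = {}" if "i \<in> {1..n}" "j \<in> {1..n}" "i \<noteq> j" for i j
  proof -
    have "x i \<noteq> x j" "y i \<noteq> y j" using that inj_onD[OF inj(1)] inj_onD[OF inj(2)] by blast+
    moreover have "x i \<noteq> y j" "y i \<noteq> x j" using that inj(3) by blast+
    ultimately show ?thesis by simp
  qed
  have "C \<subseteq> verts G" using C by (simp add: minimal_vertex_cover_def vertex_cover_def)
  then have "C = (\<Union>i\<in>{1..n}. C \<inter> {x i, y i})" unfolding V by blast
  moreover have "card (\<Union>i\<in>{1..n}. C \<inter> {x i, y i}) = (\<Sum>i\<in>{1..n}. card (C \<inter> {x i, y i}))"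
  proof (rule card_UN_disjoint)
    show "\<forall>i\<in>{1..n}. \<forall>j\<in>{1..n}. i \<noteq> j \<longrightarrow> (C \<inter> {x i, y i}) \<inter> (C \<inter> {x j, y j}) = {}"
    proof (intro ballI impI)
      fix i j assume "i \<in> {1..n}" "j \<in> {1..n}" "i \<noteq> j"
      from disj[OF this] show "(C \<inter> {x i, y i}) \<inter> (C \<inter> {x j, y j}) = {}" by blast
    qed
  qed simp_all
  ultimately have "card C = (\<Sum>i\<in>{1..n}. card (C \<inter> {x i, y i}))" by simp
  also have "\<dots> > (\<Sum>i\<in>{1..n}. 1)"
  proof (rule sum_strict_mono_ex1)
    show "\<forall>i\<in>{1..n}. 1 \<le> card (C \<inter> {x i, y i})"
    proof
      fix i assume "i \<in> {1..n}"
      from xy[OF this] have "{x i, y i} \<inter> C \<noteq> {}"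
        using C unfolding minimal_vertex_cover_def vertex_cover_def by blast
      then have "0 < card (C \<inter> {x i, y i})" by (simp add: card_gt_0_iff Int_commute)
      then show "1 \<le> card (C \<inter> {x i, y i})" by simp
    qed
    have "C \<inter> {x a, y a} = {x a, y a}" using a ya by auto
    moreover have "x a \<noteq> y a" using a(1) inj(3) by blast
    ultimately show "\<exists>i\<in>{1..n}. 1 < card (C \<inter> {x i, y i})" using a(1) by (intro bexI[of _ a]) auto
  qed simp
  finally show False using \<open>card C = n\<close> by simp
qed

text \<open>A cover avoiding \<open>z\<close> contains all neighbours of \<open>z\<close>, namely
  \<open>w\<close> and the \<open>x\<close>-vertices indexed by \<open>D\<close>. Unmixedness keeps
  their partners \<open>y a\<close> out, so the rest of the cover lies in \<open>G'\<close>.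
  Conversely, by \<open>ny\<close> every edge at such a \<open>y a\<close> is covered by the forced
  vertices, so covers of \<open>G'\<close> extend to \<open>G\<close>.\<close>

lemma minimal_covers_avoiding:
  assumes G: "simple_graph G" and std: "standard_labelling G n x y" and unm: "unmixed G"
    and D: "D \<subseteq> {1..n}" and zw: "z \<noteq> w" "w \<notin> x ` D" "z \<notin> x ` D"
    and nb: "closed_nbhd G z = x ` D \<union> {z, w}"
    and ny: "\<And>a t. a \<in> D \<Longrightarrow> {y a, t} \<in> edges G \<Longrightarrow> t \<in> x ` D \<union> {w}"
  defines "G' \<equiv> delete_verts G (x ` D \<union> y ` D \<union> {z, w})"
  shows "{C. minimal_vertex_cover G C \<and> z \<notin> C} = (\<lambda>C'. x ` D \<union> {w} \<union> C') ` {C'. minimal_vertex_cover G' C'}"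
proof -
  let ?W = "x ` D \<union> y ` D \<union> {z, w}" and ?N = "x ` D \<union> {w}"
  have N: "t \<in> ?N" if "{z, t} \<in> edges G" "z \<noteq> t" for t
  proof -
    have "t \<in> closed_nbhd G z" using that by (simp add: closed_nbhd_def)
    then show ?thesis using that unfolding nb by auto
  qed
  have N': "{z, t} \<in> edges G" if "t \<in> ?N" for t
  proof -
    have "t \<in> closed_nbhd G z" using that unfolding nb by blast
    moreover have "t \<noteq> z" using that zw by auto
    ultimately show ?thesis by (simp add: closed_nbhd_def)
  qed
  have subV: "e \<subseteq> verts G" if "e \<in> edges G" for e using that G by (auto simp: simple_graph_def)
  have NV: "?N \<subseteq> verts G" using N' subV by blast
  have NC: "?N \<subseteq> C" if "vertex_cover G C" "z \<notin> C" for C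
  proof
    fix t assume "t \<in> ?N"
    then have "{z, t} \<inter> C \<noteq> {}" using N' that(1) unfolding vertex_cover_def by blast
    then show "t \<in> C" using that(2) by blast
  qed
  have cover: "vertex_cover G (?N \<union> E)" if E: "vertex_cover G' E" for E
    unfolding vertex_cover_def
  proof (intro conjI ballI)
    show "?N \<union> E \<subseteq> verts G" using NV E by (auto simp: vertex_cover_def G'_def delete_verts_def)
    fix e assume e: "e \<in> edges G"
    show "e \<inter> (?N \<union> E) \<noteq> {}"
    proof (cases "e \<inter> ?W = {}")
      case True
      then have "e \<in> edges G'" using e by (simp add: G'_def delete_verts_def)
      then show ?thesis using E by (auto simp: vertex_cover_def)
    next
      case False
      then obtain s where s: "s \<in> e" "s \<in> ?W" by blast
      obtain t where t: "e = {s, t}" "s \<noteq> t" using edge_pair[OF G e s(1)] .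
      consider "s \<in> ?N" | "s = z" | a where "a \<in> D" "s = y a" using s(2) by blast
      then show ?thesis
      proof cases
        case 2
        then show ?thesis using N[of t] e t by auto
      next
        case 3
        then show ?thesis using ny[of a t] e t by auto
      qed (use t in auto)
    qed
  qed
  have restrict: "vertex_cover G' (E - ?N)" if E: "vertex_cover G E" "E - ?N \<subseteq> verts G'" for E
    unfolding vertex_cover_def
  proof (intro conjI ballI E(2))
    fix e assume "e \<in> edges G'"
    then have "e \<in> edges G" "e \<inter> ?W = {}" by (auto simp: G'_def delete_verts_def)
    then show "e \<inter> (E - ?N) \<noteq> {}" using E by (fastforce simp: vertex_cover_def)
  qed
  have V': "verts G' = verts G - ?W" by (simp add: G'_def delete_verts_def)
  show ?thesis
  proof (intro equalityI subsetI)
    fix C assume "C \<in> {C. minimal_vertex_cover G C \<and> z \<notin> C}"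
    then have C: "minimal_vertex_cover G C" "vertex_cover G C" "z \<notin> C" "?N \<subseteq> C"
      using NC by (auto simp: minimal_vertex_cover_def)
    \<comment> \<open>This ensures that \<open>C - ?N\<close> uses vertices of \<open>G'\<close>
      only, as the partners \<open>y a\<close> are deleted there.\<close>
    have "y a \<notin> C" if "a \<in> D" for a
    proof (rule unmixed_cover_one_of_each_pair[OF std unm C(1)])
      show "a \<in> {1..n}" using that D by blast
      show "x a \<in> C" using that C(4) by blast
    qed
    then have sub: "C - ?N \<subseteq> verts G'" using C unfolding V' by (auto simp: vertex_cover_def)
    have "minimal_vertex_cover G' (C - ?N)"
      unfolding minimal_vertex_cover_def
    proof (intro conjI allI impI notI)
      show "vertex_cover G' (C - ?N)" by (rule restrict[OF C(2) sub])
      fix E assume E: "E \<subset> C - ?N" "vertex_cover G' E"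
      have "?N \<union> E \<subset> C" using E(1) C(4) by auto
      then show False using C(1) cover[OF E(2)] by (auto simp: minimal_vertex_cover_def)
    qed
    moreover have "C = ?N \<union> (C - ?N)" using C(4) by auto
    ultimately show "C \<in> (\<lambda>C'. ?N \<union> C') ` {C'. minimal_vertex_cover G' C'}" by blast
  next
    fix C assume "C \<in> (\<lambda>C'. ?N \<union> C') ` {C'. minimal_vertex_cover G' C'}"
    then obtain C' where C': "minimal_vertex_cover G' C'" "C = ?N \<union> C'" by blast
    have sub: "C' \<subseteq> verts G'" using C' by (auto simp: minimal_vertex_cover_def vertex_cover_def)
    then have zC: "z \<notin> C" unfolding C'(2) V' using zw by auto
    have "minimal_vertex_cover G C"
      unfolding minimal_vertex_cover_def
    proof (intro conjI allI impI notI)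
      show "vertex_cover G C" unfolding C'(2) using C'(1) by (intro cover) (simp add: minimal_vertex_cover_def)
      fix E assume E: "E \<subset> C" "vertex_cover G E"
      \<comment> \<open>A subset of \<open>C\<close> still avoids \<open>z\<close>, so as a cover it
        must contain the forced vertices too. This is what carries minimality from \<open>G'\<close>
        to \<open>G\<close>.\<close>
      then have NE: "?N \<subseteq> E" using NC zC by blast
      have "E - ?N \<subseteq> C'" using E(1) C'(2) by blast
      moreover have "vertex_cover G' (E - ?N)" using restrict[OF E(2)] calculation sub by blast
      ultimately have "E - ?N = C'" using C'(1) by (auto simp: minimal_vertex_cover_def)
      then show False using E(1) NE C'(2) by blast
    qed
    then show "C \<in> {C. minimal_vertex_cover G C \<and> z \<notin> C}" using zC by simp
  qed
qed

text \<open>Independence of the \<open>y\<close>-vertices makes \<open>t\<close> some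
  \<open>x k\<close>. If \<open>k\<close> differs from \<open>a\<close> and \<open>n\<close>,
  condition (v) with \<open>i = n\<close>, applied to the edges from \<open>z\<close> to
  \<open>x a\<close> and from \<open>y a\<close> to \<open>x k\<close>, makes \<open>x k\<close> a
  neighbour of \<open>z\<close>. If \<open>k = n\<close> and \<open>z = x n\<close>, condition (iii)
  would give \<open>n \<le> a\<close>, which is impossible; if \<open>k = n\<close> and
  \<open>z = y n\<close>, then \<open>t\<close> is \<open>w\<close>.\<close>

lemma neighbours_of_matched_vertices:
  assumes G: "simple_graph G" and std: "standard_labelling G n x y"
    and z: "z = x n \<and> w = y n \<or> z = y n \<and> w = x n" and n: "n \<ge> 1" and D: "D \<subseteq> {1..<n}"
    and nb: "closed_nbhd G z = x ` D \<union> {z, w}" and a: "a \<in> D" and e: "{y a, t} \<in> edges G"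
  shows "t \<in> x ` D \<union> {w}"
proof -
  have inj: "inj_on x {1..n}" "inj_on y {1..n}" "x ` {1..n} \<inter> y ` {1..n} = {}"
    and V: "verts G = x ` {1..n} \<union> y ` {1..n}" and Y: "independent_set G (y ` {1..n})"
    and iii: "\<And>i j. i \<in> {1..n} \<Longrightarrow> j \<in> {1..n} \<Longrightarrow> {x i, y j} \<in> edges G \<Longrightarrow> i \<le> j"
    and v: "\<And>i j k z. i \<in> {1..n} \<Longrightarrow> j \<in> {1..n} \<Longrightarrow> k \<in> {1..n} \<Longrightarrow> z \<in> {x i, y i} \<Longrightarrow>
      i \<noteq> j \<Longrightarrow> j \<noteq> k \<Longrightarrow> i \<noteq> k \<Longrightarrow> {z, x j} \<in> edges G \<Longrightarrow> {y j, x k} \<in> edges G \<Longrightarrow> {z, x k} \<in> edges G"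
    by (fact standard_labellingD[OF std])+
  have a': "a \<in> {1..n}" "a \<noteq> n" using a D by auto
  have nn: "n \<in> {1..n}" using n by simp
  have xyd: "x i \<noteq> y j" if "i \<in> {1..n}" "j \<in> {1..n}" for i j using inj(3) that by blast
  have "t \<in> verts G" using G e by (auto simp: simple_graph_def)
  moreover have "t \<notin> y ` {1..n}" using Y e a' by (auto simp: independent_set_def)
  ultimately obtain k where k: "k \<in> {1..n}" "t = x k" using V by blast
  have "x a \<in> closed_nbhd G z" using a unfolding nb by blast
  moreover have "x a \<noteq> z" using z inj_onD[OF inj(1) _ a'(1) nn] a'(2) xyd[OF a'(1) nn] by metis
  ultimately have za: "{z, x a} \<in> edges G" by (simp add: closed_nbhd_def)
  consider "k = a" | "k = n" | "k \<noteq> a" "k \<noteq> n" by blast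
  then show ?thesis
  proof cases
    case 1
    then show ?thesis using a k by simp
  next
    case 2
    show ?thesis
    proof (cases "z = x n")
      case True
      have "{x n, y a} \<in> edges G" using e k 2 by (simp add: insert_commute)
      then show ?thesis using iii[OF nn a'(1)] a' by auto
    next
      case False
      then show ?thesis using z k 2 by auto
    qed
  next
    case 3
    have "{z, x k} \<in> edges G"
      by (rule v[OF nn a'(1) k(1), of z]) (use z a' 3 za e k in auto)
    then have "x k \<in> x ` D \<union> {z, w}" unfolding nb[symmetric] by (simp add: closed_nbhd_def)
    moreover have "x k \<noteq> x n" "x k \<noteq> y n" using 3(2) inj_onD[OF inj(1) _ k(1) nn] xyd[OF k(1) nn] by blast+
    ultimately show ?thesis using z k(2) by auto
  qed
qed

section \<open>The splitting of the cover ideal\<close>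

definition cover_exp :: "'v set \<Rightarrow> ('v \<Rightarrow>\<^sub>0 nat)" where
  "cover_exp C = (\<Sum>v\<in>C. Poly_Mapping.single v 1)"

lemma lookup_cover_exp: "finite C \<Longrightarrow> Poly_Mapping.lookup (cover_exp C) v = (if v \<in> C then 1 else 0)"
  by (simp add: cover_exp_def lookup_sum lookup_single when_def)

lemma prod_var: "finite C \<Longrightarrow> (\<Prod>v\<in>C. var v) = (mon (cover_exp C) :: ('v, 'k::field) mpoly)"
proof (induction C rule: finite_induct)
  case empty
  then show ?case by (simp add: cover_exp_def)
next
  case (insert v C)
  then show ?case by (simp add: cover_exp_def var_def mult_single)
qed

lemma cover_exp_union: "finite C \<Longrightarrow> finite D \<Longrightarrow> C \<inter> D = {} \<Longrightarrow> cover_exp (C \<union> D) = cover_exp C + cover_exp D"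
  by (simp add: cover_exp_def sum.union_disjoint)

lemma inj_cover_exp: "inj (cover_exp :: 'v::finite set \<Rightarrow> _)"
proof (rule injI)
  fix C D :: "'v set" assume CD: "cover_exp C = cover_exp D"
  have "(v \<in> C) = (v \<in> D)" for v
  proof -
    have "Poly_Mapping.lookup (cover_exp C) v = Poly_Mapping.lookup (cover_exp D) v"
      using CD by simp
    then show ?thesis by (simp add: lookup_cover_exp split: if_splits)
  qed
  then show "C = D" by blast
qed

lemma cover_ideal_eq:
  fixes G :: "'v::finite graph"
  shows "cover_ideal G = (Idl\<^bsub>poly_ring\<^esub> (mon ` cover_exp ` {C. minimal_vertex_cover G C}) :: ('v, 'k::field) mpoly set)"
proof -
  have "{\<Prod>z\<in>C. var z | C. minimal_vertex_cover G C} = (mon ` cover_exp ` {C. minimal_vertex_cover G C} :: ('v, 'k::field) mpoly set)"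
    by (auto simp: prod_var)
  then show ?thesis by (simp add: cover_ideal_def)
qed

text \<open>Divisibility between squarefree monomials is inclusion of their supports, and minimal
  covers are pairwise incomparable.\<close>

lemma minimal_covers_antichain:
  fixes G :: "'v::finite graph"
  assumes "a \<in> cover_exp ` {C. minimal_vertex_cover G C}" "a + b \<in> cover_exp ` {C. minimal_vertex_cover G C}"
  shows "b = 0"
proof -
  obtain C D where CD: "minimal_vertex_cover G C" "minimal_vertex_cover G D" "a = cover_exp C" "a + b = cover_exp D"
    using assms by auto
  have "C \<subseteq> D"
  proof
    fix v assume "v \<in> C"
    then show "v \<in> D" using arg_cong[OF CD(4), of "\<lambda>m. Poly_Mapping.lookup m v"] lookup_cover_exp[of D v]
      by (auto simp: CD(3) lookup_add lookup_cover_exp split: if_splits)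
  qed
  then have "C = D" using CD(1,2) by (auto simp: minimal_vertex_cover_def)
  then show ?thesis using CD(3,4) by simp
qed

lemma mon_cover_exp_image:
  fixes Cs :: "'v::finite set set"
  assumes "\<And>C. C \<in> Cs \<Longrightarrow> C \<inter> N = {}"
  shows "(+) (cover_exp N) ` cover_exp ` Cs = cover_exp ` (\<lambda>C. N \<union> C) ` Cs"
  unfolding image_image using assms by (intro image_cong) (auto simp: cover_exp_union Int_commute)

text \<open>Two views of one ideal: with the variable \<open>t\<close> split off it fits
  \<open>betti_of_splitting\<close>, while the explicit monomial generators can be matched with
  minimal covers of the whole graph.\<close>

lemma cover_ideal_part:
  fixes G' :: "'v::finite graph"
  assumes N: "t \<notin> N" "\<And>C. minimal_vertex_cover G' C \<Longrightarrow> C \<inter> (N \<union> {t}) = {}"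
  shows "(\<lambda>f. (\<Prod>v\<in>N. var v) * var t * f) ` cover_ideal G' =
      (\<lambda>f. var t * f) ` (exp_ideal (up_closure (cover_exp ` (\<lambda>C. N \<union> C) ` {C. minimal_vertex_cover G' C})) :: ('v, 'k::field) mpoly set)"
    and "(\<lambda>f. (\<Prod>v\<in>N. var v) * var t * f) ` cover_ideal G' =
      (Idl\<^bsub>poly_ring\<^esub> (mon ` cover_exp ` (\<lambda>C. N \<union> {t} \<union> C) ` {C. minimal_vertex_cover G' C}) :: ('v, 'k::field) mpoly set)"
proof -
  let ?M = "{C. minimal_vertex_cover G' C}"
  have t: "var t = (mon (cover_exp {t}) :: ('v, 'k) mpoly)" by (simp add: var_def cover_exp_def)
  have 1: "(+) (cover_exp N) ` cover_exp ` ?M = cover_exp ` (\<lambda>C. N \<union> C) ` ?M"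
    by (rule mon_cover_exp_image) (use N in blast)
  have 2: "(+) (cover_exp {t}) ` cover_exp ` (\<lambda>C. N \<union> C) ` ?M = cover_exp ` (\<lambda>C. {t} \<union> C) ` (\<lambda>C. N \<union> C) ` ?M"
    by (rule mon_cover_exp_image) (use N in blast)
  have "(\<lambda>f. (\<Prod>v\<in>N. var v) * var t * f) ` cover_ideal G' =
      (\<lambda>f. var t * f) ` (\<lambda>f. mon (cover_exp N) * f) ` (cover_ideal G' :: ('v, 'k) mpoly set)"
    by (simp add: image_image prod_var ac_simps)
  then show eq: "(\<lambda>f. (\<Prod>v\<in>N. var v) * var t * f) ` cover_ideal G' =
      (\<lambda>f. var t * f) ` (exp_ideal (up_closure (cover_exp ` (\<lambda>C. N \<union> C) ` ?M)) :: ('v, 'k) mpoly set)"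
    unfolding cover_ideal_eq Idl_mon mon_times_exp_ideal 1 .
  show "(\<lambda>f. (\<Prod>v\<in>N. var v) * var t * f) ` cover_ideal G' =
      (Idl\<^bsub>poly_ring\<^esub> (mon ` cover_exp ` (\<lambda>C. N \<union> {t} \<union> C) ` ?M) :: ('v, 'k) mpoly set)"
    unfolding eq unfolding t mon_times_exp_ideal 2 Idl_mon by (simp add: image_image)
qed

theorem proposition2p3:
  fixes G G\<^sub>1 G\<^sub>2 :: "'v::finite graph" and n :: nat and x y :: "nat \<Rightarrow> 'v" and A B :: "nat set"
  assumes "simple_graph G" and "verts G = UNIV" and "card (verts G) = 2 * n"
    and "very_well_covered TYPE('k::field) G"
    and "cohen_macaulay_graph TYPE('k) G"
    and "standard_labelling G n x y"
    and "A \<subseteq> {1..<n}" and "closed_nbhd G (x n) = x ` A \<union> {x n, y n}"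
    and "B \<subseteq> {1..<n}" and "closed_nbhd G (y n) = x ` B \<union> {x n, y n}"
    and "G\<^sub>1 = delete_verts G (x ` A \<union> y ` A \<union> {x n, y n})"
    and "G\<^sub>2 = delete_verts G (x ` B \<union> y ` B \<union> {x n, y n})"
  shows "betti_splitting (cover_ideal G :: ('v, 'k) mpoly set)
           ((\<lambda>f. (\<Prod>i\<in>A. var (x i)) * var (y n) * f) ` cover_ideal G\<^sub>1)
           ((\<lambda>f. (\<Prod>j\<in>B. var (x j)) * var (x n) * f) ` cover_ideal G\<^sub>2)"
proof -
  note G = \<open>simple_graph G\<close> and std = \<open>standard_labelling G n x y\<close>
  have unm: "unmixed G" using assms(4) by (simp add: very_well_covered_def)
  \<comment> \<open>The type of variables is nonempty, so the last index \<open>n\<close> does name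
    a pair of vertices.\<close>
  have "n \<ge> 1"
  proof (rule ccontr)
    assume "\<not> n \<ge> 1"
    then have "card (verts G) = 0" using assms(3) by simp
    then show False using assms(2) by simp
  qed
  then have nn: "n \<in> {1..n}" by simp
  note inj = standard_labellingD(1-3)[OF std]
  have sub: "A \<subseteq> {1..n}" "B \<subseteq> {1..n}" using assms(7,9) by auto
  have ne: "x n \<noteq> y n" using inj(3) nn by blast
  have yx: "y n \<notin> x ` D" if "D \<subseteq> {1..n}" for D using inj(3) nn that by blast
  have xx: "x n \<notin> x ` D" if "D \<subseteq> {1..<n}" for D
  proof
    assume "x n \<in> x ` D"
    then obtain i where i: "i \<in> D" "x n = x i" by blast
    then have "n = i" using inj_onD[OF inj(1) i(2) nn] that by auto
    then show False using i(1) that by auto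
  qed
  let ?M = "\<lambda>G. {C. minimal_vertex_cover G C}"
  have VC: "C \<subseteq> verts G - W" if "minimal_vertex_cover (delete_verts G W) C" for C W
    using that by (auto simp: minimal_vertex_cover_def vertex_cover_def delete_verts_def)
  have ny1: "\<And>a t. a \<in> A \<Longrightarrow> {y a, t} \<in> edges G \<Longrightarrow> t \<in> x ` A \<union> {y n}"
    by (rule neighbours_of_matched_vertices[OF G std _ \<open>n \<ge> 1\<close> assms(7,8)]) simp_all
  have nb2: "closed_nbhd G (y n) = x ` B \<union> {y n, x n}" using assms(10) by (simp add: insert_commute)
  have ny2: "\<And>a t. a \<in> B \<Longrightarrow> {y a, t} \<in> edges G \<Longrightarrow> t \<in> x ` B \<union> {x n}"
    by (rule neighbours_of_matched_vertices[OF G std _ \<open>n \<ge> 1\<close> assms(9) nb2]) simp_all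
  have M1: "{C. minimal_vertex_cover G C \<and> x n \<notin> C} = (\<lambda>C. x ` A \<union> {y n} \<union> C) ` ?M G\<^sub>1"
    unfolding assms(11)
    by (rule minimal_covers_avoiding[OF G std unm sub(1) ne yx[OF sub(1)] xx[OF assms(7)] assms(8) ny1])
  have M2': "{C. minimal_vertex_cover G C \<and> y n \<notin> C} = (\<lambda>C. x ` B \<union> {x n} \<union> C) ` ?M (delete_verts G (x ` B \<union> y ` B \<union> {y n, x n}))"
    by (rule minimal_covers_avoiding[OF G std unm sub(2) ne[symmetric] xx[OF assms(9)] yx[OF sub(2)] nb2 ny2])
  \<comment> \<open>Unmixedness excludes having both, the edge \<open>{x n, y n}\<close> excludes
    having neither. Covers avoiding \<open>y n\<close> are thus those containing \<open>x n\<close>,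
    and the two families partition the minimal covers.\<close>
  have one: "x n \<in> C \<longleftrightarrow> y n \<notin> C" if "minimal_vertex_cover G C" for C
  proof
    show "y n \<notin> C" if "x n \<in> C"
      by (rule unmixed_cover_one_of_each_pair[OF std unm \<open>minimal_vertex_cover G C\<close> nn that])
    show "x n \<in> C" if "y n \<notin> C"
      using standard_labellingD(7)[OF std nn] that \<open>minimal_vertex_cover G C\<close>
      by (auto simp: minimal_vertex_cover_def vertex_cover_def)
  qed
  have "{C. minimal_vertex_cover G C \<and> y n \<notin> C} = {C. minimal_vertex_cover G C \<and> x n \<in> C}" using one by blast
  then have M2: "{C. minimal_vertex_cover G C \<and> x n \<in> C} = (\<lambda>C. x ` B \<union> {x n} \<union> C) ` ?M G\<^sub>2"
    using M2' unfolding assms(12) by (simp add: insert_commute)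
  define P :: "('v, 'k) mpoly set" where "P = (\<lambda>f. (\<Prod>i\<in>A. var (x i)) * var (y n) * f) ` cover_ideal G\<^sub>1"
  define Q :: "('v, 'k) mpoly set" where "Q = (\<lambda>f. (\<Prod>j\<in>B. var (x j)) * var (x n) * f) ` cover_ideal G\<^sub>2"
  have prodA: "(\<Prod>i\<in>A. var (x i)) = (\<Prod>v\<in>x ` A. (var v :: ('v, 'k) mpoly))"
    using inj_on_subset[OF inj(1) sub(1)] by (simp add: prod.reindex)
  have prodB: "(\<Prod>i\<in>B. var (x i)) = (\<Prod>v\<in>x ` B. (var v :: ('v, 'k) mpoly))"
    using inj_on_subset[OF inj(1) sub(2)] by (simp add: prod.reindex)
  have disj1: "C \<inter> (x ` A \<union> {x n, y n}) = {}" if "minimal_vertex_cover G\<^sub>1 C" for C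
    using VC[of _ C] that unfolding assms(11) by blast
  have disj2: "C \<inter> (x ` B \<union> {x n, y n}) = {}" if "minimal_vertex_cover G\<^sub>2 C" for C
    using VC[of _ C] that unfolding assms(12) by blast
  define EP EQ where "EP = cover_exp ` (\<lambda>C. x ` A \<union> C) ` ?M G\<^sub>1" and "EQ = cover_exp ` (\<lambda>C. x ` B \<union> C) ` ?M G\<^sub>2"
  have P: "P = (\<lambda>f. var (y n) * f) ` exp_ideal (up_closure EP)"
    "P = Idl\<^bsub>poly_ring\<^esub> (mon ` cover_exp ` {C. minimal_vertex_cover G C \<and> x n \<notin> C})"
    unfolding P_def EP_def M1 prodA
    by (rule cover_ideal_part; use yx[OF sub(1)] disj1 in blast)+
  have Q: "Q = (\<lambda>f. var (x n) * f) ` exp_ideal (up_closure EQ)"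
    "Q = Idl\<^bsub>poly_ring\<^esub> (mon ` cover_exp ` {C. minimal_vertex_cover G C \<and> x n \<in> C})"
    unfolding Q_def EQ_def M2 prodB
    by (rule cover_ideal_part; use xx[OF assms(9)] disj2 in blast)+
  have I: "cover_ideal G = (Idl\<^bsub>poly_ring\<^esub> (mon ` cover_exp ` ?M G) :: ('v, 'k) mpoly set)" by (rule cover_ideal_eq)
  have split: "?M G = {C. minimal_vertex_cover G C \<and> x n \<notin> C} \<union> {C. minimal_vertex_cover G C \<and> x n \<in> C}" by blast
  have sum: "cover_ideal G = P <+>\<^bsub>poly_ring\<^esub> Q"
  proof -
    have up: "up_closure (E \<union> E') = up_closure E \<union> up_closure E'" for E E' :: "('v \<Rightarrow>\<^sub>0 nat) set"
      unfolding up_closure_def by blast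
    show ?thesis unfolding I P(2) Q(2) unfolding Idl_mon exp_ideal_union unfolding split image_Un up ..
  qed
  have gens: "min_monomial_gens (Idl\<^bsub>poly_ring\<^esub> (mon ` cover_exp ` Cs)) = (mon ` cover_exp ` Cs :: ('v, 'k) mpoly set)"
    if "Cs \<subseteq> ?M G" for Cs
  proof (rule min_monomial_gens_Idl)
    fix a b assume "a \<in> cover_exp ` Cs" "a + b \<in> cover_exp ` Cs"
    then show "b = 0" using that by (intro minimal_covers_antichain[of a G b]) blast+
  qed
  have monI: "monomial_ideal (Idl\<^bsub>poly_ring\<^esub> (mon ` E) :: ('v, 'k) mpoly set)" for E
    unfolding monomial_ideal_def by (rule exI[of _ "mon ` E"]) (auto simp: monomials_def)
  \<comment> \<open>Distinct covers give distinct monomials, so the partition of the covers gives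
    disjoint sets of generators.\<close>
  have inj_mon: "inj (\<lambda>C. mon (cover_exp C) :: ('v, 'k) mpoly)"
    by (rule injI) (metis inj_cover_exp injD keys_single singleton_inject zero_neq_one)
  have "betti (cover_ideal G :: ('v, 'k) mpoly set) i j = betti P i j + betti Q i j + betti (P \<inter> Q) (i - 1) j" for i j
    unfolding sum unfolding P(1) Q(1)
  proof (rule betti_of_splitting)
    show "finite EP" "finite EQ" by (simp_all add: EP_def EQ_def)
    show "Poly_Mapping.lookup e (x n) = 0" if "e \<in> EP" for e
      using that disj1 xx[OF assms(7)] by (auto simp: EP_def lookup_cover_exp)
    show "Poly_Mapping.lookup e (x n) = 0" "Poly_Mapping.lookup e (y n) = 0" if "e \<in> EQ" for e
      using that disj2 xx[OF assms(9)] yx[OF sub(2)] by (auto simp: EQ_def lookup_cover_exp)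
  qed (rule ne)
  moreover have "min_monomial_gens (cover_ideal G :: ('v, 'k) mpoly set) = min_monomial_gens P \<union> min_monomial_gens Q"
    unfolding I P(2) Q(2) by (subst (1 2 3) gens) (auto simp: split simp flip: image_Un)
  moreover have "min_monomial_gens P \<inter> min_monomial_gens Q = {}"
  proof -
    have "min_monomial_gens P \<inter> min_monomial_gens Q = (\<lambda>C. mon (cover_exp C)) ` ({C. minimal_vertex_cover G C \<and> x n \<notin> C} \<inter> {C. minimal_vertex_cover G C \<and> x n \<in> C})"
      unfolding P(2) Q(2) image_Int[OF inj_mon] by (subst (1 2) gens) (auto simp: image_image)
    then show ?thesis by auto
  qed
  ultimately have "betti_splitting (cover_ideal G) P Q"
    unfolding betti_splitting_def using sum monI I P(2) Q(2) by metis
  then show ?thesis unfolding P_def Q_def .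
qed

end
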